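(* Let $p$ be a prime number and let $G=H\rtimes\Gamma$ be a profinite group, where $H$ and $\Gamma$ are closed subgroups each isomorphic to the additive group $\mathbb{Z}_p$. Let $\Lambda(G)=\mathbb{Z}_p[\![G]\!]$, $\Lambda(H)=\mathbb{Z}_p[\![H]\!]$, $\Lambda(\Gamma)=\mathbb{Z}_p[\![\Gamma]\!]$. Let $X$ be a finitely generated $\Lambda(G)$-module which is $p$-torsion (i.e. $\mathbb{Z}_p$-torsion), and suppose there is an exact sequence of finitely generated $\Lambda(G)$-modules $$0\rightarrow A\rightarrow X\xrightarrow{\varphi}\bigoplus_{i=1}^s\Lambda(G)/p^{m_i}\Lambda(G)\rightarrow B\rightarrow 0$$ with $A$, $B$ pseudo-null $\Lambda(G)$-modules which are finitely generated over $\Lambda(H)$. For $m\geq 0$ let $X_{H_m}:=X/I_{H_m}X$ (a finitely generated $\Lambda(\Gamma)$-module) and let $X'_{H_m}$ be the maximal finite $\Lambda(\Gamma)$-submodule of $X_{H_m}$. Then there exist $\mu_A,\nu_A$ depending on $A$ and $\nu_B\in\mathbb{Z}$ depending on $B$ such that $$\#X'_{H_m}=p^{\mu_Ap^m+\nu_A+\nu_B}$$ for all sufficiently large $m$.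
   Context: $H_m:=H^{p^m}$ is the closed subgroup of $H$ of index $p^m$; $I_{H_m}$ is the kernel of the augmentation map $\mathbb{Z}_p[\![H_m]\!]\twoheadrightarrow\mathbb{Z}_p$, and $I_{H_m}X$ is the submodule of $X$ generated by $I_{H_m}$ acting via $\mathbb{Z}_p[\![H_m]\!]\subset\Lambda(G)$. Modules are left modules with continuous action. A finitely generated $\Lambda(G)$-module $M$ is pseudo-null if $\mathrm{Ext}^i_{\Lambda(G)}(M,\Lambda(G))=0$ for $i=0,1$. *)

theory Defs
  imports
    "HOL-Analysis.Analysis"
    "HOL-Computational_Algebra.Primes"
    "HOL-Algebra.Module"
    "HOL-Algebra.AbelCoset"
    "HOL-Algebra.Elementary_Groups"
begin

section \<open>Profinite groups\<close>

definition profinite_group :: "('g, 'c) monoid_scheme \<Rightarrow> 'g topology \<Rightarrow> bool" where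
  "profinite_group G T \<longleftrightarrow>
     group G \<and> topspace T = carrier G \<and>
     continuous_map (prod_topology T T) T (\<lambda>(x, y). x \<otimes>\<^bsub>G\<^esub> y) \<and>
     continuous_map T T (\<lambda>x. inv\<^bsub>G\<^esub> x) \<and>
     compact_space T \<and> Hausdorff_space T \<and>
     (\<forall>S. connectedin T S \<longrightarrow> (\<exists>a. S \<subseteq> {a}))"

definition top_group_isomorphic ::
    "('g, 'c) monoid_scheme \<Rightarrow> 'g topology \<Rightarrow> ('h, 'd) monoid_scheme \<Rightarrow> 'h topology \<Rightarrow> bool" where
  "top_group_isomorphic G T G' T' \<longleftrightarrow> (\<exists>f. f \<in> iso G G' \<and> homeomorphic_map T T' f)"

definition open_normal :: "('g, 'c) monoid_scheme \<Rightarrow> 'g topology \<Rightarrow> 'g set set" where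
  "open_normal G T = {U. U \<lhd> G \<and> openin T U}"


section \<open>The ring of p-adic integers\<close>

text \<open>The inverse limit of the rings \<open>\<int>/p\<^sup>n\<close>, residue classes being represented by
  their members in \<open>{0..<p\<^sup>n}\<close>; the topology is the inverse limit topology.\<close>

definition Zp :: "nat \<Rightarrow> (nat \<Rightarrow> int) ring" where
  "Zp p = \<lparr>carrier = {x. \<forall>n. x n \<in> {0..<int p ^ n} \<and> x (Suc n) mod int p ^ n = x n},
           mult = (\<lambda>x y n. (x n * y n) mod int p ^ n),
           one = (\<lambda>n. 1 mod int p ^ n),
           zero = (\<lambda>n. 0),
           add = (\<lambda>x y n. (x n + y n) mod int p ^ n)\<rparr>"

definition Zp_top :: "nat \<Rightarrow> (nat \<Rightarrow> int) topology" where
  "Zp_top p = subtopology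
     (product_topology (\<lambda>n. discrete_topology {0..<int p ^ n}) UNIV) (carrier (Zp p))"


section \<open>Completed group rings\<close>

text \<open>Group ring of a finite group \<open>Q\<close> over \<open>R\<close>, as functions \<open>Q \<rightarrow> R\<close> under convolution.\<close>

definition group_ring ::
    "('r, 'c) ring_scheme \<Rightarrow> ('q, 'd) monoid_scheme \<Rightarrow> ('q \<Rightarrow> 'r) ring" where
  "group_ring R Q = \<lparr>carrier = carrier Q \<rightarrow>\<^sub>E carrier R,
     mult = (\<lambda>f g. \<lambda>x\<in>carrier Q. \<Oplus>\<^bsub>R\<^esub>y\<in>carrier Q. f y \<otimes>\<^bsub>R\<^esub> g (inv\<^bsub>Q\<^esub> y \<otimes>\<^bsub>Q\<^esub> x)),
     one = (\<lambda>x\<in>carrier Q. if x = \<one>\<^bsub>Q\<^esub> then \<one>\<^bsub>R\<^esub> else \<zero>\<^bsub>R\<^esub>),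
     zero = (\<lambda>x\<in>carrier Q. \<zero>\<^bsub>R\<^esub>),
     add = (\<lambda>f g. \<lambda>x\<in>carrier Q. f x \<oplus>\<^bsub>R\<^esub> g x)\<rparr>"

text \<open>For a subgroup \<open>K\<close> of \<open>G\<close> and \<open>V \<subseteq> K\<close>, \<open>V \<subseteq> U\<close>, the map \<open>R[K/V] \<rightarrow> R[G/U]\<close> induced by
  \<open>K/V \<rightarrow> G/U\<close>: this homomorphism sends a coset \<open>D\<close> of \<open>V\<close> to the coset \<open>C\<close> of \<open>U\<close>
  containing it.\<close>

definition push_cosets ::
    "('r, 'c) ring_scheme \<Rightarrow> 'g set monoid \<Rightarrow> 'g set monoid \<Rightarrow> ('g set \<Rightarrow> 'r) \<Rightarrow> 'g set \<Rightarrow> 'r" where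
  "push_cosets R Q Q' x = (\<lambda>C\<in>carrier Q'. \<Oplus>\<^bsub>R\<^esub>D\<in>{D \<in> carrier Q. D \<subseteq> C}. x D)"

type_synonym 'g completed = "'g set \<Rightarrow> 'g set \<Rightarrow> nat \<Rightarrow> int"

text \<open>\<open>\<int>\<^sub>p[[G]]\<close> is the inverse limit of \<open>\<int>\<^sub>p[G/U]\<close> over the open normal subgroups \<open>U\<close>.\<close>

definition Iwasawa :: "nat \<Rightarrow> ('g, 'c) monoid_scheme \<Rightarrow> 'g topology \<Rightarrow> 'g completed ring" where
  "Iwasawa p G T =
     (let N = open_normal G T; A = (\<lambda>U. group_ring (Zp p) (G Mod U)) in
      \<lparr>carrier = {x \<in> (\<Pi>\<^sub>E U\<in>N. carrier (A U)).
          \<forall>U\<in>N. \<forall>V\<in>N. U \<subseteq> V \<longrightarrow> push_cosets (Zp p) (G Mod U) (G Mod V) (x U) = x V},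
       mult = (\<lambda>x y. \<lambda>U\<in>N. x U \<otimes>\<^bsub>A U\<^esub> y U),
       one = (\<lambda>U\<in>N. \<one>\<^bsub>A U\<^esub>),
       zero = (\<lambda>U\<in>N. \<zero>\<^bsub>A U\<^esub>),
       add = (\<lambda>x y. \<lambda>U\<in>N. x U \<oplus>\<^bsub>A U\<^esub> y U)\<rparr>)"

definition Iwasawa_top :: "nat \<Rightarrow> ('g, 'c) monoid_scheme \<Rightarrow> 'g topology \<Rightarrow> 'g completed topology" where
  "Iwasawa_top p G T = subtopology
     (product_topology (\<lambda>U. product_topology (\<lambda>_. Zp_top p) (carrier (G Mod U))) (open_normal G T))
     (carrier (Iwasawa p G T))"

text \<open>For a closed subgroup \<open>K\<close> of \<open>G\<close>: the ring \<open>\<int>\<^sub>p[[K]]\<close>, its augmentation ideal (the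
  augmentation is the projection onto \<open>\<int>\<^sub>p[K/K] = \<int>\<^sub>p\<close>), and the embedding \<open>\<int>\<^sub>p[[K]] \<rightarrow> \<int>\<^sub>p[[G]]\<close>.\<close>

definition Iwasawa_sub ::
    "nat \<Rightarrow> ('g, 'c) monoid_scheme \<Rightarrow> 'g topology \<Rightarrow> 'g set \<Rightarrow> 'g completed ring" where
  "Iwasawa_sub p G T K = Iwasawa p (G\<lparr>carrier := K\<rparr>) (subtopology T K)"

definition aug_ideal ::
    "nat \<Rightarrow> ('g, 'c) monoid_scheme \<Rightarrow> 'g topology \<Rightarrow> 'g set \<Rightarrow> 'g completed set" where
  "aug_ideal p G T K = a_kernel (Iwasawa_sub p G T K) (Zp p) (\<lambda>x. x K K)"

definition Iwasawa_emb ::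
    "nat \<Rightarrow> ('g, 'c) monoid_scheme \<Rightarrow> 'g topology \<Rightarrow> 'g set \<Rightarrow> 'g completed \<Rightarrow> 'g completed" where
  "Iwasawa_emb p G T K x = (\<lambda>U\<in>open_normal G T.
     push_cosets (Zp p) (G\<lparr>carrier := K\<rparr> Mod (U \<inter> K)) (G Mod U) (x (U \<inter> K)))"


section \<open>Left modules\<close>

text \<open>The library locale \<^locale>\<open>module\<close> requires a commutative ring; here its remaining axioms are
  reused over an arbitrary ring. The multiplication and the unit of the record \<open>M\<close> play no role.\<close>

locale left_module = R?: ring R + M?: abelian_group M
  for R :: "('r, 'c) ring_scheme" (structure) and M :: "('r, 'm, 'd) module_scheme" (structure) +
  assumes smult_axioms: "module_axioms R M"

definition lin_maps ::
    "('r, 'c) ring_scheme \<Rightarrow> ('r, 'm, 'd) module_scheme \<Rightarrow> ('r, 'n, 'e) module_scheme \<Rightarrow> ('m \<Rightarrow> 'n) set" where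
  "lin_maps R M N = {f \<in> carrier M \<rightarrow> carrier N.
     (\<forall>x\<in>carrier M. \<forall>y\<in>carrier M. f (x \<oplus>\<^bsub>M\<^esub> y) = f x \<oplus>\<^bsub>N\<^esub> f y) \<and>
     (\<forall>r\<in>carrier R. \<forall>x\<in>carrier M. f (r \<odot>\<^bsub>M\<^esub> x) = r \<odot>\<^bsub>N\<^esub> f x)}"

definition lspan :: "('r, 'c) ring_scheme \<Rightarrow> ('r, 'm, 'd) module_scheme \<Rightarrow> 'm set \<Rightarrow> 'm set" where
  "lspan R M S = \<Inter>{N. submodule N R M \<and> S \<subseteq> N}"

definition fin_gen :: "('r, 'c) ring_scheme \<Rightarrow> ('r, 'm, 'd) module_scheme \<Rightarrow> bool" where
  "fin_gen R M \<longleftrightarrow> (\<exists>S. finite S \<and> S \<subseteq> carrier M \<and> lspan R M S = carrier M)"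

definition restrict_scalars ::
    "('s \<Rightarrow> 'r) \<Rightarrow> ('r, 'm) module \<Rightarrow> ('s, 'm) module" where
  "restrict_scalars h M = \<lparr>carrier = carrier M, mult = mult M, one = one M, zero = zero M,
     add = add M, smult = (\<lambda>s x. h s \<odot>\<^bsub>M\<^esub> x)\<rparr>"

definition regular_module :: "('r, 'c) ring_scheme \<Rightarrow> ('r, 'r) module" where
  "regular_module R = \<lparr>carrier = carrier R, mult = mult R, one = one R, zero = zero R,
     add = add R, smult = mult R\<rparr>"

definition quot_module ::
    "('r, 'm) module \<Rightarrow> 'm set \<Rightarrow> ('r, 'm set) module" where
  "quot_module M N = \<lparr>carrier = a_rcosets\<^bsub>M\<^esub> N, mult = undefined, one = undefined, zero = N,
     add = set_add M, smult = (\<lambda>r C. \<Union>x\<in>C. N +>\<^bsub>M\<^esub> (r \<odot>\<^bsub>M\<^esub> x))\<rparr>"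

text \<open>For finite \<open>I\<close>, where direct sum and direct product agree.\<close>

definition direct_sum :: "'i set \<Rightarrow> ('i \<Rightarrow> ('r, 'm) module) \<Rightarrow> ('r, 'i \<Rightarrow> 'm) module" where
  "direct_sum I M = \<lparr>carrier = (\<Pi>\<^sub>E i\<in>I. carrier (M i)), mult = undefined, one = undefined,
     zero = (\<lambda>i\<in>I. \<zero>\<^bsub>M i\<^esub>), add = (\<lambda>x y. \<lambda>i\<in>I. x i \<oplus>\<^bsub>M i\<^esub> y i),
     smult = (\<lambda>r x. \<lambda>i\<in>I. r \<odot>\<^bsub>M i\<^esub> x i)\<rparr>"

text \<open>Left modules with continuous action. A finitely generated module over
  a completed group ring of a compact \<open>p\<close>-adic analytic group carries exactly one such topology,
  and linear maps between such modules are continuous, so the topology is not kept as data.\<close>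

definition continuous_module ::
    "('r, 'c) ring_scheme \<Rightarrow> 'r topology \<Rightarrow> ('r, 'm, 'd) module_scheme \<Rightarrow> bool" where
  "continuous_module R TR M \<longleftrightarrow> left_module R M \<and>
     (\<exists>T. topspace T = carrier M \<and> compact_space T \<and> Hausdorff_space T \<and>
        continuous_map (prod_topology T T) T (\<lambda>(x, y). x \<oplus>\<^bsub>M\<^esub> y) \<and>
        continuous_map (prod_topology TR T) T (\<lambda>(r, x). r \<odot>\<^bsub>M\<^esub> x))"

definition p_torsion :: "nat \<Rightarrow> ('r, 'm, 'd) module_scheme \<Rightarrow> bool" where
  "p_torsion p M \<longleftrightarrow> (\<forall>x\<in>carrier M. \<exists>n::nat. add_pow M (p ^ n) x = \<zero>\<^bsub>M\<^esub>)"

definition mod_by :: "('r, 'm) module \<Rightarrow> nat \<Rightarrow> ('r, 'm set) module" where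
  "mod_by M n = quot_module M ((\<lambda>x. add_pow M n x) ` carrier M)"

definition max_finite_submodule ::
    "('r, 'c) ring_scheme \<Rightarrow> ('r, 'm, 'd) module_scheme \<Rightarrow> 'm set \<Rightarrow> bool" where
  "max_finite_submodule R M N \<longleftrightarrow> submodule N R M \<and> finite N \<and>
     (\<forall>N'. submodule N' R M \<and> finite N' \<longrightarrow> N' \<subseteq> N)"


section \<open>Ext groups and pseudo-null modules\<close>

definition free_module :: "('r, 'c) ring_scheme \<Rightarrow> nat \<Rightarrow> ('r, nat \<Rightarrow> 'r) module" where
  "free_module R n = direct_sum {..<n} (\<lambda>_. regular_module R)"

text \<open>A resolution \<open>\<dots> \<rightarrow> R\<^bsup>n 1\<^esup> \<rightarrow> R\<^bsup>n 0\<^esup> \<rightarrow> M \<rightarrow> 0\<close> with differentials \<open>d i : R\<^bsup>n (i+1)\<^esup> \<rightarrow> R\<^bsup>n i\<^esup>\<close>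
  and augmentation \<open>e\<close>.\<close>

definition free_resolution ::
    "('r, 'c) ring_scheme \<Rightarrow> ('r, 'm, 'd) module_scheme \<Rightarrow>
     (nat \<Rightarrow> nat) \<Rightarrow> (nat \<Rightarrow> (nat \<Rightarrow> 'r) \<Rightarrow> nat \<Rightarrow> 'r) \<Rightarrow> ((nat \<Rightarrow> 'r) \<Rightarrow> 'm) \<Rightarrow> bool" where
  "free_resolution R M n d e \<longleftrightarrow>
     (let F = (\<lambda>i. free_module R (n i)) in
      e \<in> lin_maps R (F 0) M \<and> (\<forall>i. d i \<in> lin_maps R (F (Suc i)) (F i)) \<and>
      e ` carrier (F 0) = carrier M \<and>
      a_kernel (F 0) M e = d 0 ` carrier (F 1) \<and>
      (\<forall>i. a_kernel (F (Suc i)) (F i) (d i) = d (Suc i) ` carrier (F (Suc (Suc i)))))"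

definition hom_group ::
    "('r, 'c) ring_scheme \<Rightarrow> ('r, 'm, 'd) module_scheme \<Rightarrow> ('r, 'n, 'e) module_scheme \<Rightarrow> ('m \<Rightarrow> 'n) monoid" where
  "hom_group R M N = \<lparr>carrier = lin_maps R M N \<inter> extensional (carrier M),
     mult = (\<lambda>f g. \<lambda>x\<in>carrier M. f x \<oplus>\<^bsub>N\<^esub> g x),
     one = (\<lambda>x\<in>carrier M. \<zero>\<^bsub>N\<^esub>)\<rparr>"

text \<open>The \<open>i\<close>-th cohomology group of the complex \<open>Hom(F\<^sub>0, N) \<rightarrow> Hom(F\<^sub>1, N) \<rightarrow> \<dots>\<close>.\<close>

definition Ext_group ::
    "('r, 'c) ring_scheme \<Rightarrow> ('r, 'k, 'd) module_scheme \<Rightarrow>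
     (nat \<Rightarrow> nat) \<Rightarrow> (nat \<Rightarrow> (nat \<Rightarrow> 'r) \<Rightarrow> nat \<Rightarrow> 'r) \<Rightarrow> nat \<Rightarrow> ((nat \<Rightarrow> 'r) \<Rightarrow> 'k) set monoid" where
  "Ext_group R N n d i =
     (let C = (\<lambda>j. hom_group R (free_module R (n j)) N);
          \<delta> = (\<lambda>j f. \<lambda>x\<in>carrier (free_module R (n (Suc j))). f (d j x));
          Z = kernel (C i) (C (Suc i)) (\<delta> i);
          B = (case i of 0 \<Rightarrow> {\<one>\<^bsub>C 0\<^esub>} | Suc j \<Rightarrow> \<delta> j ` carrier (C j))
      in (C i)\<lparr>carrier := Z\<rparr> Mod B)"

text \<open>The Ext groups do not depend on the resolution. Resolutions by finitely generated
  free modules exist for every finitely generated module when \<open>R\<close> is Noetherian, as is the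
  Iwasawa algebra of a compact \<open>p\<close>-adic analytic group.\<close>

definition pseudo_null :: "('r, 'c) ring_scheme \<Rightarrow> ('r, 'm, 'd) module_scheme \<Rightarrow> bool" where
  "pseudo_null R M \<longleftrightarrow> (\<exists>n d e. free_resolution R M n d e \<and>
     (\<forall>i\<in>{0, 1}. trivial_group (Ext_group R (regular_module R) n d i)))"


section \<open>The quotients by the augmentation ideals\<close>

definition power_subgroup :: "('g, 'c) monoid_scheme \<Rightarrow> 'g set \<Rightarrow> nat \<Rightarrow> 'g set" where
  "power_subgroup G H n = (\<lambda>h. h [^]\<^bsub>G\<^esub> n) ` H"

text \<open>The quotient of the \<open>\<int>\<^sub>p[[G]]\<close>-module \<open>X\<close> by its submodule \<open>I\<^sub>K X\<close>, where \<open>K\<close> is a closed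
  subgroup of \<open>G\<close> and \<open>I\<^sub>K\<close> is the augmentation ideal of \<open>\<int>\<^sub>p[[K]]\<close>.\<close>

definition coinvariants ::
    "nat \<Rightarrow> ('g, 'c) monoid_scheme \<Rightarrow> 'g topology \<Rightarrow> 'g set \<Rightarrow>
     ('g completed, 'x) module \<Rightarrow> ('g completed, 'x set) module" where
  "coinvariants p G T K X = quot_module X
     (lspan (Iwasawa p G T) X
        {Iwasawa_emb p G T K a \<odot>\<^bsub>X\<^esub> x |a x. a \<in> aug_ideal p G T K \<and> x \<in> carrier X})"

end

theory Submission
  imports Defs "HOL-Computational_Algebra.Polynomial" "HOL-Algebra.Sylow"
    "HOL-Algebra.Multiplicative_Group" "HOL-Algebra.Zassenhaus"
begin

text \<open>
  Let \<open>h\<close> generate \<open>H\<close> and put \<open>\<omega>\<^sub>k = h ^ (p ^ k) - 1\<close>. Then \<open>X\<^bsub>H\<^sub>k\<^esub> = X/\<omega>\<^sub>k X\<close>. On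
  \<open>E = \<Oplus> \<Lambda>(G)/p ^ m\<^sub>i\<close> the element \<open>\<omega>\<^sub>k\<close> is injective and \<open>E/\<omega>\<^sub>k E\<close> has no finite
  \<open>\<Lambda>(\<Gamma>)\<close>-submodules except \<open>0\<close>, so the maximal finite submodule of \<open>X/\<omega>\<^sub>k X\<close> is \<open>F/\<omega>\<^sub>k X\<close>, where
  \<open>F\<close> is the preimage of \<open>\<omega>\<^sub>k E\<close> under \<open>\<phi>\<close>, and the exact sequence gives
  \<open>#(F/\<omega>\<^sub>k X) = [A : \<omega>\<^sub>k A] \<cdot> #B[\<omega>\<^sub>k]\<close>.

  With \<open>t = h - 1\<close> we have \<open>\<omega>\<^sub>k \<equiv> t ^ (p ^ k)\<close> modulo \<open>p\<close>. On \<open>A\<close> and \<open>B\<close>, which have finite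
  exponent and are finitely generated over \<open>\<Lambda>(H)\<close>, the kernels of \<open>\<omega>\<^sub>k\<close> become stationary and
  \<open>[A : \<omega>\<^sub>k A] = [D : t D] ^ (p ^ k) \<cdot> #A[\<omega>\<^sub>k]\<close>, where \<open>D = t ^ n A\<close> with \<open>n\<close> so large that \<open>t\<close> is
  injective on \<open>D\<close>.
\<close>

section \<open>Indices of subgroups\<close>

text \<open>Elements of the noncommutative algebra \<Lambda>(G) are handled as p-adic measures on G:
  \<open>a U C n\<close> is the mass of the coset C of U modulo p^n, and multiplication by g - 1
  from the left compares a measure with its translate. Two facts carry the claims about E. The right
  ideal of \<omega>_k consists of the measures that vanish on G/H^(p^k): on a finite quotient a = (g
  - 1) b is solvable exactly when the orbit sums of a vanish, and compactness glues the finite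
  solutions. And a measure modulo p^m invariant under a nontrivial power of h, or on G/H^(p^k) under
  a nontrivial power of a generator of \<Gamma>, is zero, because its value is a sum over orbits
  whose lengths on finer quotients are divisible by p^m. In the count on A the obstacle is that
  \<omega>_k and t^(p^k) agree only modulo p; induction over the exponent shows that they
  nevertheless have the same index in D. The existence of D rests on the descending indices
  [t^n A : t^(n+1) A]. The constants are p^\<mu> = [D : tD] and p^\<nu> = #A[\<omega>_k] for A, and
  p^\<nu> = #B[\<omega>_k] for B, with k large.\<close>

lemma card_image_eq_card_image:
  assumes "u ` D = D'" "\<And>x y. x \<in> D \<Longrightarrow> y \<in> D \<Longrightarrow> f x = f y \<longleftrightarrow> g (u x) = g (u y)"
  shows "card (f ` D) = card (g ` D')"
proof -
  have 1: "inv_into D f (f x) \<in> D \<and> f (inv_into D f (f x)) = f x" if "x \<in> D" for x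
    using that by (simp add: f_inv_into_f inv_into_into)
  have "bij_betw (\<lambda>c. g (u (inv_into D f c))) (f ` D) (g ` D')"
  proof (rule bij_betw_imageI)
    show "inj_on (\<lambda>c. g (u (inv_into D f c))) (f ` D)"
      using 1 assms(2) by (auto simp: inj_on_def) metis
    have "g (u (inv_into D f (f x))) = g (u x)" if "x \<in> D" for x
      using 1[OF that] assms(2) that by blast
    then show "(\<lambda>c. g (u (inv_into D f c))) ` f ` D = g ` D'"
      using assms(1) by (force simp: image_iff)
  qed
  then show ?thesis by (rule bij_betw_same_card)
qed

text \<open>The number of cosets of S that meet D, counted without forming a quotient group. As
  \<open>card\<close> of an infinite set is 0, positivity of \<open>index\<close> expresses finite
  index for nonempty D, and this is how finiteness is carried through the proof.\<close>

definition index :: "('a, 'b) monoid_scheme \<Rightarrow> 'a set \<Rightarrow> 'a set \<Rightarrow> nat" where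
  "index G D S = card ((\<lambda>d. S #>\<^bsub>G\<^esub> d) ` D)"

context group
begin

lemma rcos_eq_iff:
  assumes "subgroup S G" "x \<in> carrier G" "y \<in> carrier G"
  shows "S #> x = S #> y \<longleftrightarrow> x \<otimes> inv y \<in> S"
proof
  assume "S #> x = S #> y"
  then have "x \<in> S #> y" using rcos_self[OF assms(2,1)] by simp
  then obtain s where "s \<in> S" "x = s \<otimes> y" by (auto simp: r_coset_def)
  then show "x \<otimes> inv y \<in> S" using assms subgroup.mem_carrier[OF assms(1)] by (simp add: m_assoc)
next
  assume "x \<otimes> inv y \<in> S"
  moreover have "x = (x \<otimes> inv y) \<otimes> y" using assms by (simp add: m_assoc)
  ultimately have "x \<in> S #> y" unfolding r_coset_def by blast
  then show "S #> x = S #> y" using repr_independence[OF _ assms(3,1)] by simp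
qed

text \<open>If h (x y^-1) = h s with s in S, then x y^-1 s^-1 lies in D and in the kernel of h,
  hence in S. So x and y share a coset of S exactly when their images share a coset of h(S).\<close>

lemma index_hom:
  assumes "h \<in> hom G G'" "group G'" "subgroup D G" "subgroup S G" "S \<subseteq> D"
    "\<And>x. x \<in> D \<Longrightarrow> h x = \<one>\<^bsub>G'\<^esub> \<Longrightarrow> x \<in> S"
  shows "index G' (h ` D) (h ` S) = index G D S"
proof -
  interpret h: group_hom G G' h using assms by (simp add: group_hom_def group_hom_axioms_def is_group)
  have hS: "subgroup (h ` S) G'" using assms(4) h.subgroup_img_is_subgroup by blast
  have "card ((\<lambda>d. S #> d) ` D) = card ((\<lambda>d. (h ` S) #>\<^bsub>G'\<^esub> d) ` h ` D)"
  proof (rule card_image_eq_card_image[where u = h])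
    fix x y assume xy: "x \<in> D" "y \<in> D"
    then have c: "x \<in> carrier G" "y \<in> carrier G" using subgroup.mem_carrier[OF assms(3)] by auto
    have "h (x \<otimes> inv y) \<in> h ` S \<longleftrightarrow> x \<otimes> inv y \<in> S"
    proof
      assume "h (x \<otimes> inv y) \<in> h ` S"
      then obtain s where s: "s \<in> S" "h (x \<otimes> inv y) = h s" by auto
      then have sc: "s \<in> carrier G" using subgroup.mem_carrier[OF assms(4)] by auto
      have d: "x \<otimes> inv y \<in> D" using xy assms(3) by (simp add: subgroup.m_closed subgroup.m_inv_closed)
      have "(x \<otimes> inv y) \<otimes> inv s \<in> D" using s assms(5)
        by (intro subgroup.m_closed[OF assms(3) d] subgroup.m_inv_closed[OF assms(3)]) auto
      moreover have "h ((x \<otimes> inv y) \<otimes> inv s) = \<one>\<^bsub>G'\<^esub>"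
        using s sc c h.hom_mult[of "x \<otimes> inv y" "inv s"] by simp
      ultimately have "(x \<otimes> inv y) \<otimes> inv s \<in> S" using assms(6) by blast
      then have "(x \<otimes> inv y) \<otimes> inv s \<otimes> s \<in> S" using s subgroup.m_closed[OF assms(4)] by auto
      then show "x \<otimes> inv y \<in> S" using c sc by (simp add: m_assoc)
    qed simp
    moreover have "h (x \<otimes> inv y) = h x \<otimes>\<^bsub>G'\<^esub> inv\<^bsub>G'\<^esub> h y" using c by simp
    ultimately show "S #> x = S #> y \<longleftrightarrow> h ` S #>\<^bsub>G'\<^esub> h x = h ` S #>\<^bsub>G'\<^esub> h y"
      using rcos_eq_iff[OF assms(4) c] group.rcos_eq_iff[OF assms(2) hS] c by simp
  qed simp
  then show ?thesis by (simp add: index_def)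
qed

lemma index_hom_inj:
  assumes "h \<in> hom G G'" "group G'" "subgroup D G" "subgroup S G" "S \<subseteq> D"
    "\<And>x. x \<in> D \<Longrightarrow> h x = \<one>\<^bsub>G'\<^esub> \<Longrightarrow> x = \<one>"
  shows "index G' (h ` D) (h ` S) = index G D S"
  using index_hom[OF assms(1-5)] assms(4,6) subgroup.one_closed by metis

lemma index_one:
  assumes "D \<subseteq> carrier G" shows "index G D {\<one>} = card D"
proof -
  have "(\<lambda>d. {\<one>} #> d) ` D = (\<lambda>d. {d}) ` D"
    using assms by (intro image_cong) (auto simp: r_coset_def)
  moreover have "card ((\<lambda>d. {d}) ` D) = card D" by (intro card_image) auto
  ultimately show ?thesis by (simp add: index_def)
qed

end

context comm_group
begin

text \<open>Every coset of S that meets D has a representative in K, and two elements of K are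
  congruent modulo S exactly when they are congruent modulo K \<inter> S.\<close>

lemma index_second_iso:
  assumes "subgroup S G" "subgroup K G" "K \<subseteq> D" "\<And>d. d \<in> D \<Longrightarrow> \<exists>s\<in>S. \<exists>k\<in>K. d = s \<otimes> k"
  shows "index G D S = index G K (K \<inter> S)"
proof -
  have I: "subgroup (K \<inter> S) G" using assms subgroups_Inter_pair by blast
  have "(\<lambda>d. S #> d) ` D = (\<lambda>d. S #> d) ` K"
  proof
    show "(\<lambda>d. S #> d) ` D \<subseteq> (\<lambda>d. S #> d) ` K"
    proof
      fix C assume "C \<in> (\<lambda>d. S #> d) ` D"
      then obtain d where d: "d \<in> D" "C = S #> d" by auto
      then obtain s k where sk: "s \<in> S" "k \<in> K" "d = s \<otimes> k" using assms(4) by blast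
      then have c: "s \<in> carrier G" "k \<in> carrier G"
        using subgroup.mem_carrier[OF assms(1)] subgroup.mem_carrier[OF assms(2)] by auto
      then have "d \<otimes> inv k \<in> S" using sk by (simp add: m_assoc)
      then have "C = S #> k" using d sk c by (simp add: rcos_eq_iff[OF assms(1)])
      then show "C \<in> (\<lambda>d. S #> d) ` K" using sk by blast
    qed
  qed (use assms in blast)
  moreover have "card ((\<lambda>d. S #> d) ` K) = card ((\<lambda>d. (K \<inter> S) #> d) ` K)"
  proof (rule card_image_eq_card_image[where u = id])
    fix x y assume xy: "x \<in> K" "y \<in> K"
    then have "x \<in> carrier G" "y \<in> carrier G" using subgroup.mem_carrier[OF assms(2)] by auto
    moreover have "x \<otimes> inv y \<in> K" using xy assms(2) by (simp add: subgroup.m_closed subgroup.m_inv_closed)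
    ultimately show "S #> x = S #> y \<longleftrightarrow> (K \<inter> S) #> id x = (K \<inter> S) #> id y"
      using rcos_eq_iff[OF assms(1)] rcos_eq_iff[OF I] by simp
  qed simp
  ultimately show ?thesis by (simp add: index_def)
qed

text \<open>Fix a representative \<rho>(c) in E for every coset c of D. Each coset of S in E is then
  \<open>A #> \<rho> c\<close> for exactly one c and one coset A of S in D. Being a bijection, this
  gives the formula for infinite indices too, with both sides 0.\<close>

lemma index_tower:
  assumes "subgroup S G" "subgroup D G" "subgroup E G" "S \<subseteq> D" "D \<subseteq> E"
  shows "index G E S = index G E D * index G D S"
proof -
  define \<rho> where "\<rho> = inv_into E (\<lambda>e. D #> e)"
  have E: "e \<in> carrier G" if "e \<in> E" for e using that subgroup.mem_carrier[OF assms(3)] by auto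
  have S: "S \<subseteq> carrier G" using assms(1) subgroup.subset by blast
  have \<rho>: "\<rho> c \<in> E \<and> D #> \<rho> c = c" if "c \<in> (\<lambda>e. D #> e) ` E" for c
    using that by (simp add: \<rho>_def f_inv_into_f[of c "\<lambda>e. D #> e"] inv_into_into)
  have key: "(S #> d) #> e = S #> (d \<otimes> e)" if "d \<in> D" "e \<in> E" for d e
    using that E S assms(5) by (simp add: coset_mult_assoc subsetD)
  have "bij_betw (\<lambda>(c, A). A #> \<rho> c) (((\<lambda>e. D #> e) ` E) \<times> ((\<lambda>d. S #> d) ` D)) ((\<lambda>e. S #> e) ` E)"
  proof (rule bij_betw_imageI)
    show "inj_on (\<lambda>(c, A). A #> \<rho> c) (((\<lambda>e. D #> e) ` E) \<times> ((\<lambda>d. S #> d) ` D))"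
    proof (rule inj_onI, clarify)
      fix e1 d1 e2 d2 assume A: "e1 \<in> E" "d1 \<in> D" "e2 \<in> E" "d2 \<in> D"
        and eq: "(S #> d1) #> \<rho> (D #> e1) = (S #> d2) #> \<rho> (D #> e2)"
      define r1 r2 where "r1 = \<rho> (D #> e1)" and "r2 = \<rho> (D #> e2)"
      have r: "r1 \<in> E" "r2 \<in> E" "D #> r1 = D #> e1" "D #> r2 = D #> e2"
        using \<rho> A by (auto simp: r1_def r2_def)
      have c: "r1 \<in> carrier G" "r2 \<in> carrier G" "d1 \<in> carrier G" "d2 \<in> carrier G"
        using r A E assms(5) by auto
      have "S #> (d1 \<otimes> r1) = S #> (d2 \<otimes> r2)" using eq key A r by (simp add: r1_def r2_def)
      then have s: "(d1 \<otimes> r1) \<otimes> inv (d2 \<otimes> r2) \<in> S" using rcos_eq_iff[OF assms(1), of "d1 \<otimes> r1" "d2 \<otimes> r2"] c by simp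
      have "inv d1 \<otimes> ((d1 \<otimes> r1) \<otimes> inv (d2 \<otimes> r2)) \<otimes> d2 \<in> D"
        using A subsetD[OF assms(4) s] by (simp add: subgroup.m_closed[OF assms(2)] subgroup.m_inv_closed[OF assms(2)])
      also have "inv d1 \<otimes> ((d1 \<otimes> r1) \<otimes> inv (d2 \<otimes> r2)) \<otimes> d2 = r1 \<otimes> inv r2"
        using c by (simp add: inv_mult_group m_assoc) (simp flip: m_assoc)
      finally have re: "D #> e1 = D #> e2" using r rcos_eq_iff[OF assms(2) c(1,2)] by simp
      then have "r1 = r2" by (simp add: r1_def r2_def)
      moreover have "(d1 \<otimes> r2) \<otimes> inv (d2 \<otimes> r2) = d1 \<otimes> inv d2"
        using c by (simp add: inv_mult_group m_assoc) (simp flip: m_assoc)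
      ultimately have "d1 \<otimes> inv d2 \<in> S" using s by simp
      then have "S #> d1 = S #> d2" using rcos_eq_iff[OF assms(1)] c by simp
      then show "D #> e1 = D #> e2 \<and> S #> d1 = S #> d2" using re by simp
    qed
    show "(\<lambda>(c, A). A #> \<rho> c) ` (((\<lambda>e. D #> e) ` E) \<times> ((\<lambda>d. S #> d) ` D)) = (\<lambda>e. S #> e) ` E" (is "?L = ?R")
    proof
      show "?L \<subseteq> ?R"
      proof clarify
        fix e d assume A: "e \<in> E" "d \<in> D"
        then have "\<rho> (D #> e) \<in> E" using \<rho> by blast
        then have "(S #> d) #> \<rho> (D #> e) = S #> (d \<otimes> \<rho> (D #> e))" "d \<otimes> \<rho> (D #> e) \<in> E"
          using A key assms(5) by (auto intro: subgroup.m_closed[OF assms(3)])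
        then show "(S #> d) #> \<rho> (D #> e) \<in> ?R" by blast
      qed
      show "?R \<subseteq> ?L"
      proof
        fix C assume "C \<in> ?R"
        then obtain e where e: "e \<in> E" "C = S #> e" by auto
        define r where "r = \<rho> (D #> e)"
        have r: "r \<in> E" "D #> r = D #> e" using \<rho> e by (auto simp: r_def)
        have c: "r \<in> carrier G" "e \<in> carrier G" using r e E by auto
        have d: "e \<otimes> inv r \<in> D" using r(2) rcos_eq_iff[OF assms(2) c(2,1)] by simp
        have "(S #> (e \<otimes> inv r)) #> r = C" using key[OF d r(1)] c e by (simp add: m_assoc)
        then show "C \<in> ?L" using d e
          by (intro rev_image_eqI[of "(D #> e, S #> (e \<otimes> inv r))"]) (simp_all add: r_def)
      qed
    qed
  qed
  from bij_betw_same_card[OF this] show ?thesis by (simp add: index_def card_cartesian_product)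
qed

text \<open>The map D/S \<rightarrow> h(D)/h(S) induced by h has kernel SK/S, which is K/(K \<inter>
  S); the intermediate group P is SK. The formula is applied to the endomorphism t in
  \<open>index_img\<close>, to multiplication by p in \<open>index_act_cong\<close> and to
  \<omega>_k in \<open>index_omega\<close>.\<close>

lemma index_hom_ker:
  assumes h: "h \<in> hom G G'" "group G'" and "subgroup D G" "subgroup S G" "S \<subseteq> D"
  defines "K \<equiv> {x \<in> D. h x = \<one>\<^bsub>G'\<^esub>}"
  shows "index G D S = index G' (h ` D) (h ` S) * index G K (K \<inter> S)"
proof -
  interpret h: group_hom G G' h using h by (simp add: group_hom_def group_hom_axioms_def is_group)
  have K: "subgroup K G"
    using assms(3) unfolding K_def
    by (intro subgroupI) (auto simp: subgroup.mem_carrier subgroup.m_closed subgroup.m_inv_closed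
        intro: exI[of _ \<one>] subgroup.one_closed)
  define P where "P = S <#> K"
  have P: "subgroup P G" unfolding P_def by (rule mult_subgroups[OF assms(4) K])
  have SP: "S \<subseteq> P" unfolding P_def set_mult_def
  proof
    fix s assume s: "s \<in> S"
    then have "s = s \<otimes> \<one>" using subgroup.mem_carrier[OF assms(4) s] by simp
    then show "s \<in> (\<Union>h\<in>S. \<Union>k\<in>K. {h \<otimes> k})" using s subgroup.one_closed[OF K] by blast
  qed
  have PD: "P \<subseteq> D" using assms(3,5) unfolding P_def set_mult_def K_def
    by (auto intro: subgroup.m_closed)
  have KP: "K \<subseteq> P" unfolding P_def set_mult_def
  proof
    fix k assume s: "k \<in> K"
    then have "k = \<one> \<otimes> k" using subgroup.mem_carrier[OF K s] by simp
    then show "k \<in> (\<Union>h\<in>S. \<Union>k\<in>K. {h \<otimes> k})" using s subgroup.one_closed[OF assms(4)] by blast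
  qed
  have "index G D S = index G D P * index G P S" using index_tower[OF assms(4) P assms(3) SP PD] .
  moreover have "index G P S = index G K (K \<inter> S)"
    using index_second_iso[OF assms(4) K KP] unfolding P_def set_mult_def by auto
  moreover have "index G D P = index G' (h ` D) (h ` P)"
    by (rule index_hom[OF h assms(3) P PD, symmetric]) (use KP in \<open>auto simp: K_def\<close>)
  moreover have "h ` P = h ` S"
  proof
    show "h ` P \<subseteq> h ` S"
    proof clarify
      fix x assume "x \<in> P"
      then obtain s k where sk: "s \<in> S" "k \<in> K" "x = s \<otimes> k" by (auto simp: P_def set_mult_def)
      then have "h x = h s"
        using subgroup.mem_carrier[OF assms(4)] subgroup.mem_carrier[OF K] by (simp add: K_def)
      then show "h x \<in> h ` S" using sk by simp
    qed
  qed (use SP in blast)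
  ultimately show ?thesis by simp
qed

end

section \<open>Trivial indices and indices that are powers of p\<close>

lemma (in group) index_eq_1D:
  assumes "subgroup S G" "subgroup K G" "index G K S = 1"
  shows "K \<subseteq> S"
proof
  fix x assume x: "x \<in> K"
  have "\<one> \<in> K" using subgroup.one_closed[OF assms(2)] .
  obtain c where "(\<lambda>d. S #> d) ` K = {c}" using assms(3) card_1_singletonE unfolding index_def by metis
  then have "S #> x = S #> \<one>" using x \<open>\<one> \<in> K\<close> by blast
  then have "x \<otimes> inv \<one> \<in> S"
    using rcos_eq_iff[OF assms(1)] subgroup.mem_carrier[OF assms(2) x] by simp
  then show "x \<in> S" using subgroup.mem_carrier[OF assms(2) x] by simp
qed

text \<open>Otherwise a prime q \<noteq> p divides the order, Sylow gives a subgroup of order q, and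
  the order of a nontrivial element of it divides both q and p^n.\<close>

lemma (in group) order_eq_prime_power:
  assumes "prime p" "finite (carrier G)" "\<And>x. x \<in> carrier G \<Longrightarrow> x [^] (p ^ n :: nat) = \<one>"
  shows "\<exists>r. Coset.order G = p ^ r"
proof -
  have pos: "Coset.order G > 0" using assms(2) order_gt_0_iff_finite by simp
  obtain m where m: "Coset.order G = p ^ multiplicity p (Coset.order G) * m" "\<not> p dvd m"
    using multiplicity_decompose'[of "Coset.order G" p] pos prime_ge_2_nat[OF assms(1)] by (metis Suc_1 less_irrefl_nat nat_dvd_1_iff_1 not_less_eq_eq not_prime_unit assms(1) less_numeral_extra(3))
  have "m = 1"
  proof (rule ccontr)
    assume "m \<noteq> 1"
    then obtain q where q: "prime q" "q dvd m" using prime_factor_nat by blast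
    then have "q dvd Coset.order G" using m(1) by (metis dvd_mult)
    then obtain l where "Coset.order G = q ^ 1 * l" by auto
    from sylow_thm[OF q(1) is_group this assms(2)]
    obtain K where K: "subgroup K G" "card K = q" by auto
    have "K \<noteq> {\<one>}" using K(2) q(1) by auto
    then obtain y where y: "y \<in> K" "y \<noteq> \<one>" using subgroup.one_closed[OF K(1)] by blast
    have yc: "y \<in> carrier G" using subgroup.mem_carrier[OF K(1) y(1)] .
    interpret K: group "G\<lparr>carrier := K\<rparr>" using K(1) subgroup.subgroup_is_group is_group by blast
    have "y [^]\<^bsub>G\<lparr>carrier := K\<rparr>\<^esub> Coset.order (G\<lparr>carrier := K\<rparr>) = \<one>"
      using K.pow_order_eq_1[of y] y by simp
    then have "y [^] q = \<one>" using K(2) by (simp add: Coset.order_def nat_pow_consistent[symmetric])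
    then have "ord y dvd q" "ord y dvd p ^ n" using assms(3)[OF yc] pow_eq_id[OF yc] by auto
    moreover have "q \<noteq> p" using q m(2) by blast
    then have "coprime q (p ^ n)" using q(1) assms(1) primes_coprime by auto
    ultimately have "ord y = 1" using coprime_common_divisor_nat by blast
    then show False using y(2) yc ord_eq_1 by simp
  qed
  then show ?thesis using m(1) by auto
qed

text \<open>Positivity makes D/S a finite group, and it inherits the exponent p^n from D.\<close>

lemma (in comm_group) index_prime_power:
  assumes "prime p" "subgroup D G" "subgroup S G" "S \<subseteq> D" "index G D S > 0"
    "\<And>x. x \<in> D \<Longrightarrow> x [^] (p ^ n :: nat) = \<one>"
  shows "\<exists>r. index G D S = p ^ r"
proof -
  interpret D: comm_group "G\<lparr>carrier := D\<rparr>" using subgroup.subgroup_is_group[OF assms(2) is_group] subgroup.mem_carrier[OF assms(2)]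
    by (intro group.group_comm_groupI) (auto intro: m_comm)
  have "subgroup S (G\<lparr>carrier := D\<rparr>)" using assms(2,3,4) subgroup_incl by blast
  then interpret S: normal S "G\<lparr>carrier := D\<rparr>" using D.normal_iff_subgroup by blast
  interpret Q: group "(G\<lparr>carrier := D\<rparr>) Mod S" by (rule S.factorgroup_is_group)
  have car: "carrier ((G\<lparr>carrier := D\<rparr>) Mod S) = (\<lambda>d. S #> d) ` D"
    by (auto simp: FactGroup_def RCOSETS_def)
  have fin: "finite (carrier ((G\<lparr>carrier := D\<rparr>) Mod S))"
    using assms(5) unfolding index_def car by (rule card_ge_0_finite)
  have "\<exists>r. Coset.order ((G\<lparr>carrier := D\<rparr>) Mod S) = p ^ r"
  proof (rule Q.order_eq_prime_power[OF assms(1) fin])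
    fix x assume "x \<in> carrier ((G\<lparr>carrier := D\<rparr>) Mod S)"
    then obtain d where d: "d \<in> D" "x = S #>\<^bsub>G\<lparr>carrier := D\<rparr>\<^esub> d" unfolding car by auto
    have "x [^]\<^bsub>(G\<lparr>carrier := D\<rparr>) Mod S\<^esub> (int (p ^ n)) = S #>\<^bsub>G\<lparr>carrier := D\<rparr>\<^esub> (d [^]\<^bsub>G\<lparr>carrier := D\<rparr>\<^esub> (int (p ^ n)))"
      unfolding d(2) by (rule S.FactGroup_int_pow) (use d in simp)
    also have "d [^]\<^bsub>G\<lparr>carrier := D\<rparr>\<^esub> (int (p ^ n)) = \<one>"
      unfolding int_pow_int using assms(6)[OF d(1)] by (simp add: nat_pow_consistent[symmetric])
    also have "S #>\<^bsub>G\<lparr>carrier := D\<rparr>\<^esub> \<one> = S"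
      using subgroup.subset[OF assms(3)] by simp
    finally show "x [^]\<^bsub>(G\<lparr>carrier := D\<rparr>) Mod S\<^esub> (p ^ n) = \<one>\<^bsub>(G\<lparr>carrier := D\<rparr>) Mod S\<^esub>"
      unfolding int_pow_int by (simp add: FactGroup_def)
  qed
  then show ?thesis unfolding Coset.order_def car index_def .
qed

section \<open>Polynomials in an endomorphism\<close>

lemma prime_dvd_binomial_diff:
  fixes x y :: "'a::comm_ring_1"
  assumes "prime p"
  shows "of_nat p dvd (x + y) ^ p - (x ^ p + y ^ p)"
proof -
  have p: "p > 0" using prime_gt_0_nat[OF assms] .
  have "(x + y) ^ p = (\<Sum>k\<in>insert 0 (insert p {1..<p}). of_nat (p choose k) * x ^ k * y ^ (p - k))"
    unfolding binomial_ring using p by (intro sum.cong) auto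
  also have "\<dots> = y ^ p + x ^ p + (\<Sum>k\<in>{1..<p}. of_nat (p choose k) * x ^ k * y ^ (p - k))"
    using p by simp
  finally have e: "(x + y) ^ p - (x ^ p + y ^ p) = (\<Sum>k\<in>{1..<p}. of_nat (p choose k) * x ^ k * y ^ (p - k))"
    by simp
  show ?thesis unfolding e
  proof (rule dvd_sum)
    fix k assume "k \<in> {1..<p}"
    then have "p dvd p choose k" using dvd_choose_prime[of k p] assms p by auto
    then obtain l where "p choose k = p * l" by (rule dvdE)
    then show "of_nat p dvd of_nat (p choose k) * x ^ k * y ^ (p - k)" by (simp add: mult.assoc)
  qed
qed

lemma diff_dvd_power_diff: "a - b dvd a ^ n - (b :: 'a::comm_ring_1) ^ n"
  unfolding power_diff_sumr2 by (rule dvd_triv_left)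

text \<open>If a and b are congruent modulo p, so are a^p and b^p, because a - b divides a^p - b^p.
  The binomial congruence for exponent p can thus be iterated.\<close>

lemma prime_dvd_one_plus_power_diff:
  fixes x :: "'a::comm_ring_1"
  assumes "prime p"
  shows "of_nat p dvd (1 + x) ^ (p ^ k) - (1 + x ^ (p ^ k))"
proof (induction k)
  case (Suc k)
  let ?a = "(1 + x) ^ (p ^ k)" and ?b = "1 + x ^ (p ^ k)"
  have "?a - ?b dvd ?a ^ p - ?b ^ p" by (rule diff_dvd_power_diff)
  then have "of_nat p dvd (?a ^ p - ?b ^ p)" using Suc dvd_trans by blast
  moreover have "of_nat p dvd ?b ^ p - (1 ^ p + (x ^ (p ^ k)) ^ p)"
    by (rule prime_dvd_binomial_diff[OF assms])
  ultimately have "of_nat p dvd (?a ^ p - ?b ^ p) + (?b ^ p - (1 ^ p + (x ^ (p ^ k)) ^ p))"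
    by (rule dvd_add)
  also have "\<dots> = ?a ^ p - (1 ^ p + (x ^ (p ^ k)) ^ p)" by simp
  finally show ?case by (simp add: mult.commute flip: power_mult)
qed simp

text \<open>\<open>[:0, 1:]\<close> stands for t = h - 1, hence \<open>[:1, 1:]\<close> for h.
  Congruences between \<omega>_k and powers of t become identities in the commutative ring \<int>[T]
  and are transported to modules afterwards.\<close>

definition omega_poly :: "nat \<Rightarrow> nat \<Rightarrow> int poly" where
  "omega_poly p k = [:1, 1:] ^ (p ^ k) - 1"

lemma omega_poly_cong:
  assumes "prime p"
  obtains u where "omega_poly p k = [:0, 1:] ^ (p ^ k) + of_nat p * u"
proof -
  obtain u where "(1 + [:0, 1:]) ^ (p ^ k) - (1 + [:0, 1:] ^ (p ^ k)) = of_nat p * (u :: int poly)"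
    using prime_dvd_one_plus_power_diff[OF assms] by (meson dvdE)
  then have "omega_poly p k = [:0, 1:] ^ (p ^ k) + of_nat p * u"
    unfolding omega_poly_def by (simp add: one_pCons algebra_simps)
  then show ?thesis using that by blast
qed

text \<open>y - 1 divides y^p - 1. Consequently the kernels of \<omega>_k grow with k.\<close>

lemma omega_poly_dvd_Suc: "omega_poly p k dvd omega_poly p (Suc k)"
proof -
  have "([:1, 1:] ^ (p ^ k)) - 1 dvd ([:1, 1 :: int:] ^ (p ^ k)) ^ p - 1 ^ p"
    by (rule diff_dvd_power_diff)
  then show ?thesis by (simp add: omega_poly_def mult.commute flip: power_mult)
qed

text \<open>With T^(p^k) = \<omega>_k - p u, the N-th powers of T^(p^k) and of -p u differ by a
  multiple of \<omega>_k. On a group of exponent p^N a power of t therefore factors through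
  \<omega>_k, which relates kernel and image of \<omega>_k to those of powers of t.\<close>

lemma omega_poly_nilpotent:
  assumes "prime p"
  obtains v w where "[:0, 1:] ^ (p ^ k * N) = omega_poly p k * v + of_nat (p ^ N) * w"
proof -
  obtain u where u: "omega_poly p k = [:0, 1:] ^ (p ^ k) + of_nat p * u"
    by (rule omega_poly_cong[OF assms])
  obtain v where "([:0, 1:] ^ (p ^ k)) ^ N - (of_nat p * (- u)) ^ N
      = ([:0, 1:] ^ (p ^ k) - of_nat p * (- u)) * (v :: int poly)"
    using diff_dvd_power_diff by (blast elim: dvdE)
  moreover have "[:0, 1:] ^ (p ^ k) - of_nat p * (- u) = omega_poly p k" by (simp add: u)
  moreover have "(of_nat p * (- u)) ^ N = of_nat (p ^ N) * (- u) ^ N" by (simp only: power_mult_distrib of_nat_power)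
  ultimately have "[:0, 1:] ^ (p ^ k * N) = omega_poly p k * v + of_nat (p ^ N) * (- u) ^ N"
    by (simp only: power_mult diff_eq_eq)
  then show ?thesis using that by blast
qed

text \<open>Horner's scheme for the action of \<int>[T] on an abelian group written
  multiplicatively, with T acting as t; the group will be the additive group of a module.\<close>

definition poly_act :: "('a, 'b) monoid_scheme \<Rightarrow> ('a \<Rightarrow> 'a) \<Rightarrow> int poly \<Rightarrow> 'a \<Rightarrow> 'a" where
  "poly_act G t q x = fold_coeffs (\<lambda>c y. x [^]\<^bsub>G\<^esub> c \<otimes>\<^bsub>G\<^esub> t y) q \<one>\<^bsub>G\<^esub>"

locale group_endo = comm_group G for G :: "('a, 'b) monoid_scheme" (structure) +
  fixes t :: "'a \<Rightarrow> 'a"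
  assumes endo: "t \<in> hom G G"
begin

sublocale t: group_hom G G t
  using endo by (simp add: group_hom_def group_hom_axioms_def is_group)

abbreviation act where "act \<equiv> poly_act G t"

lemma act_0 [simp]: "act 0 x = \<one>"
  by (simp add: poly_act_def)

lemma act_pCons: "x \<in> carrier G \<Longrightarrow> act (pCons c q) x = x [^] c \<otimes> t (act q x)"
  by (cases "c = 0 \<and> q = 0") (auto simp: poly_act_def)

lemma act_closed [simp]: "x \<in> carrier G \<Longrightarrow> act q x \<in> carrier G"
  by (induction q) (auto simp: act_pCons)

lemma act_mult_distrib:
  "x \<in> carrier G \<Longrightarrow> y \<in> carrier G \<Longrightarrow> act q (x \<otimes> y) = act q x \<otimes> act q y"
  by (induction q) (auto simp: act_pCons int_pow_distrib m_ac)

lemma act_hom: "act q \<in> hom G G"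
  by (auto simp: hom_def act_mult_distrib)

sublocale act: group_hom G G "act q" for q
  using act_hom by (simp add: group_hom_def group_hom_axioms_def is_group)

lemma act_add: "x \<in> carrier G \<Longrightarrow> act (q + r) x = act q x \<otimes> act r x"
  by (induction q r rule: poly_induct2) (auto simp: act_pCons int_pow_mult m_ac)

lemma act_scale: "x \<in> carrier G \<Longrightarrow> act (Polynomial.smult c q) x = act q x [^] c"
  by (induction q) (auto simp: act_pCons int_pow_distrib int_pow_pow t.hom_int_pow mult.commute)

lemma act_mult: "x \<in> carrier G \<Longrightarrow> act (q * r) x = act q (act r x)"
  by (induction q) (auto simp: act_pCons act_add act_scale)

lemma act_mult': "x \<in> carrier G \<Longrightarrow> act (q * r) x = act r (act q x)"
  using act_mult[of x r q] by (simp add: mult.commute)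

lemma act_const: "x \<in> carrier G \<Longrightarrow> act [:c:] x = x [^] c"
  by (simp add: act_pCons)

lemma act_1: "x \<in> carrier G \<Longrightarrow> act 1 x = x"
  by (simp add: one_pCons act_const)

lemma act_of_nat_mult: "x \<in> carrier G \<Longrightarrow> act (of_nat n * q) x = act q x [^] n"
  by (simp add: of_nat_poly act_scale int_pow_int)

lemma act_X: "x \<in> carrier G \<Longrightarrow> act [:0, 1:] x = t x"
  by (simp add: act_pCons)

lemma act_X_pow:
  assumes "x \<in> carrier G"
  shows "act ([:0, 1:] ^ n) x = (t ^^ n) x"
proof (induction n)
  case 0
  show ?case unfolding power_0 funpow_0 by (rule act_1[OF assms])
next
  case (Suc n)
  have "act ([:0, 1:] ^ Suc n) x = act [:0, 1:] (act ([:0, 1:] ^ n) x)"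
    unfolding power_Suc by (rule act_mult[OF assms])
  also have "\<dots> = t (act ([:0, 1:] ^ n) x)" by (rule act_X[OF act_closed[OF assms]])
  finally show ?case unfolding Suc.IH funpow.simps o_apply .
qed

lemma act_one_plus_X_pow:
  assumes "\<And>x. x \<in> carrier G \<Longrightarrow> s x = x \<otimes> t x" "x \<in> carrier G"
  shows "act ([:1, 1:] ^ n) x = (s ^^ n) x"
proof (induction n)
  case 0
  show ?case unfolding power_0 funpow_0 by (rule act_1[OF assms(2)])
next
  case (Suc n)
  let ?y = "act ([:1, 1:] ^ n) x"
  have y: "?y \<in> carrier G" by (rule act_closed[OF assms(2)])
  have "act ([:1, 1:] ^ Suc n) x = act [:1, 1:] ?y"
    unfolding power_Suc by (rule act_mult[OF assms(2)])
  also have "\<dots> = ?y \<otimes> t (act [:1:] ?y)" using y by (simp only: act_pCons int_pow_1)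
  also have "act [:1:] ?y = ?y" using y by (simp only: act_const int_pow_1)
  also have "?y \<otimes> t ?y = s ?y" using assms(1)[OF y] by (rule sym)
  finally show ?case unfolding Suc.IH funpow.simps o_apply .
qed

lemma act_stable:
  assumes "subgroup D G" "t ` D \<subseteq> D" "x \<in> D"
  shows "act q x \<in> D"
proof (induction q)
  case (pCons c q)
  then show ?case
    using assms subgroup_int_pow_closed[OF assms(1,3)]
    by (auto simp: act_pCons subgroup.mem_carrier intro!: subgroup.m_closed[OF assms(1)])
qed (simp add: subgroup.one_closed[OF assms(1)])

lemma act_image_subgroup: "subgroup D G \<Longrightarrow> subgroup (act q ` D) G"
  using act.subgroup_img_is_subgroup by blast

text \<open>Congruent polynomials act in the same way on the \<open>p\<close>-torsion of \<open>D\<close>, and \<open>p D\<close> has a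
  smaller exponent.\<close>

lemma index_act_cong:
  assumes "subgroup D G" "t ` D \<subseteq> D" "\<And>x. x \<in> D \<Longrightarrow> x [^] (p ^ M :: nat) = \<one>"
    and q: "q2 = q1 + of_nat p * u"
    and "\<And>x. x \<in> D \<Longrightarrow> act q1 x = \<one> \<Longrightarrow> x = \<one>" "\<And>x. x \<in> D \<Longrightarrow> act q2 x = \<one> \<Longrightarrow> x = \<one>"
  shows "index G D (act q1 ` D) = index G D (act q2 ` D)"
  using assms(1-3,5,6)
proof (induction M arbitrary: D)
  case 0
  have "x = \<one>" if "x \<in> D" for x
    using 0(3)[OF that] subgroup.mem_carrier[OF 0(1) that] by simp
  then have "D = {\<one>}" using subgroup.one_closed[OF 0(1)] by blast
  then show ?case by simp
next
  case (Suc M)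
  note D = Suc.prems(1)
  have Dc: "x \<in> carrier G" if "x \<in> D" for x using subgroup.mem_carrier[OF D that] .
  define \<pi> where "\<pi> = (\<lambda>x. x [^] p)"
  have \<pi>: "\<pi> \<in> hom G G" by (auto simp: hom_def \<pi>_def nat_pow_distrib)
  interpret \<pi>: group_hom G G \<pi> using \<pi> by (simp add: group_hom_def group_hom_axioms_def is_group)
  define K where "K = {x \<in> D. \<pi> x = \<one>}"
  have \<pi>D: "\<pi> x \<in> D" if "x \<in> D" for x
    using subgroup_int_pow_closed[OF D that, of "int p"] by (simp add: \<pi>_def int_pow_int)
  have P: "subgroup (\<pi> ` D) G" using \<pi>.subgroup_img_is_subgroup[OF D] .
  have comm: "\<pi> (act q x) = act q (\<pi> x)" if "x \<in> D" for q x
    using Dc[OF that] by (simp add: \<pi>_def act.hom_nat_pow)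
  have split: "index G D (act q ` D) = index G (\<pi> ` D) (act q ` \<pi> ` D) * index G K (act q ` K)"
    if inj: "\<And>x. x \<in> D \<Longrightarrow> act q x = \<one> \<Longrightarrow> x = \<one>" for q
  proof -
    have sub: "act q ` D \<subseteq> D" using act_stable[OF D Suc.prems(2)] by blast
    have "\<pi> ` act q ` D = act q ` \<pi> ` D" using comm by (force simp: image_iff)
    \<comment> \<open>If q x is killed by p, then q kills p x, so injectivity on D puts x into
      K.\<close>
    moreover have "K \<inter> act q ` D = act q ` K"
    proof
      show "K \<inter> act q ` D \<subseteq> act q ` K"
      proof
        fix y assume y: "y \<in> K \<inter> act q ` D"
        then obtain x where x: "x \<in> D" "y = act q x" by auto
        then have "act q (\<pi> x) = \<one>" using y comm by (auto simp: K_def)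
        then have "\<pi> x = \<one>" using inj \<pi>D x by blast
        then show "y \<in> act q ` K" using x by (auto simp: K_def)
      qed
      show "act q ` K \<subseteq> K \<inter> act q ` D" using sub comm by (auto simp: K_def)
    qed
    ultimately show ?thesis
      using index_hom_ker[OF \<pi> is_group D act_image_subgroup[OF D] sub] unfolding K_def by simp
  qed
  have "act q1 x = act q2 x" if "x \<in> K" for x
  proof -
    have x: "x \<in> D" "\<pi> x = \<one>" using that by (auto simp: K_def)
    then have "act u x [^] p = \<one>" using comm[OF x(1), of u] by (simp add: \<pi>_def)
    then show ?thesis using Dc[OF x(1)] by (simp add: q act_add act_of_nat_mult)
  qed
  then have "act q1 ` K = act q2 ` K" by simp
  moreover have "index G (\<pi> ` D) (act q1 ` \<pi> ` D) = index G (\<pi> ` D) (act q2 ` \<pi> ` D)"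
  proof (rule Suc.IH[OF P])
    have "t (\<pi> x) = \<pi> (t x)" if "x \<in> D" for x
      using Dc[OF that] by (simp add: \<pi>_def t.hom_nat_pow)
    then show "t ` \<pi> ` D \<subseteq> \<pi> ` D" using Suc.prems(2) by auto
    show "x [^] (p ^ M) = \<one>" if "x \<in> \<pi> ` D" for x
      using that Suc.prems(3) Dc by (auto simp: \<pi>_def nat_pow_pow)
  qed (use Suc.prems(4,5) \<pi>D in auto)
  ultimately show ?case using split[of q1] split[of q2] Suc.prems(4,5) by simp
qed

text \<open>The summand p^N w of \<open>omega_poly_nilpotent\<close> acts trivially. Both orders of
  composition are recorded, one for kernels and one for images of \<omega>_k.\<close>

lemma pow_factors_through_omega_poly:
  assumes "prime p" "\<And>x. x \<in> carrier G \<Longrightarrow> x [^] (p ^ N) = \<one>"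
  shows "\<exists>v. \<forall>x\<in>carrier G. (t ^^ (p ^ k * N)) x = act v (act (omega_poly p k) x) \<and>
    (t ^^ (p ^ k * N)) x = act (omega_poly p k) (act v x)"
proof -
  obtain v w where vw: "[:0, 1:] ^ (p ^ k * N) = omega_poly p k * v + of_nat (p ^ N) * w"
    by (rule omega_poly_nilpotent[OF assms(1)])
  have "(t ^^ (p ^ k * N)) x = act v (act (omega_poly p k) x) \<and> (t ^^ (p ^ k * N)) x = act (omega_poly p k) (act v x)"
    if x: "x \<in> carrier G" for x
  proof -
    have "(t ^^ (p ^ k * N)) x = act (omega_poly p k * v) x \<otimes> (act w x) [^] (p ^ N)"
      unfolding act_X_pow[OF x, symmetric] vw act_add[OF x] act_of_nat_mult[OF x] ..
    also have "(act w x) [^] (p ^ N) = \<one>" by (rule assms(2)[OF act_closed[OF x]])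
    finally have "(t ^^ (p ^ k * N)) x = act (omega_poly p k * v) x"
      using act_closed[OF x] by simp
    then show ?thesis using act_mult[OF x, of "omega_poly p k" v] act_mult'[OF x, of "omega_poly p k" v] by argo
  qed
  then show ?thesis by blast
qed

end

section \<open>Index growth for a separated endomorphism of a group of exponent p^N\<close>

text \<open>The conditions on \<open>index\<close> and \<open>separated\<close> replace finite generation over \<open>(\<int>/p\<^sup>N)[[t]]\<close>.\<close>

locale separated_endo = group_endo +
  fixes p N :: nat
  assumes prime: "prime p"
    and exponent: "\<And>x. x \<in> carrier G \<Longrightarrow> x [^] (p ^ N) = \<one>"
    and finite_index: "index G (carrier G) (t ` carrier G) > 0"
    and separated: "\<And>x. x \<in> carrier G \<Longrightarrow> (\<And>n. x \<in> (t ^^ n) ` carrier G) \<Longrightarrow> x = \<one>"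
begin

definition img where "img n = (t ^^ n) ` carrier G"

lemma pow_closed: "x \<in> carrier G \<Longrightarrow> (t ^^ n) x \<in> carrier G"
  by (induction n) auto

lemma pow_hom: "t ^^ n \<in> hom G G"
proof -
  have "(t ^^ n) (x \<otimes> y) = (t ^^ n) x \<otimes> (t ^^ n) y" if "x \<in> carrier G" "y \<in> carrier G" for x y
    using that by (induction n) (auto simp: pow_closed)
  then show ?thesis by (auto simp: hom_def pow_closed)
qed

lemma pow_group_hom: "group_hom G G (t ^^ n)"
  using pow_hom by (simp add: group_hom_def group_hom_axioms_def is_group)

lemma img_subgroup: "subgroup (img n) G"
  unfolding img_def by (rule group_hom.img_is_subgroup[OF pow_group_hom])

lemma t_img: "t ` img n = img (Suc n)"
  by (simp add: img_def image_comp)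

lemma img_Suc_subset: "img (Suc n) \<subseteq> img n"
  using pow_closed by (auto simp: img_def funpow_swap1)

lemma img_antimono: "m \<le> n \<Longrightarrow> img n \<subseteq> img m"
  by (rule lift_Suc_antimono_le[of img]) (auto simp: img_Suc_subset)

text \<open>The endomorphism t carries each layer of the filtration by the groups t^n G onto the
  next. Hence the layer indices form a descending chain of divisors, and a drop is caused by
  elements of ker t in t^n G that lie outside t^(n+1) G.\<close>

lemma index_img:
  "index G (img n) (img (Suc n)) =
     index G (img (Suc n)) (img (Suc (Suc n))) *
     index G {x \<in> img n. t x = \<one>} ({x \<in> img n. t x = \<one>} \<inter> img (Suc n))"
  using index_hom_ker[OF endo is_group img_subgroup img_subgroup img_Suc_subset[of n]]
  by (simp only: t_img)

lemma index_img_pos: "index G (img n) (img (Suc n)) > 0"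
proof (induction n)
  case 0
  then show ?case using finite_index by (simp add: img_def)
next
  case (Suc n)
  then show ?case using index_img[of n] by simp
qed

lemma index_carrier_img_pos: "index G (carrier G) (img n) > 0"
proof (induction n)
  case 0
  have "(\<lambda>d. carrier G #> d) ` carrier G = {carrier G}"
    using coset_join2[OF _ subgroup_self] by auto
  then show ?case by (simp add: img_def index_def)
next
  case (Suc n)
  have "index G (carrier G) (img (Suc n)) = index G (carrier G) (img n) * index G (img n) (img (Suc n))"
    using index_tower[OF img_subgroup img_subgroup subgroup_self img_Suc_subset]
      subgroup.subset[OF img_subgroup] by blast
  then show ?case using Suc index_img_pos by simp
qed

text \<open>The indices [t^n G : t^(n+1) G] never increase, so from some n on they are constant, and
  then \<open>index_img\<close> puts ker t \<inter> t^m G into t^(m+1) G for every m \<ge> n. An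
  element of ker t \<inter> t^n G thus lies in all t^m G and vanishes by \<open>separated\<close>.
  Any such n yields a group D = t^n G on which t is injective.\<close>

lemma ker_inter_img_trivial: "\<exists>n. \<forall>x\<in>img n. t x = \<one> \<longrightarrow> x = \<one>"
proof -
  obtain n where n: "\<And>m. index G (img n) (img (Suc n)) \<le> index G (img m) (img (Suc m))"
    using ex_has_least_nat[of "\<lambda>_. True" _ "\<lambda>m. index G (img m) (img (Suc m))"] by blast
  have le: "index G (img (Suc m)) (img (Suc (Suc m))) \<le> index G (img m) (img (Suc m))" for m
  proof -
    obtain e where "index G (img m) (img (Suc m)) = index G (img (Suc m)) (img (Suc (Suc m))) * e"
      using index_img by blast
    then show ?thesis using index_img_pos[of m] by (cases e) auto
  qed
  have const: "index G (img m) (img (Suc m)) = index G (img n) (img (Suc n))" if "m \<ge> n" for m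
    using that
  proof (induction m rule: dec_induct)
    case (step m)
    then show ?case using le[of m] n[of "Suc m"] by linarith
  qed simp
  have ker: "{x \<in> img m. t x = \<one>} \<subseteq> img (Suc m)" if "m \<ge> n" for m
  proof -
    let ?K = "{x \<in> img m. t x = \<one>}"
    have "index G (img m) (img (Suc m)) = index G (img (Suc m)) (img (Suc (Suc m)))"
      using const[of m] const[of "Suc m"] that by simp
    then have "index G ?K (?K \<inter> img (Suc m)) = 1"
      using index_img[of m] index_img_pos[of "Suc m"] by simp
    moreover have "?K = img m \<inter> kernel G G t"
      using subgroup.subset[OF img_subgroup] by (auto simp: kernel_def)
    then have "subgroup ?K G" using subgroups_Inter_pair[OF img_subgroup t.subgroup_kernel] by simp
    moreover then have "subgroup (?K \<inter> img (Suc m)) G" using subgroups_Inter_pair[OF _ img_subgroup] by blast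
    ultimately show ?thesis using index_eq_1D by blast
  qed
  have "x = \<one>" if x: "x \<in> img n" "t x = \<one>" for x
  proof (rule separated)
    have "x \<in> img m" if "m \<ge> n" for m
      using that by (induction m rule: dec_induct) (use x ker in auto)
    then have "x \<in> img m" for m
      using img_antimono[of m "max m n"] by (metis max.cobounded1 max.cobounded2 subsetD)
    then show "x \<in> (t ^^ m) ` carrier G" for m by (simp add: img_def)
  qed (use x subgroup.mem_carrier[OF img_subgroup] in blast)
  then show ?thesis by blast
qed

section \<open>The torsion for powers of t and the kernels of \<omega>_k\<close>

definition tors where "tors = {x \<in> carrier G. \<exists>n. (t ^^ n) x = \<one>}"

lemma tors_inter_img_trivial:
  assumes "\<forall>x\<in>img m. t x = \<one> \<longrightarrow> x = \<one>" "x \<in> tors" "x \<in> img m"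
  shows "x = \<one>"
proof -
  obtain n where "(t ^^ n) x = \<one>" using assms(2) by (auto simp: tors_def)
  then show ?thesis using assms(3)
  proof (induction n arbitrary: x)
    case (Suc n)
    have "t x \<in> img m" using t_img[of m] img_Suc_subset[of m] Suc.prems(2) by blast
    then have "t x = \<one>" using Suc.IH[of "t x"] Suc.prems(1) by (simp add: funpow_swap1)
    then show ?case using assms(1) Suc.prems(2) by blast
  qed simp
qed

lemma tors_diff: "x \<in> tors \<Longrightarrow> y \<in> tors \<Longrightarrow> x \<otimes> inv y \<in> tors"
proof -
  assume "x \<in> tors" "y \<in> tors"
  then obtain m n where c: "x \<in> carrier G" "y \<in> carrier G" and mn: "(t ^^ m) x = \<one>" "(t ^^ n) y = \<one>"
    by (auto simp: tors_def)
  have one: "(t ^^ k) \<one> = \<one>" for k by (rule group_hom.hom_one[OF pow_group_hom])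
  have "(t ^^ (n + m)) x = \<one>" using mn one by (simp add: funpow_add)
  moreover have "(t ^^ (m + n)) y = \<one>" using mn one by (simp add: funpow_add)
  ultimately have "(t ^^ (m + n)) (x \<otimes> inv y) = \<one>"
    using c hom_mult[OF pow_hom, of x "inv y"] group_hom.hom_inv[OF pow_group_hom, of y]
    by (simp add: add.commute)
  then show ?thesis using c by (auto simp: tors_def)
qed

text \<open>A subgroup t^m G on which t is injective meets the torsion trivially, so torsion
  elements lie in distinct cosets of it, and it has finite index.\<close>

lemma finite_tors: "finite tors"
proof -
  obtain m where m: "\<forall>x\<in>img m. t x = \<one> \<longrightarrow> x = \<one>" using ker_inter_img_trivial by blast
  have "inj_on (\<lambda>x. img m #> x) tors"
  proof (rule inj_onI)
    fix x y assume xy: "x \<in> tors" "y \<in> tors" "img m #> x = img m #> y"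
    then have c: "x \<in> carrier G" "y \<in> carrier G" by (auto simp: tors_def)
    then have "x \<otimes> inv y \<in> img m" using xy rcos_eq_iff[OF img_subgroup] by simp
    then have "x \<otimes> inv y = \<one>" using tors_inter_img_trivial[OF m tors_diff] xy by blast
    then show "x = y" using c by (metis inv_equality inv_inv inv_closed)
  qed
  moreover have "(\<lambda>x. img m #> x) ` tors \<subseteq> (\<lambda>x. img m #> x) ` carrier G" by (auto simp: tors_def)
  moreover have "finite ((\<lambda>x. img m #> x) ` carrier G)"
    using index_carrier_img_pos[of m] unfolding index_def by (rule card_ge_0_finite)
  ultimately show ?thesis by (meson finite_imageD finite_subset)
qed

abbreviation \<omega> where "\<omega> k \<equiv> act (omega_poly p k)"

lemma pow_factors_through_omega:
  "\<exists>v. \<forall>x\<in>carrier G. (t ^^ (p ^ k * N)) x = act v (\<omega> k x) \<and> (t ^^ (p ^ k * N)) x = \<omega> k (act v x)"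
  using pow_factors_through_omega_poly[OF prime exponent] .

definition ker where "ker k = {x \<in> carrier G. \<omega> k x = \<one>}"

text \<open>t^(p^k N) factors through \<omega>_k. The point is that the bound does not depend on k:
  all kernels lie in the one finite set \<open>tors\<close>.\<close>

lemma ker_subset_tors: "ker k \<subseteq> tors"
proof
  fix x assume x: "x \<in> ker k"
  obtain v where "(t ^^ (p ^ k * N)) x = act v (\<omega> k x)"
    using pow_factors_through_omega[of k] x by (auto simp: ker_def)
  then have "(t ^^ (p ^ k * N)) x = \<one>" using x by (simp add: ker_def)
  then show "x \<in> tors" using x by (auto simp: tors_def ker_def)
qed

lemma finite_ker: "finite (ker k)"
  using finite_subset[OF ker_subset_tors finite_tors] .

lemma ker_Suc: "ker k \<subseteq> ker (Suc k)"
proof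
  fix x assume x: "x \<in> ker k"
  then have c: "x \<in> carrier G" by (simp add: ker_def)
  obtain q where "omega_poly p (Suc k) = omega_poly p k * q" using omega_poly_dvd_Suc by (rule dvdE)
  then have "\<omega> (Suc k) x = act q (\<omega> k x)" using act_mult'[OF c] by simp
  then show "x \<in> ker (Suc k)" using x by (simp add: ker_def)
qed

text \<open>The kernels increase inside a finite set. This stabilization is why the count is
  restricted to large k.\<close>

lemma ker_stabilizes: "\<exists>k0. \<forall>k\<ge>k0. ker k = ker k0"
proof -
  have mono: "ker j \<subseteq> ker k" if "j \<le> k" for j k
    using that by (rule lift_Suc_mono_le[of ker, rotated]) (rule ker_Suc)
  have "\<forall>k. card (ker k) \<le> card tors" using card_mono[OF finite_tors ker_subset_tors] by blast
  then obtain k0 where k0: "\<And>k. card (ker k) \<le> card (ker k0)"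
    using ex_has_greatest_nat[of "\<lambda>_. True" 0 "\<lambda>k. card (ker k)" "Suc (card tors)"] by (auto simp: less_Suc_eq_le)
  have "ker k = ker k0" if "k \<ge> k0" for k
    using card_seteq[OF finite_ker mono[OF that] k0] by simp
  then show ?thesis by blast
qed

lemma ker_subgroup: "subgroup (ker k) G"
  using act.subgroup_kernel[of "omega_poly p k"] by (simp add: ker_def kernel_def)

lemma card_ker_prime_power: "\<exists>r. card (ker k) = p ^ r"
proof -
  have "subgroup {\<one>} G" by (rule triv_subgroup)
  moreover have "index G (ker k) {\<one>} = card (ker k)"
    by (rule index_one) (use subgroup.subset[OF ker_subgroup] in blast)
  moreover have "card (ker k) > 0"
    using finite_ker subgroup.one_closed[OF ker_subgroup] by (auto simp: card_gt_0_iff)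
  ultimately show ?thesis
    using index_prime_power[OF prime ker_subgroup] subgroup.one_closed[OF ker_subgroup]
      exponent subgroup.mem_carrier[OF ker_subgroup] by (metis empty_subsetI insert_subset)
qed

text \<open>On D = t^m G both t and \<omega>_k are injective, and \<omega>_k is congruent to T^(p^k)
  modulo p, so [D : \<omega>_k D] = [D : t^(p^k) D] = [D : tD]^(p^k). The passage to the whole group
  C compares the towers C \<supseteq> D \<supseteq> \<omega>_k D and C \<supseteq> \<omega>_k C
  \<supseteq> \<omega>_k D: as [C : D] is [\<omega>_k C : \<omega>_k D] times the order of the
  kernel, the finite number [C : D] cancels.\<close>

lemma index_omega:
  assumes "\<forall>x\<in>img m. t x = \<one> \<longrightarrow> x = \<one>"
  shows "index G (carrier G) (\<omega> k ` carrier G) = index G (img m) (img (Suc m)) ^ (p ^ k) * card (ker k)"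
proof -
  define D where "D = img m"
  define C where "C = carrier G"
  have D: "subgroup D G" by (simp add: D_def img_subgroup)
  have C: "subgroup C G" by (simp add: C_def subgroup_self)
  have DC: "D \<subseteq> C" using subgroup.subset[OF D] by (simp add: C_def)
  have tD: "t ` D \<subseteq> D" unfolding D_def t_img by (rule img_Suc_subset)
  have t1: "x = \<one>" if "x \<in> D" "t x = \<one>" for x using assms that by (simp add: D_def)
  have tn: "x = \<one>" if "x \<in> D" "(t ^^ n) x = \<one>" for x n
    using tors_inter_img_trivial[OF assms] that subgroup.mem_carrier[OF D] by (auto simp: tors_def D_def)
  have w1: "x = \<one>" if "x \<in> D" "\<omega> k x = \<one>" for x
    using tors_inter_img_trivial[OF assms subsetD[OF ker_subset_tors]] that subgroup.mem_carrier[OF D]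
    by (auto simp: ker_def D_def)
  \<comment> \<open>As t^n is injective on D, it carries D/tD onto the n-th layer without changing
    the index.\<close>
  have pow: "index G D ((t ^^ n) ` D) = index G D (t ` D) ^ n" for n
  proof (induction n)
    case 0
    have "(\<lambda>d. D #> d) ` D = {D}"
      using coset_join2[OF _ D] subgroup.mem_carrier[OF D] subgroup.one_closed[OF D] by auto
    then show ?case by (simp add: index_def)
  next
    case (Suc n)
    have s: "subgroup ((t ^^ n) ` E) G" if "subgroup E G" for E
      by (rule group_hom.subgroup_img_is_subgroup[OF pow_group_hom that])
    have tDs: "subgroup (t ` D) G" by (rule t.subgroup_img_is_subgroup[OF D])
    have e: "(t ^^ Suc n) ` D = (t ^^ n) ` (t ` D)" by (auto simp: funpow_swap1 image_comp)
    have "(t ^^ n) ` D \<subseteq> D" by (induction n) (use tD in auto)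
    then have "index G D ((t ^^ Suc n) ` D) = index G D ((t ^^ n) ` D) * index G ((t ^^ n) ` D) ((t ^^ n) ` (t ` D))"
      unfolding e using tD by (intro index_tower s D tDs) auto
    also have "index G ((t ^^ n) ` D) ((t ^^ n) ` (t ` D)) = index G D (t ` D)"
      by (rule index_hom_inj[OF pow_hom is_group D tDs tD tn])
    finally show ?case using Suc by simp
  qed
  obtain u where u: "omega_poly p k = [:0, 1:] ^ (p ^ k) + of_nat p * u"
    by (rule omega_poly_cong[OF prime])
  have Xp: "act ([:0, 1:] ^ (p ^ k)) x = (t ^^ (p ^ k)) x" if "x \<in> D" for x
    by (rule act_X_pow[OF subgroup.mem_carrier[OF D that]])
  have "index G D (act ([:0, 1:] ^ (p ^ k)) ` D) = index G D (\<omega> k ` D)"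
  proof (rule index_act_cong[OF D tD _ u])
    show "x [^] (p ^ N) = \<one>" if "x \<in> D" for x using exponent subgroup.mem_carrier[OF D that] .
    show "x = \<one>" if "x \<in> D" "act ([:0, 1:] ^ (p ^ k)) x = \<one>" for x
      by (rule tn[OF that(1), of "p ^ k"]) (use that Xp in metis)
  qed (rule w1)
  moreover have "act ([:0, 1:] ^ (p ^ k)) ` D = (t ^^ (p ^ k)) ` D" using Xp by (intro image_cong refl)
  ultimately have D\<omega>: "index G D (\<omega> k ` D) = index G D (t ` D) ^ (p ^ k)" using pow by metis
  have wD: "\<omega> k ` D \<subseteq> D" using act_stable[OF D tD] by blast
  have wC: "\<omega> k ` C \<subseteq> C" by (auto simp: C_def)
  have wDs: "subgroup (\<omega> k ` D) G" and wCs: "subgroup (\<omega> k ` C) G"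
    using act_image_subgroup D C by blast+
  have "ker k \<inter> D = {\<one>}"
    using w1 subgroup.one_closed[OF D] subgroup.one_closed[OF ker_subgroup] by (auto simp: ker_def)
  then have "index G (ker k) (ker k \<inter> D) = card (ker k)"
    using index_one subgroup.subset[OF ker_subgroup] by simp
  then have "index G C D = index G (\<omega> k ` C) (\<omega> k ` D) * card (ker k)"
    using index_hom_ker[OF act_hom is_group C D DC, of "omega_poly p k"] by (simp add: ker_def C_def)
  moreover have "index G C D * index G D (\<omega> k ` D) = index G C (\<omega> k ` C) * index G (\<omega> k ` C) (\<omega> k ` D)"
    using index_tower[OF wDs D C wD DC] index_tower[OF wDs wCs C image_mono[OF DC] wC] by simp
  moreover have "index G C D > 0" using index_carrier_img_pos by (simp add: C_def D_def)
  ultimately have "card (ker k) * index G D (\<omega> k ` D) = index G C (\<omega> k ` C)"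
    by (simp add: ac_simps)
  then show ?thesis unfolding D\<omega> by (simp add: D_def C_def t_img mult.commute)
qed

text \<open>Here p^r is the stationary layer index and p^\<nu> the order of the stationary kernel.
  The kernel order is what B contributes to the final count, the index what A contributes.\<close>

theorem index_omega_eventually:
  "\<exists>(r::nat) \<nu>. \<forall>\<^sub>F k in sequentially. card (ker k) = p ^ \<nu> \<and>
     index G (carrier G) (\<omega> k ` carrier G) = p ^ (r * p ^ k + \<nu>)"
proof -
  obtain m where m: "\<forall>x\<in>img m. t x = \<one> \<longrightarrow> x = \<one>" using ker_inter_img_trivial by blast
  obtain r where r: "index G (img m) (img (Suc m)) = p ^ r"
    using index_prime_power[OF prime img_subgroup img_subgroup img_Suc_subset index_img_pos]
      exponent subgroup.mem_carrier[OF img_subgroup] by metis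
  obtain k0 where k0: "\<And>k. k \<ge> k0 \<Longrightarrow> ker k = ker k0" using ker_stabilizes by blast
  obtain \<nu> where \<nu>: "card (ker k0) = p ^ \<nu>" using card_ker_prime_power by blast
  have "card (ker k) = p ^ \<nu> \<and> index G (carrier G) (\<omega> k ` carrier G) = p ^ (r * p ^ k + \<nu>)"
    if "k \<ge> k0" for k
    using index_omega[OF m, of k] r \<nu> k0[OF that] by (simp add: power_add power_mult)
  then show ?thesis unfolding eventually_sequentially by blast
qed

end

section \<open>Modules over noncommutative rings\<close>

lemma left_moduleI:
  assumes "ring R" "abelian_group M"
    "\<And>a x. a \<in> carrier R \<Longrightarrow> x \<in> carrier M \<Longrightarrow> a \<odot>\<^bsub>M\<^esub> x \<in> carrier M"
    "\<And>a b x. a \<in> carrier R \<Longrightarrow> b \<in> carrier R \<Longrightarrow> x \<in> carrier M \<Longrightarrow>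
      (a \<oplus>\<^bsub>R\<^esub> b) \<odot>\<^bsub>M\<^esub> x = a \<odot>\<^bsub>M\<^esub> x \<oplus>\<^bsub>M\<^esub> b \<odot>\<^bsub>M\<^esub> x"
    "\<And>a x y. a \<in> carrier R \<Longrightarrow> x \<in> carrier M \<Longrightarrow> y \<in> carrier M \<Longrightarrow>
      a \<odot>\<^bsub>M\<^esub> (x \<oplus>\<^bsub>M\<^esub> y) = a \<odot>\<^bsub>M\<^esub> x \<oplus>\<^bsub>M\<^esub> a \<odot>\<^bsub>M\<^esub> y"
    "\<And>a b x. a \<in> carrier R \<Longrightarrow> b \<in> carrier R \<Longrightarrow> x \<in> carrier M \<Longrightarrow>
      (a \<otimes>\<^bsub>R\<^esub> b) \<odot>\<^bsub>M\<^esub> x = a \<odot>\<^bsub>M\<^esub> (b \<odot>\<^bsub>M\<^esub> x)"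
    "\<And>x. x \<in> carrier M \<Longrightarrow> \<one>\<^bsub>R\<^esub> \<odot>\<^bsub>M\<^esub> x = x"
  shows "left_module R M"
  using assms by (auto simp: left_module_def left_module_axioms_def module_axioms_def)

context left_module
begin

lemma smult_closed [simp, intro]: "a \<in> carrier R \<Longrightarrow> x \<in> carrier M \<Longrightarrow> a \<odot>\<^bsub>M\<^esub> x \<in> carrier M"
  and smult_l_distr: "a \<in> carrier R \<Longrightarrow> b \<in> carrier R \<Longrightarrow> x \<in> carrier M \<Longrightarrow>
      (a \<oplus> b) \<odot>\<^bsub>M\<^esub> x = a \<odot>\<^bsub>M\<^esub> x \<oplus>\<^bsub>M\<^esub> b \<odot>\<^bsub>M\<^esub> x"
  and smult_r_distr: "a \<in> carrier R \<Longrightarrow> x \<in> carrier M \<Longrightarrow> y \<in> carrier M \<Longrightarrow>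
      a \<odot>\<^bsub>M\<^esub> (x \<oplus>\<^bsub>M\<^esub> y) = a \<odot>\<^bsub>M\<^esub> x \<oplus>\<^bsub>M\<^esub> a \<odot>\<^bsub>M\<^esub> y"
  and smult_assoc: "a \<in> carrier R \<Longrightarrow> b \<in> carrier R \<Longrightarrow> x \<in> carrier M \<Longrightarrow>
      (a \<otimes> b) \<odot>\<^bsub>M\<^esub> x = a \<odot>\<^bsub>M\<^esub> (b \<odot>\<^bsub>M\<^esub> x)"
  and smult_one [simp]: "x \<in> carrier M \<Longrightarrow> \<one> \<odot>\<^bsub>M\<^esub> x = x"
  using smult_axioms unfolding module_axioms_def by auto

lemma smult_hom:
  assumes "a \<in> carrier R" shows "(\<lambda>x. a \<odot>\<^bsub>M\<^esub> x) \<in> hom (add_monoid M) (add_monoid M)"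
  using assms by (auto simp: hom_def smult_r_distr)

lemma smult_group_hom:
  assumes "a \<in> carrier R" shows "group_hom (add_monoid M) (add_monoid M) (\<lambda>x. a \<odot>\<^bsub>M\<^esub> x)"
  using smult_hom[OF assms] M.a_group by (simp add: group_hom_def group_hom_axioms_def)

lemma smult_r_null [simp]: "a \<in> carrier R \<Longrightarrow> a \<odot>\<^bsub>M\<^esub> \<zero>\<^bsub>M\<^esub> = \<zero>\<^bsub>M\<^esub>"
  using group_hom.hom_one[OF smult_group_hom] by simp

lemma smult_l_null [simp]: "x \<in> carrier M \<Longrightarrow> \<zero> \<odot>\<^bsub>M\<^esub> x = \<zero>\<^bsub>M\<^esub>"
  using smult_l_distr[of \<zero> \<zero> x] M.add.l_cancel_one'[of "\<zero> \<odot>\<^bsub>M\<^esub> x" "\<zero> \<odot>\<^bsub>M\<^esub> x"] by simp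

lemma smult_r_minus: "a \<in> carrier R \<Longrightarrow> x \<in> carrier M \<Longrightarrow> a \<odot>\<^bsub>M\<^esub> (\<ominus>\<^bsub>M\<^esub> x) = \<ominus>\<^bsub>M\<^esub> (a \<odot>\<^bsub>M\<^esub> x)"
  using group_hom.hom_inv[OF smult_group_hom] by (simp add: a_inv_def)

lemma smult_l_minus: "a \<in> carrier R \<Longrightarrow> x \<in> carrier M \<Longrightarrow> (\<ominus> a) \<odot>\<^bsub>M\<^esub> x = \<ominus>\<^bsub>M\<^esub> (a \<odot>\<^bsub>M\<^esub> x)"
  using smult_l_distr[of "\<ominus> a" a x] by (simp add: R.l_neg M.minus_equality)

lemma smult_minus_one:
  "a \<in> carrier R \<Longrightarrow> x \<in> carrier M \<Longrightarrow> (a \<ominus> \<one>) \<odot>\<^bsub>M\<^esub> x = a \<odot>\<^bsub>M\<^esub> x \<ominus>\<^bsub>M\<^esub> x"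
  by (simp add: R.minus_eq M.minus_eq smult_l_distr smult_l_minus)

lemma smult_add_pow:
  "a \<in> carrier R \<Longrightarrow> x \<in> carrier M \<Longrightarrow> a \<odot>\<^bsub>M\<^esub> (add_pow M (n::nat) x) = add_pow M n (a \<odot>\<^bsub>M\<^esub> x)"
  using group_hom.hom_nat_pow[OF smult_group_hom] by (simp add: add_pow_def)

lemma add_pow_smult:
  "a \<in> carrier R \<Longrightarrow> x \<in> carrier M \<Longrightarrow> (add_pow R (n::nat) a) \<odot>\<^bsub>M\<^esub> x = add_pow M n (a \<odot>\<^bsub>M\<^esub> x)"
proof (induction n)
  case (Suc n)
  have "add_pow R n a \<in> carrier R" using Suc by simp
  then show ?case using Suc by (simp add: smult_l_distr)
qed simp

lemma smult_image_subgroup: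
  assumes "a \<in> carrier R" "subgroup D (add_monoid M)"
  shows "subgroup ((\<lambda>x. a \<odot>\<^bsub>M\<^esub> x) ` D) (add_monoid M)"
  using group_hom.subgroup_img_is_subgroup[OF smult_group_hom[OF assms(1)] assms(2)] .

lemma add_subgroupI:
  assumes "D \<subseteq> carrier M" "\<zero>\<^bsub>M\<^esub> \<in> D" "\<And>x y. x \<in> D \<Longrightarrow> y \<in> D \<Longrightarrow> x \<oplus>\<^bsub>M\<^esub> y \<in> D"
    "\<And>x. x \<in> D \<Longrightarrow> \<ominus>\<^bsub>M\<^esub> x \<in> D"
  shows "subgroup D (add_monoid M)"
  using assms by (intro subgroup.intro) (auto simp: a_inv_def)

lemma add_subgroupD:
  assumes "subgroup D (add_monoid M)"
  shows "D \<subseteq> carrier M" "\<zero>\<^bsub>M\<^esub> \<in> D" "\<And>x y. x \<in> D \<Longrightarrow> y \<in> D \<Longrightarrow> x \<oplus>\<^bsub>M\<^esub> y \<in> D"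
    "\<And>x. x \<in> D \<Longrightarrow> \<ominus>\<^bsub>M\<^esub> x \<in> D"
  using subgroup.subset[OF assms] subgroup.one_closed[OF assms] subgroup.m_closed[OF assms]
    subgroup.m_inv_closed[OF assms] by (auto simp: a_inv_def)

lemma a_rcos_eq_iff:
  assumes "subgroup D (add_monoid M)" "x \<in> carrier M" "y \<in> carrier M"
  shows "D +>\<^bsub>M\<^esub> x = D +>\<^bsub>M\<^esub> y \<longleftrightarrow> x \<ominus>\<^bsub>M\<^esub> y \<in> D"
  using group.rcos_eq_iff[OF M.a_group assms(1)] assms
  by (simp add: a_r_coset_def a_minus_def a_inv_def)

lemma lspan_minimal: "submodule N R M \<Longrightarrow> S \<subseteq> N \<Longrightarrow> lspan R M S \<subseteq> N"
  by (auto simp: lspan_def)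

lemma lspan_subset_eqI:
  assumes "submodule N R M" "S \<subseteq> N" "\<And>x N'. x \<in> N \<Longrightarrow> submodule N' R M \<Longrightarrow> S \<subseteq> N' \<Longrightarrow> x \<in> N'"
  shows "lspan R M S = N"
  using assms unfolding lspan_def by blast

end

subsection \<open>Quotient modules\<close>

locale left_submodule = left_module R M + submodule N R M
  for N and R :: "('r, 'c) ring_scheme" (structure) and M :: "('r, 'm) module"
begin

sublocale abelian_subgroup N M
  by (rule abelian_subgroupI3) (rule additive_subgroup.intro, rule subgroup_axioms, rule M.abelian_group_axioms)

lemma N_subgroup: "subgroup N (add_monoid M)"
  by (rule subgroup_axioms)

lemma carrier_quot: "carrier (quot_module M N) = (\<lambda>x. N +>\<^bsub>M\<^esub> x) ` carrier M"
  by (auto simp: quot_module_def A_RCOSETS_def RCOSETS_def a_r_coset_def)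

lemma add_quot:
  "x \<in> carrier M \<Longrightarrow> y \<in> carrier M \<Longrightarrow>
    (N +>\<^bsub>M\<^esub> x) \<oplus>\<^bsub>quot_module M N\<^esub> (N +>\<^bsub>M\<^esub> y) = N +>\<^bsub>M\<^esub> (x \<oplus>\<^bsub>M\<^esub> y)"
  by (simp add: quot_module_def a_rcos_sum)

lemma zero_quot: "\<zero>\<^bsub>quot_module M N\<^esub> = N +>\<^bsub>M\<^esub> \<zero>\<^bsub>M\<^esub>"
  by (simp add: quot_module_def M.a_coset_add_zero[OF a_subset])

text \<open>All z in one coset give the same coset of r z, so the union in
  \<open>quot_module\<close> is one of copies of a single set over a nonempty index set.\<close>

lemma smult_quot:
  assumes "r \<in> carrier R" "x \<in> carrier M"
  shows "r \<odot>\<^bsub>quot_module M N\<^esub> (N +>\<^bsub>M\<^esub> x) = N +>\<^bsub>M\<^esub> (r \<odot>\<^bsub>M\<^esub> x)"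
proof -
  have "N +>\<^bsub>M\<^esub> (r \<odot>\<^bsub>M\<^esub> z) = N +>\<^bsub>M\<^esub> (r \<odot>\<^bsub>M\<^esub> x)" if z: "z \<in> N +>\<^bsub>M\<^esub> x" for z
  proof -
    obtain n where n: "n \<in> N" "z = n \<oplus>\<^bsub>M\<^esub> x" using z by (auto simp: a_r_coset_def' )
    then have c: "n \<in> carrier M" using a_subset by blast
    have "r \<odot>\<^bsub>M\<^esub> z \<ominus>\<^bsub>M\<^esub> r \<odot>\<^bsub>M\<^esub> x = r \<odot>\<^bsub>M\<^esub> n"
      using assms c by (simp add: n smult_r_distr M.minus_eq M.a_assoc M.r_neg)
    moreover have "r \<odot>\<^bsub>M\<^esub> n \<in> N" using assms n by simp
    ultimately show ?thesis using a_rcos_eq_iff[OF N_subgroup] assms c n by simp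
  qed
  then have "(\<Union>z\<in>N +>\<^bsub>M\<^esub> x. N +>\<^bsub>M\<^esub> (r \<odot>\<^bsub>M\<^esub> z)) = (\<Union>z\<in>N +>\<^bsub>M\<^esub> x. N +>\<^bsub>M\<^esub> (r \<odot>\<^bsub>M\<^esub> x))"
    by (intro SUP_cong) auto
  also have "\<dots> = N +>\<^bsub>M\<^esub> (r \<odot>\<^bsub>M\<^esub> x)"
    using a_rcos_self[OF assms(2)] by (simp only: UN_constant) (auto simp: empty_iff)
  finally show ?thesis by (simp add: quot_module_def)
qed

lemma quot_left_module: "left_module R (quot_module M N)"
proof (rule left_moduleI)
  show "ring R" by (rule R.ring_axioms)
  show "abelian_group (quot_module M N)"
  proof (rule abelian_groupI)
    fix c assume "c \<in> carrier (quot_module M N)"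
    then obtain x where x: "x \<in> carrier M" "c = N +>\<^bsub>M\<^esub> x" by (auto simp: carrier_quot)
    then show "\<exists>d\<in>carrier (quot_module M N). d \<oplus>\<^bsub>quot_module M N\<^esub> c = \<zero>\<^bsub>quot_module M N\<^esub>"
      by (intro bexI[of _ "N +>\<^bsub>M\<^esub> (\<ominus>\<^bsub>M\<^esub> x)"]) (auto simp: carrier_quot add_quot zero_quot M.l_neg)
  qed (auto simp: carrier_quot add_quot zero_quot M.a_ac)
qed (auto simp: carrier_quot add_quot smult_quot smult_l_distr smult_r_distr smult_assoc)

end

lemma regular_left_module: "ring R \<Longrightarrow> left_module R (regular_module R)"
proof (rule left_moduleI)
  assume "ring R"
  then interpret ring R .
  show "abelian_group (regular_module R)"
    by (rule abelian_groupI) (auto simp: regular_module_def a_ac intro: bexI[of _ "\<ominus>\<^bsub>R\<^esub> x" for x] l_neg)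
qed (auto simp: regular_module_def ring.ring_simprules)

lemma add_pow_regular_module: "add_pow (regular_module R) (n::nat) x = add_pow R n x"
  by (simp add: add_pow_def regular_module_def nat_pow_def)

definition multiples :: "('r, 'c) ring_scheme \<Rightarrow> nat \<Rightarrow> 'r set" where
  "multiples R n = (\<lambda>x. add_pow R n x) ` carrier R"

lemma mod_by_regular_module: "mod_by (regular_module R) n = quot_module (regular_module R) (multiples R n)"
  by (simp add: mod_by_def multiples_def add_pow_regular_module) (simp add: regular_module_def)

lemma (in ring) multiples_submodule: "left_submodule (multiples R n) R (regular_module R)"
proof -
  interpret L: left_module R "regular_module R" by (rule regular_left_module) (rule ring_axioms)
  have sm: "r \<otimes> add_pow R n x = add_pow R n (r \<otimes> x)" if "r \<in> carrier R" "x \<in> carrier R" for r x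
    using L.smult_add_pow[of r x n] that by (simp add: add_pow_regular_module) (simp add: regular_module_def)
  have "subgroup (multiples R n) (add_monoid (regular_module R))"
  proof -
    have "(\<lambda>x. x [^]\<^bsub>add_monoid R\<^esub> n) \<in> hom (add_monoid R) (add_monoid R)"
      using comm_monoid.nat_pow_distrib[OF add.comm_monoid_axioms]
        monoid.nat_pow_closed[OF add.monoid_axioms] by (auto simp: hom_def)
    then have "group_hom (add_monoid R) (add_monoid R) (\<lambda>x. x [^]\<^bsub>add_monoid R\<^esub> n)"
      by (simp add: group_hom_def group_hom_axioms_def a_group)
    from group_hom.img_is_subgroup[OF this] show ?thesis
      by (simp add: multiples_def add_pow_def regular_module_def subgroup_def m_inv_def)
  qed
  then have "submodule (multiples R n) R (regular_module R)"
    by (intro submodule.intro) (auto simp: submodule_axioms_def multiples_def sm regular_module_def)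
  then show ?thesis by (simp add: left_submodule_def L.left_module_axioms)
qed

subsection \<open>Direct sums\<close>

lemma direct_sum_left_module:
  assumes "ring R" "\<And>i. i \<in> I \<Longrightarrow> left_module R (M i)"
  shows "left_module R (direct_sum I M)"
proof (rule left_moduleI)
  have ab: "abelian_group (M i)" if "i \<in> I" for i using assms(2)[OF that] by (simp add: left_module_def)
  have cl: "x \<oplus>\<^bsub>M i\<^esub> y \<in> carrier (M i)" if "i \<in> I" "x \<in> carrier (M i)" "y \<in> carrier (M i)" for i x y
    using abelian_monoid.a_closed that ab by (metis abelian_group_def)
  have z: "\<zero>\<^bsub>M i\<^esub> \<in> carrier (M i)" if "i \<in> I" for i
    using abelian_monoid.zero_closed that ab by (metis abelian_group_def)
  show "abelian_group (direct_sum I M)"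
  proof (rule abelian_groupI)
    fix x assume x: "x \<in> carrier (direct_sum I M)"
    define y where "y = (\<lambda>i\<in>I. \<ominus>\<^bsub>M i\<^esub> x i)"
    have "y \<in> carrier (direct_sum I M)" "y \<oplus>\<^bsub>direct_sum I M\<^esub> x = \<zero>\<^bsub>direct_sum I M\<^esub>"
      using x abelian_group.a_inv_closed[OF ab] abelian_group.l_neg[OF ab]
      by (auto simp: y_def direct_sum_def PiE_iff)
    then show "\<exists>y\<in>carrier (direct_sum I M). y \<oplus>\<^bsub>direct_sum I M\<^esub> x = \<zero>\<^bsub>direct_sum I M\<^esub>" by blast
  next
    fix x y assume "x \<in> carrier (direct_sum I M)" "y \<in> carrier (direct_sum I M)"
    then show "x \<oplus>\<^bsub>direct_sum I M\<^esub> y \<in> carrier (direct_sum I M)"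
      "x \<oplus>\<^bsub>direct_sum I M\<^esub> y = y \<oplus>\<^bsub>direct_sum I M\<^esub> x"
      using cl abelian_monoid.a_comm[OF abelian_group.axioms(1)[OF ab]]
      by (auto simp: direct_sum_def PiE_iff intro!: restrict_ext)
  next
    fix x y z assume "x \<in> carrier (direct_sum I M)" "y \<in> carrier (direct_sum I M)" "z \<in> carrier (direct_sum I M)"
    then show "x \<oplus>\<^bsub>direct_sum I M\<^esub> y \<oplus>\<^bsub>direct_sum I M\<^esub> z = x \<oplus>\<^bsub>direct_sum I M\<^esub> (y \<oplus>\<^bsub>direct_sum I M\<^esub> z)"
      using abelian_monoid.a_assoc[OF abelian_group.axioms(1)[OF ab]]
      by (auto simp: direct_sum_def PiE_iff intro!: restrict_ext)
  next
    fix x assume x: "x \<in> carrier (direct_sum I M)"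
    have "\<zero>\<^bsub>M i\<^esub> \<oplus>\<^bsub>M i\<^esub> x i = x i" if "i \<in> I" for i
      using x that abelian_monoid.l_zero[OF abelian_group.axioms(1)[OF ab[OF that]]]
      by (auto simp: direct_sum_def PiE_iff)
    then have "\<zero>\<^bsub>direct_sum I M\<^esub> \<oplus>\<^bsub>direct_sum I M\<^esub> x = (\<lambda>i\<in>I. x i)"
      by (auto simp: direct_sum_def)
    also have "\<dots> = x" using x by (simp add: direct_sum_def PiE_iff extensional_restrict)
    finally show "\<zero>\<^bsub>direct_sum I M\<^esub> \<oplus>\<^bsub>direct_sum I M\<^esub> x = x" .
  qed (use z in \<open>auto simp: direct_sum_def\<close>)
  fix x assume x: "x \<in> carrier (direct_sum I M)"
  have "\<one>\<^bsub>R\<^esub> \<odot>\<^bsub>M i\<^esub> x i = x i" if "i \<in> I" for i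
    using x that left_module.smult_one[OF assms(2)[OF that]] by (auto simp: direct_sum_def PiE_iff)
  then have "\<one>\<^bsub>R\<^esub> \<odot>\<^bsub>direct_sum I M\<^esub> x = (\<lambda>i\<in>I. x i)"
    by (auto simp: direct_sum_def)
  also have "\<dots> = x" using x by (simp add: direct_sum_def PiE_iff extensional_restrict)
  finally show "\<one>\<^bsub>R\<^esub> \<odot>\<^bsub>direct_sum I M\<^esub> x = x" .
qed (use assms(1) left_module.smult_closed[OF assms(2)] in
    \<open>auto simp: direct_sum_def PiE_iff left_module.smult_l_distr[OF assms(2)]
    left_module.smult_r_distr[OF assms(2)] left_module.smult_assoc[OF assms(2)] intro!: restrict_ext\<close>)

section \<open>Counting in the exact sequence\<close>

lemma lin_mapsD:
  assumes "f \<in> lin_maps R M N"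
  shows "x \<in> carrier M \<Longrightarrow> f x \<in> carrier N"
    "x \<in> carrier M \<Longrightarrow> y \<in> carrier M \<Longrightarrow> f (x \<oplus>\<^bsub>M\<^esub> y) = f x \<oplus>\<^bsub>N\<^esub> f y"
    "r \<in> carrier R \<Longrightarrow> x \<in> carrier M \<Longrightarrow> f (r \<odot>\<^bsub>M\<^esub> x) = r \<odot>\<^bsub>N\<^esub> f x"
  using assms by (auto simp: lin_maps_def)

lemma lin_maps_hom: "f \<in> lin_maps R M N \<Longrightarrow> f \<in> hom (add_monoid M) (add_monoid N)"
  by (auto simp: lin_maps_def hom_def)

lemma restrict_scalars_sel:
  "carrier (restrict_scalars h M) = carrier M" "zero (restrict_scalars h M) = zero M"
  "add (restrict_scalars h M) = add M" "s \<odot>\<^bsub>restrict_scalars h M\<^esub> x = h s \<odot>\<^bsub>M\<^esub> x"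
  by (simp_all add: restrict_scalars_def)

lemma submodule_restrict_scalars:
  "submodule N S (restrict_scalars h M) \<longleftrightarrow>
    subgroup N (add_monoid M) \<and> (\<forall>s\<in>carrier S. \<forall>x\<in>N. h s \<odot>\<^bsub>M\<^esub> x \<in> N)"
  by (auto simp: submodule_def submodule_axioms_def subgroup_def m_inv_def restrict_scalars_sel)

text \<open>Here \<omega> stands for h^(p^k) - 1. In the noncommutative ring R the condition
  \<open>\<omega>_normal\<close>, that R\<omega> is contained in \<omega>R, replaces centrality: it
  makes \<omega>M a submodule of every left module M.\<close>

locale exact_seq =
  A: left_module R A + X: left_module R X + E: left_module R E + B: left_module R B
  for R :: "('r, 'c) ring_scheme" (structure) and A :: "('r, 'a) module" and X :: "('r, 'x) module"
    and E :: "('r, 'e) module" and B :: "('r, 'b) module" +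
  fixes \<alpha> \<phi> \<beta> \<omega>
  assumes \<alpha>: "\<alpha> \<in> lin_maps R A X" and \<phi>: "\<phi> \<in> lin_maps R X E" and \<beta>: "\<beta> \<in> lin_maps R E B"
    and inj: "inj_on \<alpha> (carrier A)" and exact_X: "a_kernel X E \<phi> = \<alpha> ` carrier A"
    and exact_E: "a_kernel E B \<beta> = \<phi> ` carrier X" and surj: "\<beta> ` carrier E = carrier B"
    and \<omega>: "\<omega> \<in> carrier R"
    and \<omega>_normal: "\<And>r. r \<in> carrier R \<Longrightarrow> \<exists>r'\<in>carrier R. r \<otimes> \<omega> = \<omega> \<otimes> r'"
    and \<omega>_inj: "\<And>e. e \<in> carrier E \<Longrightarrow> \<omega> \<odot>\<^bsub>E\<^esub> e = \<zero>\<^bsub>E\<^esub> \<Longrightarrow> e = \<zero>\<^bsub>E\<^esub>"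
begin

definition W where "W = (\<lambda>x. \<omega> \<odot>\<^bsub>X\<^esub> x) ` carrier X"

definition F where "F = {x \<in> carrier X. \<phi> x \<in> (\<lambda>e. \<omega> \<odot>\<^bsub>E\<^esub> e) ` carrier E}"

sublocale \<phi>: group_hom "add_monoid X" "add_monoid E" \<phi>
  using lin_maps_hom[OF \<phi>] X.M.a_group E.M.a_group by (simp add: group_hom_def group_hom_axioms_def)

sublocale \<alpha>: group_hom "add_monoid A" "add_monoid X" \<alpha>
  using lin_maps_hom[OF \<alpha>] X.M.a_group A.M.a_group by (simp add: group_hom_def group_hom_axioms_def)

sublocale \<beta>: group_hom "add_monoid E" "add_monoid B" \<beta>
  using lin_maps_hom[OF \<beta>] E.M.a_group B.M.a_group by (simp add: group_hom_def group_hom_axioms_def)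

lemma ker_\<phi>: "x \<in> carrier X \<Longrightarrow> \<phi> x = \<zero>\<^bsub>E\<^esub> \<longleftrightarrow> x \<in> \<alpha> ` carrier A"
  using exact_X by (auto simp: a_kernel_def kernel_def)

lemma ker_\<beta>: "e \<in> carrier E \<Longrightarrow> \<beta> e = \<zero>\<^bsub>B\<^esub> \<longleftrightarrow> e \<in> \<phi> ` carrier X"
  using exact_E by (auto simp: a_kernel_def kernel_def)

lemma \<omega>E_stable:
  assumes "r \<in> carrier R" "y \<in> (\<lambda>e. \<omega> \<odot>\<^bsub>E\<^esub> e) ` carrier E"
  shows "r \<odot>\<^bsub>E\<^esub> y \<in> (\<lambda>e. \<omega> \<odot>\<^bsub>E\<^esub> e) ` carrier E"
proof -
  obtain e where e: "e \<in> carrier E" "y = \<omega> \<odot>\<^bsub>E\<^esub> e" using assms(2) by auto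
  obtain r' where r': "r' \<in> carrier R" "r \<otimes> \<omega> = \<omega> \<otimes> r'" using \<omega>_normal[OF assms(1)] by auto
  have "r \<odot>\<^bsub>E\<^esub> y = \<omega> \<odot>\<^bsub>E\<^esub> (r' \<odot>\<^bsub>E\<^esub> e)"
    using e r' assms(1) \<omega> E.smult_assoc by metis
  then show ?thesis using e r' by auto
qed

lemma W_subgroup: "subgroup W (add_monoid X)"
  unfolding W_def using X.smult_image_subgroup[OF \<omega> group.subgroup_self[OF X.M.a_group]] by simp

lemma W_submodule: "submodule W R X"
proof (intro submodule.intro W_subgroup, unfold submodule_axioms_def, intro allI impI)
  fix r y assume r: "r \<in> carrier R" and "y \<in> W"
  then obtain x where x: "x \<in> carrier X" "y = \<omega> \<odot>\<^bsub>X\<^esub> x" by (auto simp: W_def)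
  obtain r' where r': "r' \<in> carrier R" "r \<otimes> \<omega> = \<omega> \<otimes> r'" using \<omega>_normal[OF r] by auto
  have "r \<odot>\<^bsub>X\<^esub> y = \<omega> \<odot>\<^bsub>X\<^esub> (r' \<odot>\<^bsub>X\<^esub> x)"
    using x r' r \<omega> X.smult_assoc by metis
  then show "r \<odot>\<^bsub>X\<^esub> y \<in> W" using x r' by (auto simp: W_def)
qed

sublocale Q: left_submodule W R X
  by (intro left_submodule.intro X.left_module_axioms W_submodule)

lemma \<omega>E_subgroup: "subgroup ((\<lambda>e. \<omega> \<odot>\<^bsub>E\<^esub> e) ` carrier E) (add_monoid E)"
  using E.smult_image_subgroup[OF \<omega> group.subgroup_self[OF E.M.a_group]] by simp

lemma F_subgroup: "subgroup F (add_monoid X)"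
  using \<phi>.hom_one \<phi>.hom_mult \<phi>.hom_inv E.add_subgroupD[OF \<omega>E_subgroup]
  by (intro X.add_subgroupI) (auto simp: F_def a_inv_def simp del: image_iff)

lemma F_smult: "r \<in> carrier R \<Longrightarrow> x \<in> F \<Longrightarrow> r \<odot>\<^bsub>X\<^esub> x \<in> F"
  using \<omega>E_stable lin_mapsD(3)[OF \<phi>] by (auto simp: F_def simp del: image_iff)

lemma W_subset_F: "W \<subseteq> F"
  using lin_mapsD[OF \<phi>] \<omega> by (auto simp: F_def W_def)

text \<open>A snake argument in terms of indices. With P = \<alpha>(A) + \<omega>X, the index of
  \<omega>X in P is that of \<alpha>(A) \<inter> \<omega>X in \<alpha>(A); since \<omega> is
  injective on E, an element \<omega>x of \<alpha>(A) has \<phi>(x) = 0, so this intersection is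
  \<alpha>(\<omega>A). The upper part F/P is carried by \<phi> to \<omega>Q/\<omega>J with J =
  \<phi>(X) and Q the preimage of the \<omega>-torsion of B; cancelling \<omega> leaves Q/J, which
  \<beta> identifies with that torsion.\<close>

lemma card_F_mod_W:
  "index (add_monoid X) F W =
    index (add_monoid A) (carrier A) ((\<lambda>a. \<omega> \<odot>\<^bsub>A\<^esub> a) ` carrier A) *
    card {b \<in> carrier B. \<omega> \<odot>\<^bsub>B\<^esub> b = \<zero>\<^bsub>B\<^esub>}"
proof -
  let ?A = "add_monoid A" and ?X = "add_monoid X" and ?E = "add_monoid E" and ?B = "add_monoid B"
  note AX = X.M.a_comm_group and AXg = X.M.a_group and AAg = A.M.a_group and AEg = E.M.a_group
    and ABg = B.M.a_group
  let ?wE = "\<lambda>e. \<omega> \<odot>\<^bsub>E\<^esub> e" and ?wA = "\<lambda>a. \<omega> \<odot>\<^bsub>A\<^esub> a"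
  let ?I = "\<alpha> ` carrier A" and ?J = "\<phi> ` carrier X"
  have I: "subgroup ?I ?X" using \<alpha>.img_is_subgroup by simp
  have J: "subgroup ?J ?E" using \<phi>.img_is_subgroup by simp
  have wA: "subgroup (?wA ` carrier A) ?A" using A.smult_image_subgroup[OF \<omega> group.subgroup_self[OF AAg]] by simp
  have wJ: "subgroup (?wE ` ?J) ?E" by (rule E.smult_image_subgroup[OF \<omega> J])
  define P where "P = ?I <#>\<^bsub>?X\<^esub> W"
  have P: "subgroup P ?X" unfolding P_def by (rule comm_group.mult_subgroups[OF AX I W_subgroup])
  have Pel: "y \<in> P \<longleftrightarrow> (\<exists>a\<in>carrier A. \<exists>w\<in>W. y = \<alpha> a \<oplus>\<^bsub>X\<^esub> w)" for y
    by (auto simp: P_def set_mult_def)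
  have Wc: "w \<in> carrier X" if "w \<in> W" for w using X.add_subgroupD(1)[OF W_subgroup] that by blast
  have WP: "W \<subseteq> P"
  proof
    fix w assume "w \<in> W"
    then show "w \<in> P" unfolding Pel using Wc \<alpha>.hom_one A.M.zero_closed
      by (intro bexI[of _ "\<zero>\<^bsub>A\<^esub>"] bexI[of _ w]) auto
  qed
  have IP: "?I \<subseteq> P"
  proof
    fix y assume "y \<in> ?I"
    then obtain a where "a \<in> carrier A" "y = \<alpha> a" by auto
    moreover then have "y = \<alpha> a \<oplus>\<^bsub>X\<^esub> \<zero>\<^bsub>X\<^esub>" using lin_mapsD[OF \<alpha>] by simp
    ultimately show "y \<in> P" unfolding Pel using X.add_subgroupD(2)[OF W_subgroup] by blast
  qed
  have IF: "?I \<subseteq> F"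
  proof
    fix y assume y: "y \<in> ?I"
    then have c: "y \<in> carrier X" using lin_mapsD[OF \<alpha>] by auto
    then have "\<phi> y = \<omega> \<odot>\<^bsub>E\<^esub> \<zero>\<^bsub>E\<^esub>" using ker_\<phi> y \<omega> by simp
    then show "y \<in> F" unfolding F_def using c by blast
  qed
  have PF: "P \<subseteq> F"
  proof
    fix y assume "y \<in> P"
    then obtain a w where "a \<in> carrier A" "w \<in> W" "y = \<alpha> a \<oplus>\<^bsub>X\<^esub> w" unfolding Pel by blast
    then show "y \<in> F" using X.add_subgroupD(3)[OF F_subgroup] IF W_subset_F by blast
  qed
  have 1: "index ?X F W = index ?X F P * index ?X P W"
    by (rule comm_group.index_tower[OF AX W_subgroup P F_subgroup WP PF])
  have IW: "?I \<inter> W = \<alpha> ` ?wA ` carrier A"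
  proof
    show "?I \<inter> W \<subseteq> \<alpha> ` ?wA ` carrier A"
    proof
      fix y assume y: "y \<in> ?I \<inter> W"
      then obtain x where x: "x \<in> carrier X" "y = \<omega> \<odot>\<^bsub>X\<^esub> x" by (auto simp: W_def)
      have "\<omega> \<odot>\<^bsub>E\<^esub> \<phi> x = \<phi> y" using x lin_mapsD(3)[OF \<phi> \<omega>] by simp
      also have "\<dots> = \<zero>\<^bsub>E\<^esub>" using y ker_\<phi>[of y] Wc by blast
      finally have "\<phi> x = \<zero>\<^bsub>E\<^esub>" using \<omega>_inj x lin_mapsD(1)[OF \<phi>] by blast
      then obtain a where a: "a \<in> carrier A" "x = \<alpha> a" using ker_\<phi> x by auto
      then have "y = \<alpha> (\<omega> \<odot>\<^bsub>A\<^esub> a)" using x lin_mapsD(3)[OF \<alpha> \<omega>] by simp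
      then show "y \<in> \<alpha> ` ?wA ` carrier A" using a by blast
    qed
    show "\<alpha> ` ?wA ` carrier A \<subseteq> ?I \<inter> W"
    proof clarify
      fix a assume a: "a \<in> carrier A"
      then have "\<alpha> (\<omega> \<odot>\<^bsub>A\<^esub> a) = \<omega> \<odot>\<^bsub>X\<^esub> \<alpha> a" using lin_mapsD(3)[OF \<alpha> \<omega>] by simp
      moreover have "\<omega> \<odot>\<^bsub>X\<^esub> \<alpha> a \<in> W" using a lin_mapsD(1)[OF \<alpha>] by (auto simp: W_def)
      ultimately show "\<alpha> (\<omega> \<odot>\<^bsub>A\<^esub> a) \<in> ?I \<inter> W" using A.smult_closed[OF \<omega> a] by (metis IntI imageI)
    qed
  qed
  have "index ?X P W = index ?X ?I (?I \<inter> W)"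
  proof (rule comm_group.index_second_iso[OF AX W_subgroup I IP])
    fix d assume "d \<in> P"
    then obtain a w where "a \<in> carrier A" "w \<in> W" "d = \<alpha> a \<oplus>\<^bsub>X\<^esub> w" unfolding Pel by blast
    moreover from this have "d = w \<oplus>\<^bsub>X\<^esub> \<alpha> a" using X.M.a_comm[of "\<alpha> a" w] Wc lin_mapsD(1)[OF \<alpha>] by simp
    ultimately show "\<exists>s\<in>W. \<exists>k\<in>?I. d = s \<otimes>\<^bsub>?X\<^esub> k" by force
  qed
  also have "\<dots> = index ?A (carrier A) (?wA ` carrier A)"
    unfolding IW
  proof (rule group.index_hom_inj[OF AAg lin_maps_hom[OF \<alpha>] AXg _ wA])
    show "x = \<one>\<^bsub>?A\<^esub>" if "x \<in> carrier A" "\<alpha> x = \<one>\<^bsub>?X\<^esub>" for x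
      using inj_onD[OF inj, of x "\<zero>\<^bsub>A\<^esub>"] that \<alpha>.hom_one by simp
  qed (use group.subgroup_self[OF AAg] \<omega> in auto)
  finally have 2: "index ?X P W = index ?A (carrier A) (?wA ` carrier A)" .
  define Q where "Q = {e \<in> carrier E. \<omega> \<odot>\<^bsub>B\<^esub> \<beta> e = \<zero>\<^bsub>B\<^esub>}"
  have B\<omega>: "subgroup {b \<in> carrier B. \<omega> \<odot>\<^bsub>B\<^esub> b = \<zero>\<^bsub>B\<^esub>} ?B"
    using \<omega> by (intro B.add_subgroupI) (auto simp: B.smult_r_distr B.smult_r_minus)
  have "Q = {e \<in> carrier E. \<beta> e \<in> {b \<in> carrier B. \<omega> \<odot>\<^bsub>B\<^esub> b = \<zero>\<^bsub>B\<^esub>}}"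
    using lin_mapsD(1)[OF \<beta>] by (auto simp: Q_def)
  then have Q: "subgroup Q ?E"
    using \<beta>.hom_one \<beta>.hom_mult \<beta>.hom_inv B.add_subgroupD[OF B\<omega>]
    by (intro E.add_subgroupI) (auto simp: a_inv_def)
  have Qc: "Q \<subseteq> carrier E" by (auto simp: Q_def)
  have JQ: "?J \<subseteq> Q"
  proof
    fix e assume e: "e \<in> ?J"
    then have "e \<in> carrier E" using lin_mapsD(1)[OF \<phi>] by auto
    moreover have "\<beta> e = \<zero>\<^bsub>B\<^esub>" using calculation e ker_\<beta> by blast
    ultimately show "e \<in> Q" using \<omega> by (simp add: Q_def)
  qed
  have "index ?X F P = index ?E (\<phi> ` F) (\<phi> ` P)"
    by (rule group.index_hom[OF AXg lin_maps_hom[OF \<phi>] AEg F_subgroup P PF, symmetric])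
       (use ker_\<phi> IP in \<open>auto simp: F_def\<close>)
  also have "\<phi> ` P = ?wE ` ?J"
  proof
    show "\<phi> ` P \<subseteq> ?wE ` ?J"
    proof clarify
      fix y assume "y \<in> P"
      then obtain a w where aw: "a \<in> carrier A" "w \<in> W" "y = \<alpha> a \<oplus>\<^bsub>X\<^esub> w" unfolding Pel by blast
      then obtain x where x: "x \<in> carrier X" "w = \<omega> \<odot>\<^bsub>X\<^esub> x" by (auto simp: W_def)
      have "\<phi> (\<alpha> a) = \<zero>\<^bsub>E\<^esub>" using ker_\<phi>[of "\<alpha> a"] aw lin_mapsD(1)[OF \<alpha>] by auto
      moreover have "\<phi> w = \<omega> \<odot>\<^bsub>E\<^esub> \<phi> x" using x lin_mapsD(3)[OF \<phi> \<omega>] by simp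
      moreover have "\<phi> y = \<phi> (\<alpha> a) \<oplus>\<^bsub>E\<^esub> \<phi> w"
        using aw lin_mapsD(2)[OF \<phi>] lin_mapsD(1)[OF \<alpha>] Wc by simp
      ultimately have "\<phi> y = \<omega> \<odot>\<^bsub>E\<^esub> \<phi> x" using x \<omega> lin_mapsD(1)[OF \<phi>] by simp
      then show "\<phi> y \<in> ?wE ` ?J" using x by blast
    qed
    show "?wE ` ?J \<subseteq> \<phi> ` P"
    proof clarify
      fix x assume x: "x \<in> carrier X"
      have "\<omega> \<odot>\<^bsub>X\<^esub> x \<in> P" using WP x by (auto simp: W_def)
      then show "\<omega> \<odot>\<^bsub>E\<^esub> \<phi> x \<in> \<phi> ` P" using lin_mapsD(3)[OF \<phi> \<omega> x] by (metis imageI)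
    qed
  qed
  \<comment> \<open>If \<phi>(x) = \<omega>e, exactness at E gives \<omega>\<beta>(e) =
    \<beta>(\<phi>(x)) = 0. Conversely \<omega>e with e in Q lies in ker \<beta>, that is, in the
    image of \<phi>.\<close>
  also have "\<phi> ` F = ?wE ` Q"
  proof
    show "\<phi> ` F \<subseteq> ?wE ` Q"
    proof clarify
      fix x assume "x \<in> F"
      then obtain e where e: "x \<in> carrier X" "e \<in> carrier E" "\<phi> x = \<omega> \<odot>\<^bsub>E\<^esub> e" by (auto simp: F_def)
      then have "\<omega> \<odot>\<^bsub>B\<^esub> \<beta> e = \<zero>\<^bsub>B\<^esub>"
        using lin_mapsD(3)[OF \<beta> \<omega>, of e] ker_\<beta>[of "\<phi> x"] lin_mapsD(1)[OF \<phi>, of x] by force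
      then show "\<phi> x \<in> ?wE ` Q" using e by (auto simp: Q_def)
    qed
    show "?wE ` Q \<subseteq> \<phi> ` F"
    proof clarify
      fix e assume "e \<in> Q"
      then have e: "e \<in> carrier E" "\<omega> \<odot>\<^bsub>B\<^esub> \<beta> e = \<zero>\<^bsub>B\<^esub>" by (auto simp: Q_def)
      then have "\<omega> \<odot>\<^bsub>E\<^esub> e \<in> ?J" using ker_\<beta>[of "\<omega> \<odot>\<^bsub>E\<^esub> e"] lin_mapsD(3)[OF \<beta> \<omega>] \<omega> by auto
      then obtain x where "x \<in> carrier X" "\<phi> x = \<omega> \<odot>\<^bsub>E\<^esub> e" by auto
      then show "\<omega> \<odot>\<^bsub>E\<^esub> e \<in> \<phi> ` F" using e by (auto simp: F_def intro!: rev_image_eqI[of x])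
    qed
  qed
  also have "index ?E (?wE ` Q) (?wE ` ?J) = index ?E Q ?J"
    by (rule group.index_hom_inj[OF AEg E.smult_hom[OF \<omega>] AEg Q J JQ]) (use \<omega>_inj Qc in auto)
  also have "\<dots> = index ?B (\<beta> ` Q) (\<beta> ` ?J)"
    by (rule group.index_hom[OF AEg lin_maps_hom[OF \<beta>] ABg Q J JQ, symmetric]) (use ker_\<beta> Qc in auto)
  also have "\<beta> ` ?J = {\<one>\<^bsub>?B\<^esub>}"
  proof -
    have "\<beta> e = \<zero>\<^bsub>B\<^esub>" if "e \<in> ?J" for e using that ker_\<beta>[of e] lin_mapsD(1)[OF \<phi>] by auto
    moreover have "?J \<noteq> {}" by auto
    ultimately show ?thesis by (auto simp: image_iff)
  qed
  also have "\<beta> ` Q = {b \<in> carrier B. \<omega> \<odot>\<^bsub>B\<^esub> b = \<zero>\<^bsub>B\<^esub>}"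
  proof
    show "{b \<in> carrier B. \<omega> \<odot>\<^bsub>B\<^esub> b = \<zero>\<^bsub>B\<^esub>} \<subseteq> \<beta> ` Q"
    proof clarify
      fix b assume b: "b \<in> carrier B" "\<omega> \<odot>\<^bsub>B\<^esub> b = \<zero>\<^bsub>B\<^esub>"
      then obtain e where "e \<in> carrier E" "b = \<beta> e" using surj by blast
      then show "b \<in> \<beta> ` Q" using b by (auto simp: Q_def)
    qed
  qed (use lin_mapsD(1)[OF \<beta>] in \<open>auto simp: Q_def\<close>)
  also have "index ?B {b \<in> carrier B. \<omega> \<odot>\<^bsub>B\<^esub> b = \<zero>\<^bsub>B\<^esub>} {\<one>\<^bsub>?B\<^esub>} = card {b \<in> carrier B. \<omega> \<odot>\<^bsub>B\<^esub> b = \<zero>\<^bsub>B\<^esub>}"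
    by (rule group.index_one[OF ABg]) auto
  finally show ?thesis using 1 2 by simp
qed

lemma card_image_F: "card ((\<lambda>x. W +>\<^bsub>X\<^esub> x) ` F) = index (add_monoid X) F W"
  by (simp add: index_def a_r_coset_def)

section \<open>Maximality of F/\<omega>X among the finite submodules\<close>

text \<open>A unit \<open>g\<close> acting on a finite submodule has finite order there, so it suffices that
  \<open>E/\<omega>E\<close> has no nonzero element fixed by a power of \<open>g\<close>.\<close>

lemma max_finite_submodule_F:
  assumes pos: "index (add_monoid X) F W > 0"
    and h: "\<And>s. s \<in> carrier S \<Longrightarrow> h s \<in> carrier R"
    and g: "g \<in> h ` carrier S" "g' \<in> carrier R" "g' \<otimes> g = \<one>"
    and fixed: "\<And>n e. n > 0 \<Longrightarrow> e \<in> carrier E \<Longrightarrow>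
      (g [^] (n::nat) \<ominus> \<one>) \<odot>\<^bsub>E\<^esub> e \<in> (\<lambda>e. \<omega> \<odot>\<^bsub>E\<^esub> e) ` carrier E \<Longrightarrow>
      e \<in> (\<lambda>e. \<omega> \<odot>\<^bsub>E\<^esub> e) ` carrier E"
  shows "max_finite_submodule S (restrict_scalars h (quot_module X W)) ((\<lambda>x. W +>\<^bsub>X\<^esub> x) ` F)"
proof -
  interpret QM: left_module R "quot_module X W" by (rule Q.quot_left_module)
  have gc: "g \<in> carrier R" using g(1) h by auto
  have Fc: "F \<subseteq> carrier X" by (auto simp: F_def)
  have fin: "finite ((\<lambda>x. W +>\<^bsub>X\<^esub> x) ` F)"
    using pos card_image_F by (intro card_ge_0_finite) simp
  have coset_hom: "(\<lambda>x. W +>\<^bsub>X\<^esub> x) \<in> hom (add_monoid X) (add_monoid (quot_module X W))"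
    by (auto simp: hom_def Q.carrier_quot Q.add_quot)
  have "subgroup ((\<lambda>x. W +>\<^bsub>X\<^esub> x) ` F) (add_monoid (quot_module X W))"
    by (rule group_hom.subgroup_img_is_subgroup[OF _ F_subgroup])
       (use coset_hom X.M.a_group QM.M.a_group in \<open>simp add: group_hom_def group_hom_axioms_def\<close>)
  moreover have "h s \<odot>\<^bsub>quot_module X W\<^esub> y \<in> (\<lambda>x. W +>\<^bsub>X\<^esub> x) ` F"
    if s: "s \<in> carrier S" and y: "y \<in> (\<lambda>x. W +>\<^bsub>X\<^esub> x) ` F" for s y
  proof -
    obtain x where "x \<in> F" "y = W +>\<^bsub>X\<^esub> x" using y by auto
    then show ?thesis using Q.smult_quot[OF h[OF s]] F_smult[OF h[OF s]] Fc by blast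
  qed
  ultimately have sub: "submodule ((\<lambda>x. W +>\<^bsub>X\<^esub> x) ` F) S (restrict_scalars h (quot_module X W))"
    by (auto simp: submodule_restrict_scalars)
  have "N \<subseteq> (\<lambda>x. W +>\<^bsub>X\<^esub> x) ` F"
    if N: "submodule N S (restrict_scalars h (quot_module X W))" "finite N" for N
  proof
    fix \<xi> assume \<xi>: "\<xi> \<in> N"
    have Nsub: "subgroup N (add_monoid (quot_module X W))"
      and Nst: "\<And>s x. s \<in> carrier S \<Longrightarrow> x \<in> N \<Longrightarrow> h s \<odot>\<^bsub>quot_module X W\<^esub> x \<in> N"
      using N(1) by (auto simp: submodule_restrict_scalars)
    have "\<xi> \<in> carrier (quot_module X W)" using subgroup.subset[OF Nsub] \<xi> by auto
    then obtain x where x: "x \<in> carrier X" "\<xi> = W +>\<^bsub>X\<^esub> x" unfolding Q.carrier_quot by auto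
    have gx: "g [^] n \<odot>\<^bsub>X\<^esub> x \<in> carrier X" for n :: nat using gc x by simp
    have orbit: "W +>\<^bsub>X\<^esub> (g [^] n \<odot>\<^bsub>X\<^esub> x) \<in> N" for n :: nat
    proof (induction n)
      case (Suc n)
      obtain s where s: "s \<in> carrier S" "g = h s" using g(1) by auto
      have "g [^] Suc n = g \<otimes> g [^] n" using A.R.nat_pow_Suc2[OF gc] .
      then have "g [^] Suc n \<odot>\<^bsub>X\<^esub> x = g \<odot>\<^bsub>X\<^esub> (g [^] n \<odot>\<^bsub>X\<^esub> x)" using X.smult_assoc gc x by simp
      then show ?case using Nst[OF s(1) Suc] Q.smult_quot[OF gc gx] s by simp
    qed (use x \<xi> in simp)
    have "\<not> inj (\<lambda>n::nat. W +>\<^bsub>X\<^esub> (g [^] n \<odot>\<^bsub>X\<^esub> x))"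
    proof
      assume "inj (\<lambda>n::nat. W +>\<^bsub>X\<^esub> (g [^] n \<odot>\<^bsub>X\<^esub> x))"
      moreover have "finite (range (\<lambda>n::nat. W +>\<^bsub>X\<^esub> (g [^] n \<odot>\<^bsub>X\<^esub> x)))"
        using orbit by (intro finite_subset[OF _ N(2)]) auto
      ultimately show False using finite_imageD infinite_UNIV_nat by blast
    qed
    then obtain i j :: nat where ij: "W +>\<^bsub>X\<^esub> (g [^] i \<odot>\<^bsub>X\<^esub> x) = W +>\<^bsub>X\<^esub> (g [^] j \<odot>\<^bsub>X\<^esub> x)" "i < j"
      unfolding inj_def by (metis nat_neq_iff)
    define d where "d = j - i"
    have d: "d > 0" "j = i + d" using ij by (auto simp: d_def)
    have "g [^] j \<odot>\<^bsub>X\<^esub> x \<ominus>\<^bsub>X\<^esub> g [^] i \<odot>\<^bsub>X\<^esub> x \<in> W"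
      using X.a_rcos_eq_iff[OF W_subgroup gx[of j] gx[of i]] ij by simp
    moreover have "g [^] j \<odot>\<^bsub>X\<^esub> x \<ominus>\<^bsub>X\<^esub> g [^] i \<odot>\<^bsub>X\<^esub> x = g [^] i \<odot>\<^bsub>X\<^esub> ((g [^] d \<ominus> \<one>) \<odot>\<^bsub>X\<^esub> x)"
    proof -
      have "g [^] j \<odot>\<^bsub>X\<^esub> x = g [^] i \<odot>\<^bsub>X\<^esub> (g [^] d \<odot>\<^bsub>X\<^esub> x)"
        using gc x by (simp add: d(2) flip: X.smult_assoc A.R.nat_pow_mult)
      then show ?thesis using gc x
        by (simp add: X.smult_minus_one X.M.minus_eq X.smult_r_distr X.smult_r_minus)
    qed
    ultimately have inW: "g [^] i \<odot>\<^bsub>X\<^esub> ((g [^] d \<ominus> \<one>) \<odot>\<^bsub>X\<^esub> x) \<in> W" by simp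
    define y where "y = (g [^] d \<ominus> \<one>) \<odot>\<^bsub>X\<^esub> x"
    have yc: "y \<in> carrier X" using gc x by (simp add: y_def)
    \<comment> \<open>The unit g can be cancelled, because its inverse g' maps the submodule W into
      itself.\<close>
    have "g [^] n \<odot>\<^bsub>X\<^esub> y \<in> W \<Longrightarrow> y \<in> W" for n :: nat
    proof (induction n)
      case (Suc n)
      have "g' \<odot>\<^bsub>X\<^esub> (g [^] Suc n \<odot>\<^bsub>X\<^esub> y) = (g' \<otimes> (g \<otimes> g [^] n)) \<odot>\<^bsub>X\<^esub> y"
        using X.smult_assoc A.R.nat_pow_Suc2[OF gc] gc g(2) yc by simp
      also have "g' \<otimes> (g \<otimes> g [^] n) = g [^] n"
        using gc g(2,3) by (simp flip: A.R.m_assoc)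
      finally have "g [^] n \<odot>\<^bsub>X\<^esub> y = g' \<odot>\<^bsub>X\<^esub> (g [^] Suc n \<odot>\<^bsub>X\<^esub> y)" ..
      then show ?case using Suc submodule.smult_closed[OF W_submodule g(2)] by metis
    qed (use yc in simp)
    then have "y \<in> W" using inW unfolding y_def by blast
    then obtain z where z: "z \<in> carrier X" "y = \<omega> \<odot>\<^bsub>X\<^esub> z" by (auto simp: W_def)
    have "(g [^] d \<ominus> \<one>) \<odot>\<^bsub>E\<^esub> \<phi> x = \<phi> y"
      unfolding y_def by (rule lin_mapsD(3)[OF \<phi>, symmetric]) (use gc x in auto)
    also have "\<dots> = \<omega> \<odot>\<^bsub>E\<^esub> \<phi> z" unfolding z(2) by (rule lin_mapsD(3)[OF \<phi> \<omega> z(1)])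
    finally have "\<phi> x \<in> (\<lambda>e. \<omega> \<odot>\<^bsub>E\<^esub> e) ` carrier E"
      using fixed[OF d(1), of "\<phi> x"] x z lin_mapsD(1)[OF \<phi>] by auto
    then show "\<xi> \<in> (\<lambda>x. W +>\<^bsub>X\<^esub> x) ` F" using x by (auto simp: F_def)
  qed
  then show ?thesis unfolding max_finite_submodule_def using sub fin by blast
qed

end

section \<open>Free actions of finite cyclic groups\<close>

text \<open>The intended case is a set \<Omega> of cosets in G/U, with \<sigma> the left translation
  by g and r the order of g in G/U.\<close>

locale free_cyclic =
  fixes \<Omega> :: "'x set" and \<sigma> :: "'x \<Rightarrow> 'x" and r :: nat
  assumes fin: "finite \<Omega>" and stable: "x \<in> \<Omega> \<Longrightarrow> \<sigma> x \<in> \<Omega>" and r: "r > 0"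
    and period: "x \<in> \<Omega> \<Longrightarrow> (\<sigma> ^^ r) x = x"
    and free: "x \<in> \<Omega> \<Longrightarrow> 0 < i \<Longrightarrow> i < r \<Longrightarrow> (\<sigma> ^^ i) x \<noteq> x"
begin

definition orb where "orb x = (\<lambda>i. (\<sigma> ^^ i) x) ` {..<r}"

lemma pow_stable: "x \<in> \<Omega> \<Longrightarrow> (\<sigma> ^^ i) x \<in> \<Omega>"
  by (induction i) (auto simp: stable)

lemma inj_orb: "x \<in> \<Omega> \<Longrightarrow> inj_on (\<lambda>i. (\<sigma> ^^ i) x) {..<r}"
proof (rule linorder_inj_onI')
  fix i j assume x: "x \<in> \<Omega>" and ij: "i \<in> {..<r}" "j \<in> {..<r}" "i < j"
  show "(\<sigma> ^^ i) x \<noteq> (\<sigma> ^^ j) x"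
  proof
    assume eq: "(\<sigma> ^^ i) x = (\<sigma> ^^ j) x"
    \<comment> \<open>Applying \<sigma>^(r - j) to both sides produces the forbidden period r - j +
      i, which lies strictly between 0 and r.\<close>
    define k where "k = r - j"
    have k: "k + j = r" "0 < k + i" "k + i < r" using ij by (auto simp: k_def)
    have "(\<sigma> ^^ (k + i)) x = (\<sigma> ^^ (k + j)) x" by (simp only: funpow_add o_apply eq)
    then have "(\<sigma> ^^ (k + i)) x = x" unfolding k(1) period[OF x] .
    then show False using free[OF x k(2,3)] by simp
  qed
qed

lemma orb_subset: "x \<in> \<Omega> \<Longrightarrow> orb x \<subseteq> \<Omega>"
  by (auto simp: orb_def pow_stable)

lemma orb_self: "x \<in> orb x"
  using r by (auto simp: orb_def intro: rev_image_eqI[of 0])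

text \<open>\<sigma> is invertible on \<Omega> with inverse \<sigma>^(r-1). Therefore the complement
  of an orbit is again stable, which permits induction by removing orbits.\<close>

lemma \<sigma>_orb:
  assumes "x \<in> \<Omega>" "y \<in> \<Omega>"
  shows "\<sigma> y \<in> orb x \<longleftrightarrow> y \<in> orb x"
proof
  assume "\<sigma> y \<in> orb x"
  then obtain i where i: "i < r" "\<sigma> y = (\<sigma> ^^ i) x" by (auto simp: orb_def)
  have r': "Suc (r - 1) = r" using r by simp
  have "(\<sigma> ^^ (r - 1)) (\<sigma> y) = (\<sigma> ^^ Suc (r - 1)) y" by (simp only: funpow_Suc_right o_apply)
  then have "y = (\<sigma> ^^ (r - 1)) (\<sigma> y)" unfolding r' period[OF assms(2)] by (rule sym)
  also have "\<dots> = (\<sigma> ^^ (r - 1 + i)) x" by (simp only: i funpow_add o_apply)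
  also have "\<dots> = (if i = 0 then (\<sigma> ^^ (r - 1)) x else (\<sigma> ^^ (i - 1)) x)"
  proof (cases i)
    case (Suc j)
    then have "r - 1 + i = j + r" using r by simp
    then have "(\<sigma> ^^ (r - 1 + i)) x = (\<sigma> ^^ r) ((\<sigma> ^^ j) x)" by (simp only: add.commute[of j r] funpow_add o_apply)
    then show ?thesis using Suc period[OF pow_stable[OF assms(1)]] by simp
  qed simp
  finally show "y \<in> orb x" using i r by (auto simp: orb_def split: if_splits)
next
  assume "y \<in> orb x"
  then obtain i where i: "i < r" "y = (\<sigma> ^^ i) x" by (auto simp: orb_def)
  then have e: "\<sigma> y = (\<sigma> ^^ Suc i) x" by simp
  show "\<sigma> y \<in> orb x"
  proof (cases "Suc i < r")
    case False
    then have "Suc i = r" using i by simp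
    then have "\<sigma> y = x" using e by (simp only: period[OF assms(1)])
    then show ?thesis using orb_self by simp
  qed (use e in \<open>auto simp: orb_def simp del: funpow.simps\<close>)
qed

lemma remove_orb: "x \<in> \<Omega> \<Longrightarrow> free_cyclic (\<Omega> - orb x) \<sigma> r"
  using fin stable r period free \<sigma>_orb by unfold_locales auto

lemma sum_orb: "x \<in> \<Omega> \<Longrightarrow> sum f (orb x) = (\<Sum>i<r. f ((\<sigma> ^^ i) x))"
  unfolding orb_def by (simp add: sum.reindex[OF inj_orb])

lemma card_remove_orb: "x \<in> \<Omega> \<Longrightarrow> card (\<Omega> - orb x) < card \<Omega>"
  using fin orb_self by (intro psubset_card_mono) auto

lemma sum_split_orb: "x \<in> \<Omega> \<Longrightarrow> sum f \<Omega> = sum f (\<Omega> - orb x) + sum f (orb x)"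
  by (rule sum.subset_diff[OF orb_subset fin])

end

text \<open>f is constant on orbits, and every orbit has exactly r elements.\<close>

lemma free_cyclic_dvd_sum:
  fixes f :: "'x \<Rightarrow> int"
  assumes "free_cyclic \<Omega> \<sigma> r" "\<And>x. x \<in> \<Omega> \<Longrightarrow> f (\<sigma> x) = f x"
  shows "int r dvd sum f \<Omega>"
  using assms
proof (induction "card \<Omega>" arbitrary: \<Omega> rule: less_induct)
  case less
  interpret free_cyclic \<Omega> \<sigma> r by (rule less.prems(1))
  show ?case
  proof (cases "\<Omega> = {}")
    case False
    then obtain x where x: "x \<in> \<Omega>" by blast
    have "int r dvd sum f (\<Omega> - orb x)"
      by (rule less.hyps[OF card_remove_orb[OF x] remove_orb[OF x]]) (use less.prems(2) in auto)
    moreover have "f ((\<sigma> ^^ i) x) = f x" for i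
      by (induction i) (use less.prems(2) pow_stable[OF x] in auto)
    then have "sum f (orb x) = int r * f x" by (simp add: sum_orb[OF x])
    ultimately show ?thesis by (simp add: sum_split_orb[OF x])
  qed simp
qed

text \<open>The cokernel of \<open>\<sigma> - 1\<close> on functions is given by the sums over the orbits.\<close>

lemma free_cyclic_solve:
  fixes a :: "'x \<Rightarrow> int"
  assumes "free_cyclic \<Omega> \<sigma> r" "\<And>x. x \<in> \<Omega> \<Longrightarrow> \<exists>z. (\<Sum>i<r. a ((\<sigma> ^^ i) x)) mod M = (e * z) mod M"
  shows "\<exists>b c. \<forall>x\<in>\<Omega>. a (\<sigma> x) mod M = (b x - b (\<sigma> x) + e * c (\<sigma> x)) mod M"
  using assms
proof (induction "card \<Omega>" arbitrary: \<Omega> rule: less_induct)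
  case less
  interpret free_cyclic \<Omega> \<sigma> r by (rule less.prems(1))
  show ?case
  proof (cases "\<Omega> = {}")
    case False
    then obtain x where x: "x \<in> \<Omega>" by blast
    have "\<exists>b c. \<forall>y\<in>\<Omega> - orb x. a (\<sigma> y) mod M = (b y - b (\<sigma> y) + e * c (\<sigma> y)) mod M"
      by (rule less.hyps[OF card_remove_orb[OF x] remove_orb[OF x]]) (rule less.prems(2), simp)
    then obtain b c where bc: "\<And>y. y \<in> \<Omega> - orb x \<Longrightarrow> a (\<sigma> y) mod M = (b y - b (\<sigma> y) + e * c (\<sigma> y)) mod M"
      by blast
    obtain z where z: "(\<Sum>i<r. a ((\<sigma> ^^ i) x)) mod M = (e * z) mod M" using less.prems(2)[OF x] by blast
    define ix where "ix = inv_into {..<r} (\<lambda>i. (\<sigma> ^^ i) x)"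
    have ix: "ix ((\<sigma> ^^ i) x) = i" if "i < r" for i
      unfolding ix_def using inv_into_f_f[OF inj_orb[OF x]] that by simp
    \<comment> \<open>On the orbit of x, b is minus the partial sum of a, begun at j = 1, so that
      differences telescope to a. Where the orbit closes up at x, the total orbit sum is left over;
      it is e z modulo M and is absorbed by placing z in c at x alone.\<close>
    define b' where "b' y = (if y \<in> orb x then - (\<Sum>j=1..ix y. a ((\<sigma> ^^ j) x)) else b y)" for y
    define c' where "c' y = (if y \<in> orb x then (if y = x then z else 0) else c y)" for y
    have b': "b' ((\<sigma> ^^ i) x) = - (\<Sum>j=1..i. a ((\<sigma> ^^ j) x))" if "i < r" for i
      using that ix by (auto simp: b'_def orb_def)
    have c': "c' ((\<sigma> ^^ i) x) = (if i = 0 then z else 0)" if "i < r" for i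
      using that free[OF x, of i] by (auto simp: c'_def orb_def)
    have "a (\<sigma> y) mod M = (b' y - b' (\<sigma> y) + e * c' (\<sigma> y)) mod M" if y: "y \<in> \<Omega>" for y
    proof (cases "y \<in> orb x")
      case False
      then have "\<sigma> y \<notin> orb x" using \<sigma>_orb[OF x y] by simp
      then show ?thesis using bc[of y] y False by (simp add: b'_def c'_def)
    next
      case True
      then obtain i where i: "i < r" "y = (\<sigma> ^^ i) x" by (auto simp: orb_def)
      show ?thesis
      proof (cases "Suc i < r")
        case True
        have "\<sigma> y = (\<sigma> ^^ Suc i) x" using i by simp
        then show ?thesis using b'[OF i(1)] b'[OF True] c'[OF True] i(2)
          by (simp del: funpow.simps)
      next
        case False
        then have r': "r = Suc i" using i by simp
        then have \<sigma>y: "\<sigma> y = (\<sigma> ^^ 0) x" using i period[OF x] by simp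
        have "(\<Sum>j<r. a ((\<sigma> ^^ j) x)) = a x + (\<Sum>j=1..i. a ((\<sigma> ^^ j) x))"
          unfolding r' sum.lessThan_Suc_shift by (simp add: sum.atLeast1_atMost_eq del: funpow.simps)
        then have ax: "a x = (\<Sum>j<r. a ((\<sigma> ^^ j) x)) - (\<Sum>j=1..i. a ((\<sigma> ^^ j) x))" by linarith
        have "a x mod M = (e * z - (\<Sum>j=1..i. a ((\<sigma> ^^ j) x))) mod M"
          unfolding ax by (rule mod_diff_cong[OF z refl])
        then show ?thesis using b'[OF i(1)] b'[OF r] c'[OF r] unfolding i(2)[symmetric] \<sigma>y
          by (simp add: algebra_simps)
      qed
    qed
    then show ?thesis by blast
  qed simp
qed

section \<open>The ring of \<open>p\<close>-adic integers\<close>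

lemma Zp_carrier: "x \<in> carrier (Zp p) \<longleftrightarrow> (\<forall>n. 0 \<le> x n \<and> x n < int p ^ n \<and> x (Suc n) mod int p ^ n = x n)"
  by (auto simp: Zp_def)

lemma Zp_sel: "\<zero>\<^bsub>Zp p\<^esub> = (\<lambda>n. 0)" "\<one>\<^bsub>Zp p\<^esub> = (\<lambda>n. 1 mod int p ^ n)"
  "x \<oplus>\<^bsub>Zp p\<^esub> y = (\<lambda>n. (x n + y n) mod int p ^ n)" "x \<otimes>\<^bsub>Zp p\<^esub> y = (\<lambda>n. (x n * y n) mod int p ^ n)"
  by (simp_all add: Zp_def)

lemma Zp_mod: "x \<in> carrier (Zp p) \<Longrightarrow> x n mod int p ^ n = x n"
  by (simp add: Zp_carrier)

lemma Zp_mod_le: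
  assumes "x \<in> carrier (Zp p)" "m \<le> n" shows "x n mod int p ^ m = x m"
  using assms(2)
proof (induction n rule: dec_induct)
  case (step n)
  have "x (Suc n) mod int p ^ m = (x (Suc n) mod int p ^ n) mod int p ^ m"
    using step by (simp add: mod_mod_cancel le_imp_power_dvd)
  then show ?case using step assms(1) by (simp add: Zp_carrier)
qed (use assms Zp_mod in auto)

lemma Zp_of_int: "p > 0 \<Longrightarrow> (\<lambda>n. z mod int p ^ n) \<in> carrier (Zp p)"
  by (simp add: Zp_carrier mod_mod_cancel)

lemma Zp_reduce:
  assumes "p > 0" "\<And>n. f (Suc n) mod int p ^ n = f n mod int p ^ n"
  shows "(\<lambda>n. f n mod int p ^ n) \<in> carrier (Zp p)"
  using assms by (simp add: Zp_carrier mod_mod_cancel)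

lemma Zp_abelian_monoid: "p > 0 \<Longrightarrow> abelian_monoid (Zp p)"
proof (rule abelian_monoidI)
  assume p: "p > 0"
  show "x \<oplus>\<^bsub>Zp p\<^esub> y \<in> carrier (Zp p)" if "x \<in> carrier (Zp p)" "y \<in> carrier (Zp p)" for x y
    unfolding Zp_sel
  proof (rule Zp_reduce[OF p])
    fix n
    have "(x (Suc n) + y (Suc n)) mod int p ^ n = (x (Suc n) mod int p ^ n + y (Suc n) mod int p ^ n) mod int p ^ n"
      by (simp add: mod_add_eq)
    then show "(x (Suc n) + y (Suc n)) mod int p ^ n = (x n + y n) mod int p ^ n"
      using that by (simp add: Zp_carrier)
  qed
  show "\<zero>\<^bsub>Zp p\<^esub> \<in> carrier (Zp p)" using p by (simp add: Zp_carrier Zp_sel)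
  show "x \<oplus>\<^bsub>Zp p\<^esub> y \<oplus>\<^bsub>Zp p\<^esub> z = x \<oplus>\<^bsub>Zp p\<^esub> (y \<oplus>\<^bsub>Zp p\<^esub> z)" for x y z
    by (simp add: Zp_sel mod_simps add.assoc)
  show "x \<oplus>\<^bsub>Zp p\<^esub> y = y \<oplus>\<^bsub>Zp p\<^esub> x" for x y
    by (simp add: Zp_sel add.commute)
qed (simp add: Zp_sel Zp_mod)

lemma Zp_mult_closed:
  assumes "p > 0" "x \<in> carrier (Zp p)" "y \<in> carrier (Zp p)"
  shows "x \<otimes>\<^bsub>Zp p\<^esub> y \<in> carrier (Zp p)"
  unfolding Zp_sel
proof (rule Zp_reduce[OF assms(1)])
  fix n
  have "(x (Suc n) * y (Suc n)) mod int p ^ n = ((x (Suc n) mod int p ^ n) * (y (Suc n) mod int p ^ n)) mod int p ^ n"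
    by (simp add: mod_mult_eq)
  then show "(x (Suc n) * y (Suc n)) mod int p ^ n = (x n * y n) mod int p ^ n"
    using assms by (simp add: Zp_carrier)
qed

lemma Zp_finsum:
  assumes "p > 0" "finite A" "\<And>x. x \<in> A \<Longrightarrow> f x \<in> carrier (Zp p)"
  shows "finsum (Zp p) f A n = (\<Sum>x\<in>A. f x n) mod int p ^ n"
proof -
  interpret abelian_monoid "Zp p" by (rule Zp_abelian_monoid[OF assms(1)])
  show ?thesis
    using assms(2,3)
  proof (induction A)
    case empty
    then show ?case by (simp add: Zp_sel)
  next
    case (insert x A)
    then show ?case by (subst finsum_insert) (auto simp: Zp_sel mod_simps)
  qed
qed

lemma Zp_finsum_closed:
  assumes "p > 0" "\<And>x. x \<in> A \<Longrightarrow> f x \<in> carrier (Zp p)"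
  shows "finsum (Zp p) f A \<in> carrier (Zp p)"
proof -
  interpret abelian_monoid "Zp p" by (rule Zp_abelian_monoid[OF assms(1)])
  show ?thesis using assms(2) by (intro finsum_closed) auto
qed

section \<open>Compact groups\<close>

locale compact_group = group G for G :: "('g, 'c) monoid_scheme" (structure) +
  fixes T :: "'g topology"
  assumes topspace: "topspace T = carrier G"
    and cont_mult: "continuous_map (prod_topology T T) T (\<lambda>(x, y). x \<otimes> y)"
    and cont_inv: "continuous_map T T (\<lambda>x. inv x)"
    and compact: "compact_space T"
begin

lemma continuous_mult:
  assumes "continuous_map Z T f" "continuous_map Z T g"
  shows "continuous_map Z T (\<lambda>z. f z \<otimes> g z)"
  using continuous_map_compose[OF continuous_map_pairedI[OF assms] cont_mult] by (simp add: o_def)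

lemma continuous_inv: "continuous_map Z T f \<Longrightarrow> continuous_map Z T (\<lambda>z. inv (f z))"
  using continuous_map_compose[OF _ cont_inv] by (simp add: o_def)

lemma continuous_const: "g \<in> carrier G \<Longrightarrow> continuous_map Z T (\<lambda>z. g)"
  by (simp add: topspace)

text \<open>By the tube lemma a condition imposed for all x in a compact set is open in g. It yields
  the openness of the stabilizer of a clopen set and of the intersection of all conjugates of an
  open subgroup.\<close>

lemma openin_forall_compact:
  assumes "continuous_map (prod_topology T T) T f" "openin T O'" "compactin T C"
  shows "openin T {g \<in> carrier G. \<forall>x\<in>C. f (g, x) \<in> O'}"
proof (subst openin_subopen, intro ballI)
  fix g assume g: "g \<in> {g \<in> carrier G. \<forall>x\<in>C. f (g, x) \<in> O'}"
  let ?W = "{z \<in> topspace (prod_topology T T). f z \<in> O'}"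
  have CT: "C \<subseteq> carrier G" using compactin_subset_topspace[OF assms(3)] topspace by simp
  have "openin (prod_topology T T) ?W" by (rule openin_continuous_map_preimage[OF assms(1,2)])
  moreover have "{g} \<times> C \<subseteq> ?W" using g CT topspace by auto
  ultimately obtain U V where UV: "openin T U" "g \<in> U" "C \<subseteq> V" "U \<times> V \<subseteq> ?W"
    using tube_lemma_right[of T T ?W C g] assms(3) g topspace by auto
  have "U \<subseteq> {g \<in> carrier G. \<forall>x\<in>C. f (g, x) \<in> O'}"
    using UV openin_subset[OF UV(1)] topspace by auto
  then show "\<exists>U. openin T U \<and> g \<in> U \<and> U \<subseteq> {g \<in> carrier G. \<forall>x\<in>C. f (g, x) \<in> O'}" using UV by blast
qed

lemma openin_rcos:
  assumes "openin T U" "g \<in> carrier G"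
  shows "openin T (U #> g)"
proof -
  have U: "U \<subseteq> carrier G" using openin_subset[OF assms(1)] topspace by simp
  have "U #> g = {x \<in> topspace T. x \<otimes> inv g \<in> U}"
  proof
    show "U #> g \<subseteq> {x \<in> topspace T. x \<otimes> inv g \<in> U}"
      using U assms(2) topspace by (auto simp: r_coset_def m_assoc subsetD)
    show "{x \<in> topspace T. x \<otimes> inv g \<in> U} \<subseteq> U #> g"
    proof
      fix x assume "x \<in> {x \<in> topspace T. x \<otimes> inv g \<in> U}"
      moreover from this have "x = (x \<otimes> inv g) \<otimes> g" using assms(2) topspace by (simp add: m_assoc)
      ultimately show "x \<in> U #> g" unfolding r_coset_def by blast
    qed
  qed
  moreover have "openin T {x \<in> topspace T. x \<otimes> inv g \<in> U}"
    by (rule openin_continuous_map_preimage[OF _ assms(1)])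
       (intro continuous_mult continuous_const continuous_map_id[unfolded id_def] inv_closed assms)
  ultimately show ?thesis by simp
qed

lemma openin_union_rcos:
  assumes "subgroup U G" "openin T U" "S \<subseteq> carrier G" "\<And>s. s \<in> S \<Longrightarrow> U #> s \<subseteq> S"
  shows "openin T S"
proof (subst openin_subopen, intro ballI)
  fix s assume s: "s \<in> S"
  then have "s \<in> carrier G" using assms(3) by blast
  then show "\<exists>V. openin T V \<and> s \<in> V \<and> V \<subseteq> S"
    using openin_rcos[OF assms(2)] assms(4)[OF s] rcos_self[OF _ assms(1)] by blast
qed

lemma finite_rcosets_open:
  assumes "subgroup U G" "openin T U"
  shows "finite (rcosets U)"
proof -
  have "\<forall>C\<in>rcosets U. openin T C" using openin_rcos[OF assms(2)] by (auto simp: RCOSETS_def)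
  moreover have "topspace T \<subseteq> \<Union>(rcosets U)" using rcosets_part_G[OF assms(1)] topspace by simp
  ultimately obtain F where F: "finite F" "F \<subseteq> rcosets U" "topspace T \<subseteq> \<Union>F"
    using spec[OF iffD1[OF compact_space_alt compact], of "rcosets U"] by auto
  have "C \<in> F" if C: "C \<in> rcosets U" for C
  proof -
    obtain x where x: "x \<in> carrier G" "C = U #> x" using C by (auto simp: RCOSETS_def)
    then have "x \<in> C" using rcos_self[OF _ assms(1)] by simp
    have "x \<in> \<Union>F" using F(3) x(1) topspace by auto
    then obtain D where D: "D \<in> F" "x \<in> D" by (rule UnionE)
    have "D \<in> rcosets U" using F(2) D(1) by (rule subsetD)
    then obtain y where y: "y \<in> carrier G" "D = U #> y" by (auto simp: RCOSETS_def)
    have "D = C" unfolding x(2) y(2)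
      by (rule repr_independence) (use D(2) y assms(1) in auto)
    then show ?thesis using D(1) by blast
  qed
  then show ?thesis using F(1) by (meson finite_subset subsetI)
qed

text \<open>The complement of U is a finite union of cosets, each closed as a preimage of U under a
  translation.\<close>

lemma closedin_finite_index_imp_openin:
  assumes "subgroup U G" "closedin T U" "finite (rcosets U)"
  shows "openin T U"
proof -
  have cl: "closedin T (U #> g)" if "g \<in> carrier G" for g
  proof -
    have U: "U \<subseteq> carrier G" using subgroup.subset[OF assms(1)] .
    have "U #> g = {x \<in> topspace T. x \<otimes> inv g \<in> U}"
    proof
      show "U #> g \<subseteq> {x \<in> topspace T. x \<otimes> inv g \<in> U}"
        using U that topspace by (auto simp: r_coset_def m_assoc subsetD)
      show "{x \<in> topspace T. x \<otimes> inv g \<in> U} \<subseteq> U #> g"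
      proof
        fix x assume "x \<in> {x \<in> topspace T. x \<otimes> inv g \<in> U}"
        moreover from this have "x = (x \<otimes> inv g) \<otimes> g" using that topspace by (simp add: m_assoc)
        ultimately show "x \<in> U #> g" unfolding r_coset_def by blast
      qed
    qed
    moreover have "closedin T {x \<in> topspace T. x \<otimes> inv g \<in> U}"
      by (rule closedin_continuous_map_preimage[OF _ assms(2)])
         (intro continuous_mult continuous_const continuous_map_id[unfolded id_def] inv_closed that)
    ultimately show ?thesis by simp
  qed
  have "closedin T (\<Union>(rcosets U - {U}))"
    using cl assms(3) by (intro closedin_Union) (auto simp: RCOSETS_def)
  moreover have "U = topspace T - \<Union>(rcosets U - {U})"
  proof
    have "U \<in> rcosets U" using coset_join2[OF one_closed assms(1)] subgroup.one_closed[OF assms(1)]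
      unfolding RCOSETS_def by blast
    then have "disjnt U C" if "C \<in> rcosets U - {U}" for C
      using rcos_disjoint[OF assms(1)] that by (auto simp: pairwise_def)
    then show "U \<subseteq> topspace T - \<Union>(rcosets U - {U})"
      using subgroup.subset[OF assms(1)] topspace by (auto simp: disjnt_iff)
    show "topspace T - \<Union>(rcosets U - {U}) \<subseteq> U"
      using rcosets_part_G[OF assms(1)] topspace by auto
  qed
  ultimately show ?thesis using openin_diff[OF openin_topspace] by metis
qed

abbreviation \<N> where "\<N> \<equiv> open_normal G T"

lemma \<N>D: "U \<in> \<N> \<Longrightarrow> U \<lhd> G" "U \<in> \<N> \<Longrightarrow> openin T U" "U \<in> \<N> \<Longrightarrow> subgroup U G"
  by (auto simp: open_normal_def normal_imp_subgroup)

lemma finite_rcosets: "U \<in> \<N> \<Longrightarrow> finite (rcosets U)"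
  using finite_rcosets_open \<N>D by blast

lemma \<N>_inter: "U \<in> \<N> \<Longrightarrow> V \<in> \<N> \<Longrightarrow> U \<inter> V \<in> \<N>"
  by (auto simp: open_normal_def normal_inv_iff subgroups_Inter_pair openin_Int)

lemma \<N>_carrier: "carrier G \<in> \<N>"
  using openin_topspace[of T] topspace by (auto simp: open_normal_def normal_inv_iff subgroup_self)

lemma \<N>_Inter: "finite F \<Longrightarrow> F \<subseteq> \<N> \<Longrightarrow> \<exists>U\<in>\<N>. \<forall>V\<in>F. U \<subseteq> V"
proof (induction F rule: finite_induct)
  case empty
  then show ?case using \<N>_carrier by blast
next
  case (insert V F)
  then obtain U where "U \<in> \<N>" "\<forall>V\<in>F. U \<subseteq> V" by auto
  then show ?case using insert.prems \<N>_inter[of V U] by (intro bexI[of _ "V \<inter> U"]) auto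
qed

lemma set_mult_mem: "x \<in> A <#> B \<longleftrightarrow> (\<exists>a\<in>A. \<exists>b\<in>B. x = a \<otimes> b)"
  by (auto simp: set_mult_def)

lemma normal_conj: "K \<lhd> G \<Longrightarrow> x \<in> carrier G \<Longrightarrow> k \<in> K \<Longrightarrow> x \<otimes> k \<otimes> inv x \<in> K"
  by (simp add: normal_inv_iff)

lemma set_mult_subset:
  assumes "subgroup K G" "subgroup U G"
  shows "K \<subseteq> K <#> U" "U \<subseteq> K <#> U"
proof
  fix x assume x: "x \<in> K"
  then have "x = x \<otimes> \<one>" using subgroup.mem_carrier[OF assms(1)] by simp
  then show "x \<in> K <#> U" unfolding set_mult_mem using x subgroup.one_closed[OF assms(2)] by blast
next
  show "U \<subseteq> K <#> U"
  proof
    fix x assume x: "x \<in> U"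
    then have "x = \<one> \<otimes> x" using subgroup.mem_carrier[OF assms(2)] by simp
    then show "x \<in> K <#> U" unfolding set_mult_mem using x subgroup.one_closed[OF assms(1)] by blast
  qed
qed

lemma normal_set_mult:
  assumes K: "K \<lhd> G" and U: "U \<lhd> G"
  shows "K <#> U \<lhd> G"
  unfolding normal_inv_iff
proof (intro conjI ballI)
  have Ks: "subgroup K G" and Us: "subgroup U G" using K U normal_imp_subgroup by blast+
  show "subgroup (K <#> U) G"
    by (rule mult_norm_subgroup[OF K Us])
  fix x y assume x: "x \<in> carrier G" and "y \<in> K <#> U"
  then obtain k u where ku: "k \<in> K" "u \<in> U" "y = k \<otimes> u" by (auto simp: set_mult_mem)
  then have c: "k \<in> carrier G" "u \<in> carrier G"
    using subgroup.mem_carrier[OF Ks] subgroup.mem_carrier[OF Us] by auto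
  then have "x \<otimes> y \<otimes> inv x = (x \<otimes> k \<otimes> inv x) \<otimes> (x \<otimes> u \<otimes> inv x)"
    using x ku by (simp add: m_assoc) (simp flip: m_assoc)
  then show "x \<otimes> y \<otimes> inv x \<in> K <#> U"
    unfolding set_mult_mem using normal_conj[OF K x ku(1)] normal_conj[OF U x ku(2)] by blast
qed

lemma \<N>_set_mult:
  assumes "K \<lhd> G" "U \<in> \<N>"
  shows "K <#> U \<in> \<N>"
proof -
  have n: "K <#> U \<lhd> G" using normal_set_mult assms \<N>D by blast
  have Us: "subgroup U G" and KU: "subgroup (K <#> U) G" using assms n \<N>D normal_imp_subgroup by blast+
  have UKU: "U \<subseteq> K <#> U" using set_mult_subset(2)[OF normal_imp_subgroup[OF assms(1)] Us] .
  have "openin T (K <#> U)"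
  proof (rule openin_union_rcos[OF Us \<N>D(2)[OF assms(2)] subgroup.subset[OF KU]])
    fix s assume "s \<in> K <#> U"
    then show "U #> s \<subseteq> K <#> U" using UKU subgroup.m_closed[OF KU] by (auto simp: r_coset_def)
  qed
  then show ?thesis using n by (simp add: open_normal_def)
qed

lemma closed_subgroup_compact_group:
  assumes "subgroup K G" "closedin T K"
  shows "compact_group (G\<lparr>carrier := K\<rparr>) (subtopology T K)"
proof (intro compact_group.intro compact_group_axioms.intro)
  have Kc: "K \<subseteq> carrier G" using subgroup.subset[OF assms(1)] .
  show "group (G\<lparr>carrier := K\<rparr>)" using subgroup.subgroup_is_group[OF assms(1) is_group] .
  show "topspace (subtopology T K) = carrier (G\<lparr>carrier := K\<rparr>)"
    using Kc topspace by auto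
  show "compact_space (subtopology T K)"
    using closedin_compact_space[OF compact assms(2)] by (simp add: compact_space_subtopology)
  have "continuous_map (subtopology (prod_topology T T) (K \<times> K)) T (\<lambda>(x, y). x \<otimes> y)"
    by (rule continuous_map_from_subtopology[OF cont_mult])
  then show "continuous_map (prod_topology (subtopology T K) (subtopology T K)) (subtopology T K)
     (\<lambda>(x, y). x \<otimes>\<^bsub>G\<lparr>carrier := K\<rparr>\<^esub> y)"
    unfolding continuous_map_in_subtopology subtopology_Times[symmetric]
    using subgroup.m_closed[OF assms(1)] by auto
  have "continuous_map (subtopology T K) T (\<lambda>x. inv x)"
    by (rule continuous_map_from_subtopology[OF cont_inv])
  then have "continuous_map (subtopology T K) (subtopology T K) (\<lambda>x. inv x)"
    using subgroup.m_inv_closed[OF assms(1)] by (auto simp: continuous_map_in_subtopology)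
  then show "continuous_map (subtopology T K) (subtopology T K) (\<lambda>x. inv\<^bsub>G\<lparr>carrier := K\<rparr>\<^esub> x)"
    by (rule continuous_map_eq) (use m_inv_consistent[OF assms(1)] in auto)
qed

lemma open_normal_restrict:
  assumes "subgroup K G" "U \<in> \<N>"
  shows "U \<inter> K \<in> open_normal (G\<lparr>carrier := K\<rparr>) (subtopology T K)"
proof -
  have "U \<inter> K \<lhd> G\<lparr>carrier := K\<rparr>"
    by (rule normal_Int_subgroup[OF assms(1) \<N>D(1)[OF assms(2)]])
  then show ?thesis using \<N>D(2)[OF assms(2)]
    by (auto simp: open_normal_def openin_subtopology)
qed

lemma rcos_subset_iff:
  assumes "subgroup U G" "subgroup V G" "U \<subseteq> V" "x \<in> carrier G" "y \<in> carrier G"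
  shows "U #> x \<subseteq> V #> y \<longleftrightarrow> x \<in> V #> y"
proof
  assume "U #> x \<subseteq> V #> y"
  then show "x \<in> V #> y" using rcos_self[OF assms(4,1)] by blast
next
  assume "x \<in> V #> y"
  then have "V #> y = V #> x" using repr_independence[OF _ assms(5,2)] by simp
  then show "U #> x \<subseteq> V #> y" using assms(3) by (auto simp: r_coset_def)
qed

end

section \<open>Open normal subgroups separate the points of a profinite group\<close>

lemma profinite_compact_group: "profinite_group G T \<Longrightarrow> compact_group G T"
  by (simp add: profinite_group_def compact_group_def compact_group_axioms_def)

text \<open>In a compact Hausdorff space components are quasi-components, so total disconnectedness
  gives a clopen set C containing 1 but not g. The elements u for which u and its inverse both map C
  into itself by right multiplication form an open subgroup Q, and the intersection U of its
  conjugates is open because G is compact. If g were in U, then C would contain 1 g.\<close>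

lemma profinite_separated:
  assumes "profinite_group G T" "g \<in> carrier G" "g \<noteq> \<one>\<^bsub>G\<^esub>"
  shows "\<exists>U\<in>open_normal G T. g \<notin> U"
proof -
  interpret compact_group G T by (rule profinite_compact_group[OF assms(1)])
  have haus: "Hausdorff_space T" and tdc: "\<And>S. connectedin T S \<Longrightarrow> \<exists>a. S \<subseteq> {a}"
    using assms(1) by (auto simp: profinite_group_def)
  have "\<not> connected_component_of T \<one>\<^bsub>G\<^esub> g"
  proof
    assume "connected_component_of T \<one>\<^bsub>G\<^esub> g"
    then obtain S where "connectedin T S" "\<one>\<^bsub>G\<^esub> \<in> S" "g \<in> S" by (auto simp: connected_component_of_def)
    then show False using tdc[of S] assms(3) by auto
  qed
  then have "\<not> quasi_component_of T \<one>\<^bsub>G\<^esub> g"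
    using quasi_eq_connected_component_of[of T "\<one>\<^bsub>G\<^esub>"] compact haus by simp
  then obtain C where C: "closedin T C" "openin T C" "\<one>\<^bsub>G\<^esub> \<in> C" "g \<notin> C"
    using assms(2) topspace unfolding quasi_component_of by auto
  have Cc: "compactin T C" by (rule closedin_compact_space[OF compact C(1)])
  have CG: "C \<subseteq> carrier G" using openin_subset[OF C(2)] topspace by simp
  define P where "P = {u \<in> carrier G. \<forall>x\<in>C. x \<otimes>\<^bsub>G\<^esub> u \<in> C}"
  have P: "openin T P"
  proof -
    have "continuous_map (prod_topology T T) T (\<lambda>z. snd z \<otimes>\<^bsub>G\<^esub> fst z)"
      by (intro continuous_mult continuous_map_snd continuous_map_fst)
    from openin_forall_compact[OF this C(2) Cc] show ?thesis by (simp add: P_def)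
  qed
  define Q where "Q = {u \<in> carrier G. u \<in> P \<and> inv\<^bsub>G\<^esub> u \<in> P}"
  have "Q = P \<inter> {u \<in> topspace T. inv\<^bsub>G\<^esub> u \<in> P}" using topspace by (auto simp: Q_def)
  then have Qo: "openin T Q" using P openin_continuous_map_preimage[OF cont_inv P] by auto
  have Qs: "subgroup Q G"
  proof (rule subgroupI)
    show "Q \<noteq> {}" using CG by (auto simp: Q_def P_def intro!: exI[of _ "\<one>\<^bsub>G\<^esub>"])
    show "u \<otimes>\<^bsub>G\<^esub> v \<in> Q" if "u \<in> Q" "v \<in> Q" for u v
    proof -
      have c: "u \<in> carrier G" "v \<in> carrier G" using that by (auto simp: Q_def)
      have "x \<otimes>\<^bsub>G\<^esub> (u \<otimes>\<^bsub>G\<^esub> v) \<in> C" if x: "x \<in> C" for x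
      proof -
        have "x \<otimes>\<^bsub>G\<^esub> u \<in> C" using x \<open>u \<in> Q\<close> by (simp add: Q_def P_def)
        then have "x \<otimes>\<^bsub>G\<^esub> u \<otimes>\<^bsub>G\<^esub> v \<in> C" using \<open>v \<in> Q\<close> by (simp add: Q_def P_def)
        then show ?thesis using c x CG by (simp add: m_assoc subsetD)
      qed
      moreover have "x \<otimes>\<^bsub>G\<^esub> (inv\<^bsub>G\<^esub> v \<otimes>\<^bsub>G\<^esub> inv\<^bsub>G\<^esub> u) \<in> C" if x: "x \<in> C" for x
      proof -
        have "x \<otimes>\<^bsub>G\<^esub> inv\<^bsub>G\<^esub> v \<in> C" using x \<open>v \<in> Q\<close> by (simp add: Q_def P_def)
        then have "x \<otimes>\<^bsub>G\<^esub> inv\<^bsub>G\<^esub> v \<otimes>\<^bsub>G\<^esub> inv\<^bsub>G\<^esub> u \<in> C" using \<open>u \<in> Q\<close> by (simp add: Q_def P_def)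
        then show ?thesis using c x CG by (simp add: m_assoc subsetD)
      qed
      ultimately show ?thesis using c by (simp add: Q_def P_def inv_mult_group)
    qed
  qed (auto simp: Q_def)
  define U where "U = {u \<in> carrier G. \<forall>x\<in>carrier G. x \<otimes>\<^bsub>G\<^esub> u \<otimes>\<^bsub>G\<^esub> inv\<^bsub>G\<^esub> x \<in> Q}"
  have Uo: "openin T U"
  proof -
    have "continuous_map (prod_topology T T) T (\<lambda>z. snd z \<otimes>\<^bsub>G\<^esub> fst z \<otimes>\<^bsub>G\<^esub> inv\<^bsub>G\<^esub> (snd z))"
      by (intro continuous_mult continuous_inv continuous_map_snd continuous_map_fst)
    moreover have "compactin T (carrier G)" using compact topspace by (simp add: compact_space_def)
    ultimately show ?thesis
      using openin_forall_compact[OF _ Qo, of "\<lambda>z. snd z \<otimes>\<^bsub>G\<^esub> fst z \<otimes>\<^bsub>G\<^esub> inv\<^bsub>G\<^esub> (snd z)"]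
      by (simp add: U_def)
  qed
  have Us: "subgroup U G"
  proof (rule subgroupI)
    show "U \<noteq> {}" using subgroup.one_closed[OF Qs] by (auto simp: U_def intro!: exI[of _ "\<one>\<^bsub>G\<^esub>"])
    show "inv\<^bsub>G\<^esub> u \<in> U" if u: "u \<in> U" for u
    proof -
      have c: "u \<in> carrier G" using u by (simp add: U_def)
      have "x \<otimes>\<^bsub>G\<^esub> inv\<^bsub>G\<^esub> u \<otimes>\<^bsub>G\<^esub> inv\<^bsub>G\<^esub> x = inv\<^bsub>G\<^esub> (x \<otimes>\<^bsub>G\<^esub> u \<otimes>\<^bsub>G\<^esub> inv\<^bsub>G\<^esub> x)" if "x \<in> carrier G" for x
        using c that by (simp add: inv_mult_group m_assoc)
      then show ?thesis using u c subgroup.m_inv_closed[OF Qs] by (simp add: U_def)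
    qed
    show "u \<otimes>\<^bsub>G\<^esub> v \<in> U" if uv: "u \<in> U" "v \<in> U" for u v
    proof -
      have c: "u \<in> carrier G" "v \<in> carrier G" using uv by (auto simp: U_def)
      have "x \<otimes>\<^bsub>G\<^esub> (u \<otimes>\<^bsub>G\<^esub> v) \<otimes>\<^bsub>G\<^esub> inv\<^bsub>G\<^esub> x =
        (x \<otimes>\<^bsub>G\<^esub> u \<otimes>\<^bsub>G\<^esub> inv\<^bsub>G\<^esub> x) \<otimes>\<^bsub>G\<^esub> (x \<otimes>\<^bsub>G\<^esub> v \<otimes>\<^bsub>G\<^esub> inv\<^bsub>G\<^esub> x)" if "x \<in> carrier G" for x
        using c that by (simp add: m_assoc) (simp flip: m_assoc)
      then show ?thesis using uv c subgroup.m_closed[OF Qs] by (simp add: U_def)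
    qed
  qed (auto simp: U_def)
  have "U \<lhd> G" unfolding normal_inv_iff
  proof (intro conjI Us ballI)
    fix x u assume x: "x \<in> carrier G" and u: "u \<in> U"
    then have c: "u \<in> carrier G" by (simp add: U_def)
    have "y \<otimes>\<^bsub>G\<^esub> (x \<otimes>\<^bsub>G\<^esub> u \<otimes>\<^bsub>G\<^esub> inv\<^bsub>G\<^esub> x) \<otimes>\<^bsub>G\<^esub> inv\<^bsub>G\<^esub> y = (y \<otimes>\<^bsub>G\<^esub> x) \<otimes>\<^bsub>G\<^esub> u \<otimes>\<^bsub>G\<^esub> inv\<^bsub>G\<^esub> (y \<otimes>\<^bsub>G\<^esub> x)"
      if "y \<in> carrier G" for y
      using c x that by (simp add: m_assoc inv_mult_group)
    then show "x \<otimes>\<^bsub>G\<^esub> u \<otimes>\<^bsub>G\<^esub> inv\<^bsub>G\<^esub> x \<in> U" using u x c by (simp add: U_def)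
  qed
  moreover have "g \<notin> U"
  proof
    assume "g \<in> U"
    then have "\<one>\<^bsub>G\<^esub> \<otimes>\<^bsub>G\<^esub> g \<otimes>\<^bsub>G\<^esub> inv\<^bsub>G\<^esub> \<one>\<^bsub>G\<^esub> \<in> Q" unfolding U_def by blast
    then have "g \<in> P" using assms(2) by (simp add: Q_def)
    then have "\<one>\<^bsub>G\<^esub> \<otimes>\<^bsub>G\<^esub> g \<in> C" using C(3) by (auto simp: P_def)
    then show False using C(4) assms(2) by simp
  qed
  ultimately show ?thesis using Uo by (auto simp: open_normal_def)
qed

section \<open>Elements of the Iwasawa algebra as coherent families of integers\<close>

locale iwasawa = compact_group +
  fixes p :: nat
  assumes prime: "prime p"
begin

abbreviation \<Lambda> where "\<Lambda> \<equiv> Iwasawa p G T"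

lemma p_pos: "p > 0"
  using prime prime_gt_0_nat by blast

lemma carrier_Mod: "carrier (G Mod U) = rcosets U"
  by (simp add: FactGroup_def)

lemma finsum_Zp_coset_sum:
  assumes "U \<in> \<N>" "\<forall>D\<in>rcosets U. f D \<in> carrier (Zp p)"
  shows "(\<Oplus>\<^bsub>Zp p\<^esub>D\<in>{D \<in> rcosets U. D \<subseteq> C}. f D) n = (\<Sum>D\<in>{D \<in> rcosets U. D \<subseteq> C}. f D n) mod int p ^ n"
  by (rule Zp_finsum[OF p_pos]) (use assms finite_rcosets in auto)

text \<open>This turns an element of \<Lambda> into a measure with integer values:
  \<open>a U C n\<close> is the mass of the coset C modulo p^n, and coherence is additivity over the
  smaller cosets inside C. Later identities in \<Lambda> are checked on these values.\<close>

lemma \<Lambda>_carrier: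
  "a \<in> carrier \<Lambda> \<longleftrightarrow> a \<in> extensional \<N> \<and>
    (\<forall>U\<in>\<N>. a U \<in> extensional (rcosets U) \<and> (\<forall>C\<in>rcosets U. a U C \<in> carrier (Zp p))) \<and>
    (\<forall>U\<in>\<N>. \<forall>V\<in>\<N>. U \<subseteq> V \<longrightarrow> (\<forall>C\<in>rcosets V. \<forall>n.
      a V C n = (\<Sum>D\<in>{D \<in> rcosets U. D \<subseteq> C}. a U D n) mod int p ^ n))"
  (is "_ \<longleftrightarrow> ?e \<and> ?v \<and> ?c")
proof -
  have "a \<in> carrier \<Lambda> \<longleftrightarrow> (?e \<and> ?v) \<and>
      (\<forall>U\<in>\<N>. \<forall>V\<in>\<N>. U \<subseteq> V \<longrightarrow> push_cosets (Zp p) (G Mod U) (G Mod V) (a U) = a V)"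
    by (auto simp: Iwasawa_def Let_def group_ring_def PiE_iff carrier_Mod)
  moreover have "push_cosets (Zp p) (G Mod U) (G Mod V) (a U) = a V \<longleftrightarrow>
      (\<forall>C\<in>rcosets V. \<forall>n. a V C n = (\<Sum>D\<in>{D \<in> rcosets U. D \<subseteq> C}. a U D n) mod int p ^ n)"
    if "?v" "U \<in> \<N>" "V \<in> \<N>" for U V
  proof -
    have "push_cosets (Zp p) (G Mod U) (G Mod V) (a U) = a V \<longleftrightarrow>
      (\<forall>C\<in>rcosets V. (\<Oplus>\<^bsub>Zp p\<^esub>D\<in>{D \<in> rcosets U. D \<subseteq> C}. a U D) = a V C)"
      unfolding push_cosets_def carrier_Mod
    proof
      assume h: "(\<lambda>C\<in>rcosets V. \<Oplus>\<^bsub>Zp p\<^esub>D\<in>{D \<in> rcosets U. D \<subseteq> C}. a U D) = a V"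
      show "\<forall>C\<in>rcosets V. (\<Oplus>\<^bsub>Zp p\<^esub>D\<in>{D \<in> rcosets U. D \<subseteq> C}. a U D) = a V C"
        unfolding h[symmetric] by simp
    next
      assume h: "\<forall>C\<in>rcosets V. (\<Oplus>\<^bsub>Zp p\<^esub>D\<in>{D \<in> rcosets U. D \<subseteq> C}. a U D) = a V C"
      show "(\<lambda>C\<in>rcosets V. \<Oplus>\<^bsub>Zp p\<^esub>D\<in>{D \<in> rcosets U. D \<subseteq> C}. a U D) = a V"
        by (rule extensionalityI[OF restrict_extensional]) (use that h in auto)
    qed
    also have "\<dots> \<longleftrightarrow> (\<forall>C\<in>rcosets V. \<forall>n. a V C n = (\<Sum>D\<in>{D \<in> rcosets U. D \<subseteq> C}. a U D n) mod int p ^ n)"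
      using finsum_Zp_coset_sum[OF that(2), of "a U"] that by (auto simp: fun_eq_iff)
    finally show ?thesis .
  qed
  then have "?v \<Longrightarrow> (\<forall>U\<in>\<N>. \<forall>V\<in>\<N>. U \<subseteq> V \<longrightarrow> push_cosets (Zp p) (G Mod U) (G Mod V) (a U) = a V) \<longleftrightarrow> ?c"
    by auto
  ultimately show ?thesis by argo
qed

lemma \<Lambda>_ext: "a \<in> carrier \<Lambda> \<Longrightarrow> a \<in> extensional \<N>"
  by (simp add: \<Lambda>_carrier)

lemma \<Lambda>_ext': "a \<in> carrier \<Lambda> \<Longrightarrow> U \<in> \<N> \<Longrightarrow> a U \<in> extensional (rcosets U)"
  by (simp add: \<Lambda>_carrier)

lemma \<Lambda>_value: "a \<in> carrier \<Lambda> \<Longrightarrow> U \<in> \<N> \<Longrightarrow> C \<in> rcosets U \<Longrightarrow> a U C \<in> carrier (Zp p)"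
  by (simp add: \<Lambda>_carrier)

lemma \<Lambda>_coherent:
  assumes "a \<in> carrier \<Lambda>" "U \<in> \<N>" "V \<in> \<N>" "U \<subseteq> V" "C \<in> rcosets V"
  shows "a V C n = (\<Sum>D\<in>{D \<in> rcosets U. D \<subseteq> C}. a U D n) mod int p ^ n"
  using assms(1)[unfolded \<Lambda>_carrier, THEN conjunct2, THEN conjunct2, rule_format, OF assms(2-5)] .

lemma \<Lambda>I:
  assumes "a \<in> extensional \<N>" "\<And>U. U \<in> \<N> \<Longrightarrow> a U \<in> extensional (rcosets U)"
    "\<And>U C. U \<in> \<N> \<Longrightarrow> C \<in> rcosets U \<Longrightarrow> a U C \<in> carrier (Zp p)"
    "\<And>U V C n. U \<in> \<N> \<Longrightarrow> V \<in> \<N> \<Longrightarrow> U \<subseteq> V \<Longrightarrow> C \<in> rcosets V \<Longrightarrow>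
      a V C n = (\<Sum>D\<in>{D \<in> rcosets U. D \<subseteq> C}. a U D n) mod int p ^ n"
  shows "a \<in> carrier \<Lambda>"
  unfolding \<Lambda>_carrier by (intro conjI ballI allI impI assms)

lemma \<Lambda>_mod: "a \<in> carrier \<Lambda> \<Longrightarrow> U \<in> \<N> \<Longrightarrow> C \<in> rcosets U \<Longrightarrow> a U C n mod int p ^ n = a U C n"
  using \<Lambda>_value Zp_mod by blast

lemma \<Lambda>_eqI:
  assumes "a \<in> carrier \<Lambda>" "b \<in> carrier \<Lambda>"
    "\<And>U C n. U \<in> \<N> \<Longrightarrow> C \<in> rcosets U \<Longrightarrow> a U C n = b U C n"
  shows "a = b"
proof (rule extensionalityI[OF \<Lambda>_ext[OF assms(1)] \<Lambda>_ext[OF assms(2)]])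
  fix U assume U: "U \<in> \<N>"
  show "a U = b U"
    by (rule extensionalityI[OF \<Lambda>_ext'[OF assms(1) U] \<Lambda>_ext'[OF assms(2) U]]) (use assms(3) U in auto)
qed

lemma add_\<Lambda>: "U \<in> \<N> \<Longrightarrow> C \<in> rcosets U \<Longrightarrow> (a \<oplus>\<^bsub>\<Lambda>\<^esub> b) U C n = (a U C n + b U C n) mod int p ^ n"
  by (simp add: Iwasawa_def Let_def group_ring_def carrier_Mod Zp_sel)

lemma zero_\<Lambda>: "U \<in> \<N> \<Longrightarrow> C \<in> rcosets U \<Longrightarrow> \<zero>\<^bsub>\<Lambda>\<^esub> U C n = 0"
  by (simp add: Iwasawa_def Let_def group_ring_def carrier_Mod Zp_sel)

lemma rcosetsE:
  assumes "C \<in> rcosets U" obtains x where "x \<in> carrier G" "C = U #> x"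
  using assms by (auto simp: RCOSETS_def)

lemma rcosets_I: "x \<in> carrier G \<Longrightarrow> U #> x \<in> rcosets U"
  by (auto simp: RCOSETS_def)

lemma inv_mult_rcos:
  assumes "U \<in> \<N>" "g \<in> carrier G" "x \<in> carrier G"
  shows "inv\<^bsub>G Mod U\<^esub> (U #> g) \<otimes>\<^bsub>G Mod U\<^esub> (U #> x) = U #> (inv g \<otimes> x)"
proof -
  interpret U: normal U G by (rule \<N>D(1)[OF assms(1)])
  show ?thesis
    using assms U.inv_FactGroup[of "U #> g"] U.rcos_inv U.rcos_sum rcosets_I by (simp add: carrier_Mod)
qed

lemma mult_\<Lambda>:
  assumes "a \<in> carrier \<Lambda>" "b \<in> carrier \<Lambda>" "U \<in> \<N>" "x \<in> carrier G"
  shows "(a \<otimes>\<^bsub>\<Lambda>\<^esub> b) U (U #> x) n =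
    (\<Sum>D\<in>rcosets U. a U D n * b U (inv\<^bsub>G Mod U\<^esub> D \<otimes>\<^bsub>G Mod U\<^esub> (U #> x)) n mod int p ^ n) mod int p ^ n"
proof -
  have cl: "a U D \<otimes>\<^bsub>Zp p\<^esub> b U (inv\<^bsub>G Mod U\<^esub> D \<otimes>\<^bsub>G Mod U\<^esub> (U #> x)) \<in> carrier (Zp p)"
    if D: "D \<in> rcosets U" for D
  proof -
    obtain d where d: "d \<in> carrier G" "D = U #> d" using D by (rule rcosetsE)
    then have "inv\<^bsub>G Mod U\<^esub> D \<otimes>\<^bsub>G Mod U\<^esub> (U #> x) \<in> rcosets U"
      using inv_mult_rcos[OF assms(3) _ assms(4)] rcosets_I assms(4) by simp
    then show ?thesis using \<Lambda>_value assms D by (intro Zp_mult_closed p_pos) auto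
  qed
  have "(a \<otimes>\<^bsub>\<Lambda>\<^esub> b) U (U #> x) =
      (\<Oplus>\<^bsub>Zp p\<^esub>D\<in>rcosets U. a U D \<otimes>\<^bsub>Zp p\<^esub> b U (inv\<^bsub>G Mod U\<^esub> D \<otimes>\<^bsub>G Mod U\<^esub> (U #> x)))"
    using assms(3) rcosets_I[OF assms(4), of U]
    by (simp add: Iwasawa_def Let_def group_ring_def carrier_Mod)
  then show ?thesis using Zp_finsum[OF p_pos finite_rcosets[OF assms(3)] cl] by (simp add: Zp_sel)
qed

subsection \<open>Finitely supported elements\<close>

text \<open>The element of the group ring \<int>[G] with coefficient \<open>b g\<close> at g for g
  in F, regarded as a sum of point masses.\<close>

definition atom :: "'a set \<Rightarrow> ('a \<Rightarrow> int) \<Rightarrow> 'a completed" where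
  "atom F b = (\<lambda>U\<in>\<N>. \<lambda>C\<in>rcosets U. \<lambda>n. (\<Sum>g\<in>F. if g \<in> C then b g else 0) mod int p ^ n)"

lemma atom_value: "U \<in> \<N> \<Longrightarrow> C \<in> rcosets U \<Longrightarrow> atom F b U C n = (\<Sum>g\<in>F. if g \<in> C then b g else 0) mod int p ^ n"
  by (simp add: atom_def)

lemma mem_rcos_iff:
  assumes "subgroup U G" "g \<in> carrier G" "D \<in> rcosets U"
  shows "g \<in> D \<longleftrightarrow> D = U #> g"
proof
  obtain x where x: "x \<in> carrier G" "D = U #> x" using assms(3) by (rule rcosetsE)
  assume "g \<in> D"
  then show "D = U #> g" unfolding x(2) by (intro repr_independence) (use x assms(1) in auto)
next
  assume "D = U #> g"
  then show "g \<in> D" using rcos_self[OF assms(2,1)] by simp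
qed

lemma sum_cosets_indicator:
  assumes "U \<in> \<N>" "V \<in> \<N>" "U \<subseteq> V" "C \<in> rcosets V" "g \<in> carrier G"
  shows "(\<Sum>D\<in>{D \<in> rcosets U. D \<subseteq> C}. if g \<in> D then z else 0) = (if g \<in> C then z else (0::int))"
proof -
  have Us: "subgroup U G" and Vs: "subgroup V G" using assms \<N>D by blast+
  obtain x where x: "x \<in> carrier G" "C = V #> x" using assms(4) by (rule rcosetsE)
  have "(\<Sum>D\<in>{D \<in> rcosets U. D \<subseteq> C}. if g \<in> D then z else 0) =
      (\<Sum>D\<in>{D \<in> rcosets U. D \<subseteq> C}. if D = U #> g then z else 0)"
    by (rule sum.cong) (use mem_rcos_iff[OF Us assms(5)] in auto)
  also have "\<dots> = (if U #> g \<in> {D \<in> rcosets U. D \<subseteq> C} then z else 0)"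
    using finite_rcosets[OF assms(1)] by (intro sum.delta) auto
  also have "U #> g \<in> {D \<in> rcosets U. D \<subseteq> C} \<longleftrightarrow> g \<in> C"
    using rcos_subset_iff[OF Us Vs assms(3,5) x(1)] rcosets_I[OF assms(5)] x(2) by simp
  finally show ?thesis .
qed

lemma atom_closed:
  assumes "finite F" "F \<subseteq> carrier G"
  shows "atom F b \<in> carrier \<Lambda>"
proof (rule \<Lambda>I)
  fix U V C n assume U: "U \<in> \<N>" and V: "V \<in> \<N>" and UV: "U \<subseteq> V" and C: "C \<in> rcosets V"
  have "(\<Sum>D\<in>{D \<in> rcosets U. D \<subseteq> C}. atom F b U D n) mod int p ^ n =
      (\<Sum>D\<in>{D \<in> rcosets U. D \<subseteq> C}. (\<Sum>g\<in>F. if g \<in> D then b g else 0) mod int p ^ n) mod int p ^ n"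
    using U by (intro arg_cong[where f = "\<lambda>z. z mod int p ^ n"] sum.cong refl) (simp add: atom_value)
  also have "\<dots> = (\<Sum>D\<in>{D \<in> rcosets U. D \<subseteq> C}. \<Sum>g\<in>F. if g \<in> D then b g else 0) mod int p ^ n"
    by (rule mod_sum_eq)
  also have "\<dots> = (\<Sum>g\<in>F. \<Sum>D\<in>{D \<in> rcosets U. D \<subseteq> C}. if g \<in> D then b g else 0) mod int p ^ n"
    by (subst sum.swap) (rule refl)
  also have "\<dots> = (\<Sum>g\<in>F. if g \<in> C then b g else 0) mod int p ^ n"
    using assms(2) by (intro arg_cong[where f = "\<lambda>z. z mod int p ^ n"] sum.cong refl
        sum_cosets_indicator[OF U V UV C]) blast
  finally show "atom F b V C n = (\<Sum>D\<in>{D \<in> rcosets U. D \<subseteq> C}. atom F b U D n) mod int p ^ n"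
    using V C by (simp add: atom_value)
next
  fix U C assume "U \<in> \<N>" "C \<in> rcosets U"
  then show "atom F b U C \<in> carrier (Zp p)" using Zp_of_int[OF p_pos] by (simp add: atom_def)
qed (auto simp: atom_def)

definition \<delta> :: "'a \<Rightarrow> 'a completed" where "\<delta> g = atom {g} (\<lambda>_. 1)"

lemma \<delta>_closed [simp]: "g \<in> carrier G \<Longrightarrow> \<delta> g \<in> carrier \<Lambda>"
  unfolding \<delta>_def by (rule atom_closed) auto

lemma \<delta>_value: "U \<in> \<N> \<Longrightarrow> C \<in> rcosets U \<Longrightarrow> \<delta> g U C n = (if g \<in> C then 1 mod int p ^ n else 0)"
  by (simp add: \<delta>_def atom_value)

lemma \<delta>_mult:
  assumes "a \<in> carrier \<Lambda>" "U \<in> \<N>" "g \<in> carrier G" "x \<in> carrier G"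
  shows "(\<delta> g \<otimes>\<^bsub>\<Lambda>\<^esub> a) U (U #> x) n = a U (U #> (inv g \<otimes> x)) n"
proof -
  have Us: "subgroup U G" using assms \<N>D by blast
  have "(\<Sum>D\<in>rcosets U. \<delta> g U D n * a U (inv\<^bsub>G Mod U\<^esub> D \<otimes>\<^bsub>G Mod U\<^esub> (U #> x)) n mod int p ^ n) =
      (\<Sum>D\<in>rcosets U. if D = U #> g then a U (U #> (inv g \<otimes> x)) n mod int p ^ n else 0)"
  proof (rule sum.cong[OF refl])
    fix D assume D: "D \<in> rcosets U"
    show "\<delta> g U D n * a U (inv\<^bsub>G Mod U\<^esub> D \<otimes>\<^bsub>G Mod U\<^esub> (U #> x)) n mod int p ^ n =
        (if D = U #> g then a U (U #> (inv g \<otimes> x)) n mod int p ^ n else 0)"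
      using mem_rcos_iff[OF Us assms(3) D] D assms(2) inv_mult_rcos[OF assms(2,3,4)]
      by (simp add: \<delta>_value mod_mult_left_eq)
  qed
  also have "\<dots> = a U (U #> (inv g \<otimes> x)) n mod int p ^ n"
    using finite_rcosets[OF assms(2)] rcosets_I[OF assms(3), of U] by simp
  finally show ?thesis
    using mult_\<Lambda>[OF \<delta>_closed[OF assms(3)] assms(1,2,4)] \<Lambda>_mod[OF assms(1,2) rcosets_I] assms by simp
qed

lemma one_\<Lambda>: "\<one>\<^bsub>\<Lambda>\<^esub> = \<delta> \<one>"
proof
  fix U
  show "\<one>\<^bsub>\<Lambda>\<^esub> U = \<delta> \<one> U"
  proof (cases "U \<in> \<N>")
    case True
    then have Us: "subgroup U G" using \<N>D by blast
    have "\<one> \<in> C \<longleftrightarrow> C = U" if "C \<in> rcosets U" for C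
      using mem_rcos_iff[OF Us one_closed that] coset_mult_one[OF subgroup.subset[OF Us]] by simp
    then have "(\<lambda>C\<in>rcosets U. if C = U then \<one>\<^bsub>Zp p\<^esub> else \<zero>\<^bsub>Zp p\<^esub>) =
        (\<lambda>C\<in>rcosets U. \<lambda>n. if \<one> \<in> C then 1 mod int p ^ n else 0)"
      by (intro restrict_ext) (simp add: Zp_sel)
    moreover have "\<delta> \<one> U = (\<lambda>C\<in>rcosets U. \<lambda>n. if \<one> \<in> C then 1 mod int p ^ n else 0)"
      using True by (simp add: \<delta>_def atom_def) (intro restrict_ext, simp)
    ultimately show ?thesis using True
      by (simp add: Iwasawa_def Let_def group_ring_def carrier_Mod)
  qed (simp add: Iwasawa_def Let_def \<delta>_def atom_def)
qed

lemma \<delta>_mult_\<delta>: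
  assumes "ring \<Lambda>" "g \<in> carrier G" "h \<in> carrier G"
  shows "\<delta> g \<otimes>\<^bsub>\<Lambda>\<^esub> \<delta> h = \<delta> (g \<otimes> h)"
proof -
  interpret L: ring \<Lambda> by (rule assms(1))
  show ?thesis
  proof (rule \<Lambda>_eqI)
    fix U C n assume U: "U \<in> \<N>" and "C \<in> rcosets U"
    then obtain x where x: "x \<in> carrier G" "C = U #> x" by (auto elim: rcosetsE)
    have Us: "subgroup U G" using U \<N>D by blast
    interpret U: normal U G by (rule \<N>D(1)[OF U])
    have "h \<in> U #> (inv g \<otimes> x) \<longleftrightarrow> U #> (inv g \<otimes> x) = U #> h"
      using mem_rcos_iff[OF Us assms(3) rcosets_I] assms x by simp
    also have "\<dots> \<longleftrightarrow> U #> x = U #> (g \<otimes> h)"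
    proof
      assume e: "U #> (inv g \<otimes> x) = U #> h"
      have "U #> x = (U #> g) <#> (U #> (inv g \<otimes> x))"
        using assms x by (simp add: U.rcos_sum flip: m_assoc)
      also have "\<dots> = U #> (g \<otimes> h)" unfolding e using assms by (simp add: U.rcos_sum)
      finally show "U #> x = U #> (g \<otimes> h)" .
    next
      assume e: "U #> x = U #> (g \<otimes> h)"
      have "U #> (inv g \<otimes> x) = (U #> inv g) <#> (U #> x)" using assms x by (simp add: U.rcos_sum)
      also have "\<dots> = U #> (inv g \<otimes> (g \<otimes> h))" unfolding e using assms by (simp add: U.rcos_sum)
      also have "inv g \<otimes> (g \<otimes> h) = h" using assms by (simp flip: m_assoc)
      finally show "U #> (inv g \<otimes> x) = U #> h" .
    qed
    also have "\<dots> \<longleftrightarrow> g \<otimes> h \<in> C"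
      using mem_rcos_iff[OF Us _ rcosets_I[OF x(1)], of "g \<otimes> h"] assms x by simp
    finally show "(\<delta> g \<otimes>\<^bsub>\<Lambda>\<^esub> \<delta> h) U C n = \<delta> (g \<otimes> h) U C n"
      using \<delta>_mult[OF \<delta>_closed[OF assms(3)] U assms(2) x(1)] U x assms
      by (simp add: \<delta>_value rcosets_I)
  qed (use assms in auto)
qed

lemma \<delta>_pow:
  assumes "ring \<Lambda>" "g \<in> carrier G"
  shows "\<delta> g [^]\<^bsub>\<Lambda>\<^esub> (n::nat) = \<delta> (g [^] n)"
proof -
  interpret L: ring \<Lambda> by (rule assms(1))
  show ?thesis by (induction n) (use assms \<delta>_mult_\<delta> one_\<Lambda> in auto)
qed

lemma minus_\<Lambda>:
  assumes "ring \<Lambda>" "a \<in> carrier \<Lambda>" "U \<in> \<N>" "C \<in> rcosets U"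
  shows "(\<ominus>\<^bsub>\<Lambda>\<^esub> a) U C n = (- a U C n) mod int p ^ n"
proof -
  interpret L: ring \<Lambda> by (rule assms(1))
  let ?b = "\<ominus>\<^bsub>\<Lambda>\<^esub> a"
  have "(a \<oplus>\<^bsub>\<Lambda>\<^esub> ?b) U C n = 0" using L.r_neg[OF assms(2)] zero_\<Lambda> assms(3,4) by simp
  then have "(a U C n + ?b U C n) mod int p ^ n = 0" using add_\<Lambda> assms(3,4) by simp
  then have "(?b U C n) mod int p ^ n = (- a U C n) mod int p ^ n"
    by (metis add.commute add.inverse_inverse diff_minus_eq_add mod_0_imp_dvd mod_eq_dvd_iff)
  then show ?thesis using \<Lambda>_mod[OF L.a_inv_closed[OF assms(2)] assms(3,4)] by simp
qed

lemma \<delta>_minus_one_mult: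
  assumes "ring \<Lambda>" "a \<in> carrier \<Lambda>" "U \<in> \<N>" "g \<in> carrier G" "x \<in> carrier G"
  shows "((\<delta> g \<ominus>\<^bsub>\<Lambda>\<^esub> \<one>\<^bsub>\<Lambda>\<^esub>) \<otimes>\<^bsub>\<Lambda>\<^esub> a) U (U #> x) n =
    (a U (U #> (inv g \<otimes> x)) n - a U (U #> x) n) mod int p ^ n"
proof -
  interpret L: ring \<Lambda> by (rule assms(1))
  have "(\<delta> g \<ominus>\<^bsub>\<Lambda>\<^esub> \<one>\<^bsub>\<Lambda>\<^esub>) \<otimes>\<^bsub>\<Lambda>\<^esub> a = (\<delta> g \<otimes>\<^bsub>\<Lambda>\<^esub> a) \<oplus>\<^bsub>\<Lambda>\<^esub> (\<ominus>\<^bsub>\<Lambda>\<^esub> a)"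
    using assms by (simp add: L.minus_eq L.l_distr L.l_minus)
  then show ?thesis
    using add_\<Lambda>[OF assms(3) rcosets_I[OF assms(5)]] \<delta>_mult[OF assms(2,3,4,5)]
      minus_\<Lambda>[OF assms(1,2,3) rcosets_I[OF assms(5)]] by (simp add: mod_add_right_eq)
qed

lemma add_pow_\<Lambda>:
  assumes "ring \<Lambda>" "a \<in> carrier \<Lambda>" "U \<in> \<N>" "C \<in> rcosets U"
  shows "(add_pow \<Lambda> k a) U C n = (int k * a U C n) mod int p ^ n"
proof -
  interpret L: ring \<Lambda> by (rule assms(1))
  show ?thesis
  proof (induction k)
    case 0
    then show ?case using zero_\<Lambda> assms by simp
  next
    case (Suc k)
    then show ?case using add_\<Lambda>[OF assms(3,4), of "add_pow \<Lambda> k a" a] assms(2)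
      by (simp add: mod_add_left_eq mod_add_right_eq algebra_simps)
  qed
qed

subsection \<open>Neighbourhoods of zero\<close>

lemma topspace_Zp: "topspace (Zp_top p) = carrier (Zp p)"
  by (auto simp: Zp_top_def Zp_def)

text \<open>A basic open box of the product restricts only finitely many levels U, so whatever
  agrees with 0 at those levels lies in it.\<close>

lemma \<Lambda>_nhd_zero:
  assumes "openin (Iwasawa_top p G T) W" "\<zero>\<^bsub>\<Lambda>\<^esub> \<in> W"
  shows "\<exists>F. finite F \<and> F \<subseteq> \<N> \<and>
    (\<forall>a\<in>carrier \<Lambda>. (\<forall>U\<in>F. \<forall>C\<in>rcosets U. \<forall>n. a U C n = 0) \<longrightarrow> a \<in> W)"
proof -
  let ?P = "\<lambda>U. product_topology (\<lambda>_. Zp_top p) (rcosets U)"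
  obtain W' where W': "openin (product_topology ?P \<N>) W'" "W = W' \<inter> carrier \<Lambda>"
    using assms(1) by (auto simp: Iwasawa_top_def openin_subtopology carrier_Mod)
  have z: "\<zero>\<^bsub>\<Lambda>\<^esub> \<in> W'" using W'(2) assms(2) by simp
  then obtain X where X: "finite {U \<in> \<N>. X U \<noteq> topspace (?P U)}" "\<zero>\<^bsub>\<Lambda>\<^esub> \<in> Pi\<^sub>E \<N> X" "Pi\<^sub>E \<N> X \<subseteq> W'"
    using W'(1)[unfolded openin_product_topology_alt, rule_format, OF z] by (elim exE conjE)
  let ?F = "{U \<in> \<N>. X U \<noteq> topspace (?P U)}"
  have "a \<in> W" if a: "a \<in> carrier \<Lambda>" "\<forall>U\<in>?F. \<forall>C\<in>rcosets U. \<forall>n. a U C n = 0" for a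
  proof -
    have "a U \<in> X U" if U: "U \<in> \<N>" for U
    proof (cases "U \<in> ?F")
      case True
      have "\<zero>\<^bsub>\<Lambda>\<^esub> U \<in> extensional (rcosets U)"
        using U by (simp add: Iwasawa_def Let_def group_ring_def carrier_Mod)
      then have "a U = \<zero>\<^bsub>\<Lambda>\<^esub> U"
        using extensionalityI[OF \<Lambda>_ext'[OF a(1) U], of "\<zero>\<^bsub>\<Lambda>\<^esub> U"] a(2) True zero_\<Lambda>[OF U]
        by (auto simp: fun_eq_iff)
      then show ?thesis using X(2) U by (simp add: PiE_iff)
    next
      case False
      then have "X U = topspace (?P U)" using U by simp
      then show ?thesis using \<Lambda>_value[OF a(1) U] \<Lambda>_ext'[OF a(1) U] by (simp add: topspace_Zp PiE_iff)
    qed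
    then have "a \<in> Pi\<^sub>E \<N> X" using \<Lambda>_ext[OF a(1)] by (simp add: PiE_iff)
    then show ?thesis using W' X(3) a(1) by blast
  qed
  then show ?thesis using X(1) by (intro exI[of _ ?F]) auto
qed

end

section \<open>Translations on finite quotients\<close>

context iwasawa
begin

text \<open>Left translation by g on G/U, written as a product of cosets so that no representative
  of D enters.\<close>

definition transl :: "'a set \<Rightarrow> 'a \<Rightarrow> 'a set \<Rightarrow> 'a set" where
  "transl U g D = (U #> g) <#> D"

definition mord :: "'a set \<Rightarrow> 'a \<Rightarrow> nat" where
  "mord U g = group.ord (G Mod U) (U #> g)"

lemma transl_rcos: "U \<in> \<N> \<Longrightarrow> g \<in> carrier G \<Longrightarrow> x \<in> carrier G \<Longrightarrow> transl U g (U #> x) = U #> (g \<otimes> x)"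
  unfolding transl_def using normal.rcos_sum[OF \<N>D(1)] by blast

lemma transl_pow:
  assumes "U \<in> \<N>" "g \<in> carrier G" "x \<in> carrier G"
  shows "(transl U g ^^ i) (U #> x) = U #> (g [^] i \<otimes> x)"
proof (induction i)
  case (Suc i)
  have "(transl U g ^^ Suc i) (U #> x) = U #> (g \<otimes> (g [^] i \<otimes> x))"
    using Suc transl_rcos[OF assms(1,2), of "g [^] i \<otimes> x"] assms by simp
  also have "g \<otimes> (g [^] i \<otimes> x) = g [^] Suc i \<otimes> x"
    using assms(2,3) nat_pow_Suc2[OF assms(2), of i] by (simp add: m_assoc)
  finally show ?case .
qed (use assms in simp)

lemma rcos_eq_self_iff: "U \<in> \<N> \<Longrightarrow> g \<in> carrier G \<Longrightarrow> U #> g = U \<longleftrightarrow> g \<in> U"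
  using coset_join1[OF _ _ \<N>D(3)] coset_join2[OF _ \<N>D(3)] subgroup.subset[OF \<N>D(3)] by blast

lemma mord_dvd_iff:
  assumes "U \<in> \<N>" "g \<in> carrier G"
  shows "mord U g dvd k \<longleftrightarrow> g [^] k \<in> U"
proof -
  interpret U: normal U G by (rule \<N>D(1)[OF assms(1)])
  interpret Q: group "G Mod U" by (rule U.factorgroup_is_group)
  have "mord U g dvd k \<longleftrightarrow> (U #> g) [^]\<^bsub>G Mod U\<^esub> k = \<one>\<^bsub>G Mod U\<^esub>"
    unfolding mord_def using Q.pow_eq_id[of "U #> g" k] rcosets_I[OF assms(2), of U] by (simp add: carrier_Mod)
  also have "(U #> g) [^]\<^bsub>G Mod U\<^esub> k = U #> (g [^] k)"
    by (rule U.FactGroup_pow[OF assms(2)])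
  finally show ?thesis using rcos_eq_self_iff[OF assms(1), of "g [^] k"] assms(2) by simp
qed

lemma mord_pos:
  assumes "U \<in> \<N>" "g \<in> carrier G"
  shows "mord U g > 0"
proof -
  interpret U: normal U G by (rule \<N>D(1)[OF assms(1)])
  interpret Q: group "G Mod U" by (rule U.factorgroup_is_group)
  have c: "U #> g \<in> carrier (G Mod U)" using rcosets_I[OF assms(2)] by (simp add: carrier_Mod)
  have "finite (carrier (G Mod U))" using finite_rcosets[OF assms(1)] by (simp add: carrier_Mod)
  then have "Coset.order (G Mod U) > 0" using Q.order_gt_0_iff_finite by simp
  then show ?thesis unfolding mord_def using Q.ord_dvd_group_order[OF c] by (auto intro: Nat.gr0I)
qed

lemma rcos_mult_eq_iff:
  assumes "U \<in> \<N>" "g \<in> carrier G" "x \<in> carrier G"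
  shows "U #> (g \<otimes> x) = U #> x \<longleftrightarrow> g \<in> U"
  using rcos_eq_iff[OF \<N>D(3)[OF assms(1)], of "g \<otimes> x" x] assms by (simp add: m_assoc)

text \<open>A power of g fixes one coset of the normal subgroup U only if it lies in U, and then it
  fixes all of them.\<close>

lemma free_cyclic_transl:
  assumes "U \<in> \<N>" "g \<in> carrier G" "\<Omega> \<subseteq> rcosets U" "\<And>D. D \<in> \<Omega> \<Longrightarrow> transl U g D \<in> \<Omega>"
  shows "free_cyclic \<Omega> (transl U g) (mord U g)"
proof
  show "finite \<Omega>" using finite_subset[OF assms(3) finite_rcosets[OF assms(1)]] .
  show "0 < mord U g" by (rule mord_pos[OF assms(1,2)])
  fix D assume "D \<in> \<Omega>"
  then have "D \<in> rcosets U" using assms(3) by blast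
  then obtain x where x: "x \<in> carrier G" "D = U #> x" by (rule rcosetsE)
  have key: "(transl U g ^^ i) D = D \<longleftrightarrow> mord U g dvd i" for i
    unfolding x(2) transl_pow[OF assms(1,2) x(1)] mord_dvd_iff[OF assms(1,2)]
    using rcos_mult_eq_iff[OF assms(1) _ x(1)] assms(2) by simp
  show "(transl U g ^^ mord U g) D = D" by (simp add: key)
  show "(transl U g ^^ i) D \<noteq> D" if "0 < i" "i < mord U g" for i
    using that nat_dvd_not_less by (simp add: key)
qed (rule assms(4))

section \<open>Measures invariant under a translation\<close>

text \<open>The orbits of \<open>g\<close> on \<open>G/V\<close> become arbitrarily divisible by \<open>p\<close> as \<open>V\<close> shrinks.\<close>

lemma invariant_imp_zero:
  assumes a: "a \<in> carrier \<Lambda>" and g: "g \<in> carrier G"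
    and inv: "\<And>U x. U \<in> \<N> \<Longrightarrow> L \<subseteq> U \<Longrightarrow> x \<in> carrier G \<Longrightarrow> a U (U #> (inv g \<otimes> x)) m = a U (U #> x) m"
    and sep: "\<And>n::nat. n > 0 \<Longrightarrow> \<exists>V\<in>\<N>. L \<subseteq> V \<and> g [^] n \<notin> V"
    and tor: "\<And>V. V \<in> \<N> \<Longrightarrow> \<exists>j::nat. g [^] (p ^ j) \<in> V"
    and U: "U \<in> \<N>" "L \<subseteq> U" "C \<in> rcosets U"
  shows "a U C m = 0"
proof -
  obtain x where x: "x \<in> carrier G" "C = U #> x" using U(3) by (rule rcosetsE)
  have Us: "subgroup U G" by (rule \<N>D(3)[OF U(1)])
  obtain j :: nat where j: "g [^] (p ^ j) \<in> U" using tor[OF U(1)] by blast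
  \<comment> \<open>A power of g inside U is used, because its translation permutes the cosets of V
    that lie in C.\<close>
  define g0 where "g0 = g [^] (p ^ j)"
  have g0: "g0 \<in> carrier G" "g0 \<in> U" using g j by (auto simp: g0_def)
  have g0_pow: "g0 [^] (k::nat) = g [^] (p ^ j * k)" for k using g by (simp add: g0_def nat_pow_pow)
  \<comment> \<open>Chosen so that g0^(p^m) lies outside V. The order of g0 modulo V is a power of p
    by \<open>tor\<close>, hence divisible by p^m, and so are the orbit lengths. V has to contain L,
    as invariance is assumed only at such levels.\<close>
  obtain V1 where V1: "V1 \<in> \<N>" "L \<subseteq> V1" "g [^] (p ^ j * p ^ m) \<notin> V1"
    using sep[of "p ^ j * p ^ m"] p_pos by auto
  define V where "V = V1 \<inter> U"
  have V: "V \<in> \<N>" "L \<subseteq> V" "V \<subseteq> U" using \<N>_inter V1 U by (auto simp: V_def)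
  have Vs: "subgroup V G" by (rule \<N>D(3)[OF V(1)])
  obtain i :: nat where i: "g [^] (p ^ i) \<in> V" using tor[OF V(1)] by blast
  have "g0 [^] (p ^ i) = (g [^] (p ^ i)) [^] (p ^ j)" unfolding g0_pow using g by (simp add: nat_pow_pow mult.commute)
  also have "\<dots> \<in> V" using subgroup_int_pow_closed[OF Vs i, of "int (p ^ j)"] by (simp only: int_pow_int)
  finally have "mord V g0 dvd p ^ i" using mord_dvd_iff[OF V(1) g0(1)] by simp
  then obtain l where l: "mord V g0 = p ^ l" using divides_primepow_nat[OF prime] by blast
  have "l > m"
  proof (rule ccontr)
    assume "\<not> l > m"
    then have "mord V g0 dvd p ^ m" unfolding l by (simp add: le_imp_power_dvd)
    then have "g0 [^] (p ^ m) \<in> V" using mord_dvd_iff[OF V(1) g0(1)] by simp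
    then show False using V1(3) unfolding g0_pow V_def by simp
  qed
  then have dvd: "int p ^ m dvd int (mord V g0)" unfolding l by (simp add: le_imp_power_dvd)
  have step: "a V (V #> (g [^] k \<otimes> y)) m = a V (V #> y) m" if y: "y \<in> carrier G" for k :: nat and y
  proof (induction k)
    case (Suc k)
    have "g [^] Suc k \<otimes> y = g \<otimes> (g [^] k \<otimes> y)"
      using g y nat_pow_Suc2[OF g, of k] by (simp add: m_assoc)
    moreover have "inv g \<otimes> (g \<otimes> (g [^] k \<otimes> y)) = g [^] k \<otimes> y"
      using g y by (simp flip: m_assoc)
    ultimately have "a V (V #> (g [^] Suc k \<otimes> y)) m = a V (V #> (g [^] k \<otimes> y)) m"
      using inv[OF V(1,2), of "g \<otimes> (g [^] k \<otimes> y)"] g y by simp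
    then show ?case using Suc by simp
  qed (use y in simp)
  define \<Omega> where "\<Omega> = {D \<in> rcosets V. D \<subseteq> C}"
  have \<Omega>E: "\<exists>y\<in>carrier G. D = V #> y \<and> y \<in> C" if D: "D \<in> \<Omega>" for D
  proof -
    obtain y where y: "y \<in> carrier G" "D = V #> y" using D by (auto simp: \<Omega>_def RCOSETS_def)
    then have "y \<in> C" using D rcos_self[OF y(1) Vs] by (auto simp: \<Omega>_def)
    then show ?thesis using y by blast
  qed
  have stab: "transl V g0 D \<in> \<Omega>" if D: "D \<in> \<Omega>" for D
  proof -
    obtain y where y: "y \<in> carrier G" "D = V #> y" "y \<in> C" using \<Omega>E[OF D] by blast
    have "C = U #> y" using mem_rcos_iff[OF Us y(1) U(3)] y(3) by simp
    then have "g0 \<otimes> y \<in> C" using g0(2) by (auto simp: r_coset_def)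
    then have "V #> (g0 \<otimes> y) \<subseteq> C"
      unfolding x(2) using rcos_subset_iff[OF Vs Us V(3) _ x(1)] g0(1) y(1) by simp
    then show ?thesis using transl_rcos[OF V(1) g0(1) y(1)] y g0(1) rcosets_I by (simp add: \<Omega>_def)
  qed
  have "int (mord V g0) dvd (\<Sum>D\<in>\<Omega>. a V D m)"
  proof (rule free_cyclic_dvd_sum[OF free_cyclic_transl[OF V(1) g0(1) _ stab]])
    fix D assume D: "D \<in> \<Omega>"
    obtain y where y: "y \<in> carrier G" "D = V #> y" using \<Omega>E[OF D] by blast
    show "a V (transl V g0 D) m = a V D m"
      unfolding y(2) transl_rcos[OF V(1) g0(1) y(1)] unfolding g0_def by (rule step[OF y(1)])
  qed (auto simp: \<Omega>_def)
  then have "int p ^ m dvd (\<Sum>D\<in>\<Omega>. a V D m)" using dvd dvd_trans by blast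
  then show ?thesis using \<Lambda>_coherent[OF a V(1) U(1) V(3) U(3), of m] by (simp add: \<Omega>_def mod_eq_0_iff_dvd)
qed

section \<open>The ideal generated by \<open>\<kappa> - 1\<close> and an integer\<close>

text \<open>Modulo U every element of K is a power of \<kappa>. The cosets of U inside KUx therefore
  form a single orbit of \<kappa>, and coherence between U and KU becomes a sum over this
  orbit.\<close>

lemma orbit_sum:
  assumes "a \<in> carrier \<Lambda>" "U \<in> \<N>" "K \<lhd> G" "\<kappa> \<in> K" "x \<in> carrier G"
    and gen: "\<And>k. k \<in> K \<Longrightarrow> \<exists>i::nat. U #> k = U #> (\<kappa> [^] i)"
  shows "a (K <#> U) ((K <#> U) #> x) n = (\<Sum>i<mord U \<kappa>. a U (U #> (\<kappa> [^] i \<otimes> x)) n) mod int p ^ n"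
proof -
  let ?W = "K <#> U"
  have W: "?W \<in> \<N>" by (rule \<N>_set_mult[OF assms(3,2)])
  have Ks: "subgroup K G" using assms(3) normal_imp_subgroup by blast
  have Us: "subgroup U G" by (rule \<N>D(3)[OF assms(2)])
  have Ws: "subgroup ?W G" by (rule \<N>D(3)[OF W])
  have UW: "U \<subseteq> ?W" and KW: "K \<subseteq> ?W" using set_mult_subset[OF Ks Us] by auto
  have \<kappa>: "\<kappa> \<in> carrier G" using subgroup.mem_carrier[OF Ks assms(4)] .
  interpret U: normal U G by (rule \<N>D(1)[OF assms(2)])
  interpret fc: free_cyclic "rcosets U" "transl U \<kappa>" "mord U \<kappa>"
  proof (rule free_cyclic_transl[OF assms(2) \<kappa> subset_refl])
    fix D assume "D \<in> rcosets U"
    then obtain y where "y \<in> carrier G" "D = U #> y" by (rule rcosetsE)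
    then show "transl U \<kappa> D \<in> rcosets U" using transl_rcos[OF assms(2) \<kappa>] \<kappa> rcosets_I by simp
  qed
  have "{D \<in> rcosets U. D \<subseteq> ?W #> x} = fc.orb (U #> x)"
  proof
    show "{D \<in> rcosets U. D \<subseteq> ?W #> x} \<subseteq> fc.orb (U #> x)"
    proof
      fix D assume D: "D \<in> {D \<in> rcosets U. D \<subseteq> ?W #> x}"
      then obtain y where y: "y \<in> carrier G" "D = U #> y" by (auto simp: RCOSETS_def)
      have "y \<in> ?W #> x" using D y rcos_self[OF y(1) Us] by auto
      then obtain k u where ku: "k \<in> K" "u \<in> U" "y = k \<otimes> u \<otimes> x" by (auto simp: r_coset_def set_mult_mem)
      have c: "k \<in> carrier G" "u \<in> carrier G"
        using ku subgroup.mem_carrier[OF Ks] subgroup.mem_carrier[OF Us] by auto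
      obtain i0 :: nat where i0: "U #> k = U #> (\<kappa> [^] i0)" using gen[OF ku(1)] by blast
      have uU: "U #> u = U" using rcos_eq_self_iff[OF assms(2) c(2)] ku(2) by simp
      have "U #> y = (U #> k) <#> (U #> u) <#> (U #> x)"
        using c assms(5) by (simp add: ku(3) U.rcos_sum)
      also have "(U #> k) <#> (U #> u) = (U #> (\<kappa> [^] i0)) <#> (U #> \<one>)"
        unfolding i0 uU using subgroup.subset[OF Us] by simp
      also have "(U #> (\<kappa> [^] i0)) <#> (U #> \<one>) <#> (U #> x) = U #> (\<kappa> [^] i0 \<otimes> x)"
        using \<kappa> assms(5) by (simp add: U.rcos_sum)
      also have "\<dots> = (transl U \<kappa> ^^ i0) (U #> x)" using transl_pow[OF assms(2) \<kappa> assms(5)] by simp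
      also have "\<dots> = (transl U \<kappa> ^^ (i0 mod mord U \<kappa>)) (U #> x)"
        using fc.period[OF rcosets_I[OF assms(5)]] by (rule funpow_mod_eq[symmetric])
      finally show "D \<in> fc.orb (U #> x)" unfolding fc.orb_def y(2) using mord_pos[OF assms(2) \<kappa>] by simp
    qed
    show "fc.orb (U #> x) \<subseteq> {D \<in> rcosets U. D \<subseteq> ?W #> x}"
    proof
      fix D assume "D \<in> fc.orb (U #> x)"
      then have "\<exists>i::nat. D = U #> (\<kappa> [^] i \<otimes> x)"
        unfolding fc.orb_def transl_pow[OF assms(2) \<kappa> assms(5)] by blast
      then obtain i :: nat where D: "D = U #> (\<kappa> [^] i \<otimes> x)" by blast
      have "\<kappa> [^] i \<in> ?W"
        using KW subgroup_int_pow_closed[OF Ks assms(4), of "int i"] by (auto simp: int_pow_int)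
      then have "\<kappa> [^] i \<otimes> x \<in> ?W #> x" by (auto simp: r_coset_def)
      then show "D \<in> {D \<in> rcosets U. D \<subseteq> ?W #> x}"
        unfolding D using rcos_subset_iff[OF Us Ws UW _ assms(5)] \<kappa> assms(5) rcosets_I by simp
    qed
  qed
  then show ?thesis
    using \<Lambda>_coherent[OF assms(1,2) W UW rcosets_I[OF assms(5)], of n]
      fc.sum_orb[OF rcosets_I[OF assms(5)], of "\<lambda>D. a U D n"] transl_pow[OF assms(2) \<kappa> assms(5)] by simp
qed

text \<open>The values of a at level KU are its orbit sums under \<kappa> at level U. By
  \<open>div\<close> they are multiples of e, which is the solvability criterion of
  \<open>free_cyclic_solve\<close>.\<close>

lemma solve_finite_level:
  assumes "a \<in> carrier \<Lambda>" "K \<lhd> G" "\<kappa> \<in> K" "U \<in> \<N>"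
    and gen: "\<And>k. k \<in> K \<Longrightarrow> \<exists>i::nat. U #> k = U #> (\<kappa> [^] i)"
    and div: "\<And>C. C \<in> rcosets (K <#> U) \<Longrightarrow> \<exists>z. a (K <#> U) C n = (e * z) mod int p ^ n"
  shows "\<exists>b c. \<forall>x\<in>carrier G. a U (U #> x) n =
    (b (U #> (inv \<kappa> \<otimes> x)) - b (U #> x) + e * c (U #> x)) mod int p ^ n"
proof -
  have Ks: "subgroup K G" using assms(2) normal_imp_subgroup by blast
  have \<kappa>: "\<kappa> \<in> carrier G" using subgroup.mem_carrier[OF Ks assms(3)] .
  have fc: "free_cyclic (rcosets U) (transl U \<kappa>) (mord U \<kappa>)"
  proof (rule free_cyclic_transl[OF assms(4) \<kappa> subset_refl])
    fix D assume "D \<in> rcosets U"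
    then obtain y where "y \<in> carrier G" "D = U #> y" by (rule rcosetsE)
    then show "transl U \<kappa> D \<in> rcosets U" using transl_rcos[OF assms(4) \<kappa>] \<kappa> rcosets_I by simp
  qed
  have "\<exists>b c. \<forall>D\<in>rcosets U. a U (transl U \<kappa> D) n mod int p ^ n =
      (b D - b (transl U \<kappa> D) + e * c (transl U \<kappa> D)) mod int p ^ n"
  proof (rule free_cyclic_solve[OF fc])
    fix D assume "D \<in> rcosets U"
    then obtain y where y: "y \<in> carrier G" "D = U #> y" by (rule rcosetsE)
    show "\<exists>z. (\<Sum>i<mord U \<kappa>. a U ((transl U \<kappa> ^^ i) D) n) mod int p ^ n = (e * z) mod int p ^ n"
      using div[OF rcosets_I[OF y(1)]] orbit_sum[OF assms(1,4,2,3) y(1) gen, of n]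
      unfolding y(2) transl_pow[OF assms(4) \<kappa> y(1)] by simp
  qed
  then obtain b c where bc: "\<And>D. D \<in> rcosets U \<Longrightarrow> a U (transl U \<kappa> D) n mod int p ^ n =
      (b D - b (transl U \<kappa> D) + e * c (transl U \<kappa> D)) mod int p ^ n" by blast
  have "a U (U #> x) n = (b (U #> (inv \<kappa> \<otimes> x)) - b (U #> x) + e * c (U #> x)) mod int p ^ n"
    if x: "x \<in> carrier G" for x
  proof -
    have y: "inv \<kappa> \<otimes> x \<in> carrier G" using x \<kappa> by simp
    have "transl U \<kappa> (U #> (inv \<kappa> \<otimes> x)) = U #> x"
      unfolding transl_rcos[OF assms(4) \<kappa> y] using x \<kappa> by (simp flip: m_assoc)
    then show ?thesis using bc[OF rcosets_I[OF y]] \<Lambda>_mod[OF assms(1,4) rcosets_I[OF x]] by simp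
  qed
  then show ?thesis by blast
qed

text \<open>The lift places the mass \<open>b D\<close> at a chosen representative of each coset
  D.\<close>

lemma lift_finite_level:
  assumes "U \<in> \<N>"
  shows "\<exists>b'\<in>carrier \<Lambda>. \<forall>D\<in>rcosets U. b' U D n = b D mod int p ^ n"
proof -
  define \<rho> where "\<rho> D = (SOME x. x \<in> carrier G \<and> D = U #> x)" for D
  have \<rho>: "\<rho> D \<in> carrier G \<and> D = U #> \<rho> D" if "D \<in> rcosets U" for D
    unfolding \<rho>_def by (rule someI_ex) (use that in \<open>auto simp: RCOSETS_def\<close>)
  have Us: "subgroup U G" by (rule \<N>D(3)[OF assms])
  let ?F = "\<rho> ` (rcosets U)"
  have F: "finite ?F" "?F \<subseteq> carrier G" using finite_rcosets[OF assms] \<rho> by auto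
  have inj: "inj_on \<rho> (rcosets U)" using \<rho> by (metis inj_onI)
  let ?b' = "atom ?F (\<lambda>g. b (U #> g))"
  have "?b' U D n = b D mod int p ^ n" if D: "D \<in> rcosets U" for D
  proof -
    have "(\<Sum>g\<in>?F. if g \<in> D then b (U #> g) else 0) = (\<Sum>D'\<in>rcosets U. if \<rho> D' \<in> D then b (U #> \<rho> D') else 0)"
      by (simp add: sum.reindex[OF inj])
    also have "\<dots> = (\<Sum>D'\<in>rcosets U. if D' = D then b D else 0)"
    proof (rule sum.cong[OF refl])
      fix D' assume D': "D' \<in> rcosets U"
      have "\<rho> D' \<in> D \<longleftrightarrow> D' = D" using mem_rcos_iff[OF Us _ D, of "\<rho> D'"] \<rho>[OF D'] by metis
      then show "(if \<rho> D' \<in> D then b (U #> \<rho> D') else 0) = (if D' = D then b D else 0)"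
        using \<rho>[OF D'] by metis
    qed
    also have "\<dots> = b D" using finite_rcosets[OF assms] D by simp
    finally show ?thesis using atom_value[OF assms D] by simp
  qed
  then show ?thesis using atom_closed[OF F] by blast
qed

end

section \<open>From finite quotients to the Iwasawa algebra by compactness\<close>

lemma closedin_finitely_determined:
  fixes D :: "'i \<Rightarrow> 'b set" and I :: "'i set"
  assumes "finite F"
    and P: "\<And>y y'. (\<And>i. i \<in> F \<Longrightarrow> y i = y' i) \<Longrightarrow> P y \<Longrightarrow> P y'"
  defines "X \<equiv> product_topology (\<lambda>i. discrete_topology (D i)) I"
  shows "closedin X {y \<in> topspace X. P y}"
proof -
  have "openin X {y \<in> topspace X. \<not> P y}"
  proof (subst openin_subopen, intro ballI)
    fix y assume y: "y \<in> {y \<in> topspace X. \<not> P y}"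
    let ?B = "\<lambda>i. if i \<in> F then {y i} else D i"
    have yD: "y \<in> Pi\<^sub>E I D" using y by (simp add: X_def)
    have "openin X (Pi\<^sub>E I ?B)"
      unfolding X_def openin_PiE_gen
    proof (intro disjI2 conjI ballI)
      show "openin (discrete_topology (D i)) (?B i)" if "i \<in> I" for i
        using yD that by (auto simp: PiE_iff)
      have "{i \<in> I. ?B i \<noteq> topspace (discrete_topology (D i))} \<subseteq> F" by auto
      then show "finite {i \<in> I. ?B i \<noteq> topspace (discrete_topology (D i))}"
        using assms(1) by (rule finite_subset)
    qed
    moreover have "y \<in> Pi\<^sub>E I ?B" using yD by (auto simp: PiE_iff)
    moreover have "Pi\<^sub>E I ?B \<subseteq> {y \<in> topspace X. \<not> P y}"
    proof
      fix z assume z: "z \<in> Pi\<^sub>E I ?B"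
      have zD: "z \<in> Pi\<^sub>E I D" using z yD by (auto simp: PiE_iff split: if_splits)
      have "z i = y i" if "i \<in> F" for i
        using z yD that by (cases "i \<in> I") (auto simp: PiE_iff extensional_def)
      then have "\<not> P z" using P[of z y] y by auto
      then show "z \<in> {y \<in> topspace X. \<not> P y}" using zD by (simp add: X_def)
    qed
    ultimately show "\<exists>V. openin X V \<and> y \<in> V \<and> V \<subseteq> {y \<in> topspace X. \<not> P y}" by blast
  qed
  moreover have "topspace X - {y \<in> topspace X. P y} = {y \<in> topspace X. \<not> P y}" by blast
  ultimately show ?thesis unfolding closedin_def by auto
qed

lemma closedin_Collect_all':
  assumes "\<And>i. closedin X {y \<in> topspace X. P i y}"
  shows "closedin X {y \<in> topspace X. \<forall>i. P i y}"
proof -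
  have "{y \<in> topspace X. \<forall>i. P i y} = (\<Inter>i. {y \<in> topspace X. P i y})" by auto
  also have "closedin X \<dots>" using assms by (intro closedin_INT) auto
  finally show ?thesis .
qed

lemma closedin_Collect_imp':
  assumes "Q \<Longrightarrow> closedin X {y \<in> topspace X. P y}"
  shows "closedin X {y \<in> topspace X. Q \<longrightarrow> P y}"
  using assms by (cases Q) auto

lemma closedin_Collect_conj':
  assumes "closedin X {y \<in> topspace X. P y}" "closedin X {y \<in> topspace X. Q y}"
  shows "closedin X {y \<in> topspace X. P y \<and> Q y}"
proof -
  have "{y \<in> topspace X. P y \<and> Q y} = {y \<in> topspace X. P y} \<inter> {y \<in> topspace X. Q y}" by blast
  then show ?thesis using closedin_Int[OF assms] by simp
qed

context iwasawa
begin

text \<open>Solvability on all finite quotients suffices, since the pairs \<open>(b, c)\<close> form a compact space.\<close>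

lemma solve_compact:
  assumes ring: "ring \<Lambda>" and a: "a \<in> carrier \<Lambda>" and \<kappa>: "\<kappa> \<in> carrier G"
    and fin: "\<And>U n. U \<in> \<N> \<Longrightarrow> \<exists>b\<in>carrier \<Lambda>. \<exists>c\<in>carrier \<Lambda>. \<forall>x\<in>carrier G.
      a U (U #> x) n = (b U (U #> (inv \<kappa> \<otimes> x)) n - b U (U #> x) n + int e * c U (U #> x) n) mod int p ^ n"
  shows "\<exists>b\<in>carrier \<Lambda>. \<exists>c\<in>carrier \<Lambda>. a = (\<delta> \<kappa> \<ominus>\<^bsub>\<Lambda>\<^esub> \<one>\<^bsub>\<Lambda>\<^esub>) \<otimes>\<^bsub>\<Lambda>\<^esub> b \<oplus>\<^bsub>\<Lambda>\<^esub> add_pow \<Lambda> e c"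
proof -
  interpret L: ring \<Lambda> by (rule ring)
  let ?w = "\<lambda>b c. (\<delta> \<kappa> \<ominus>\<^bsub>\<Lambda>\<^esub> \<one>\<^bsub>\<Lambda>\<^esub>) \<otimes>\<^bsub>\<Lambda>\<^esub> b \<oplus>\<^bsub>\<Lambda>\<^esub> add_pow \<Lambda> e c"
  have w_closed: "?w b c \<in> carrier \<Lambda>" if "b \<in> carrier \<Lambda>" "c \<in> carrier \<Lambda>" for b c
    using that \<kappa> by simp
  have w: "?w b c U (U #> x) n =
      (b U (U #> (inv \<kappa> \<otimes> x)) n - b U (U #> x) n + int e * c U (U #> x) n) mod int p ^ n"
    if "b \<in> carrier \<Lambda>" "c \<in> carrier \<Lambda>" "U \<in> \<N>" "x \<in> carrier G" for b c U x n
    using add_\<Lambda>[OF that(3) rcosets_I[OF that(4)]] \<delta>_minus_one_mult[OF ring that(1,3) \<kappa> that(4)]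
      add_pow_\<Lambda>[OF ring that(2,3) rcosets_I[OF that(4)]] by (simp add: mod_add_eq)
  have agree: "a U C n = v U C n"
    if v: "v \<in> carrier \<Lambda>" and U: "U0 \<in> \<N>" "U \<in> \<N>" "U0 \<subseteq> U" "n \<le> n0" "C \<in> rcosets U"
      and eq: "\<And>C. C \<in> rcosets U0 \<Longrightarrow> a U0 C n0 = v U0 C n0" for v U0 U n n0 C
  proof -
    have "a U0 D n = v U0 D n" if D: "D \<in> rcosets U0" for D
      using Zp_mod_le[OF \<Lambda>_value[OF a U(1) D] U(4)] Zp_mod_le[OF \<Lambda>_value[OF v U(1) D] U(4)] eq[OF D] by simp
    then show ?thesis
      unfolding \<Lambda>_coherent[OF a U(1,2,3,5)] \<Lambda>_coherent[OF v U(1,2,3,5)] by simp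
  qed
  \<comment> \<open>A point of the product records both unknowns at once, b under
    \<open>True\<close> and c under \<open>False\<close>. Each coordinate ranges over the finitely
    many residues modulo p^n, so the product is compact by Tychonoff.\<close>
  define I where "I = {(s :: bool, U, C, n :: nat). U \<in> \<N> \<and> C \<in> rcosets U}"
  define D where "D = (\<lambda>(s :: bool, U :: 'a set, C :: 'a set, n). {0..<int p ^ n})"
  define X where "X = product_topology (\<lambda>i. discrete_topology (D i)) I"
  define fam where "fam y s = (\<lambda>U\<in>\<N>. \<lambda>C\<in>rcosets U. \<lambda>n. y (s, U, C, n))"
    for y :: "bool \<times> 'a set \<times> 'a set \<times> nat \<Rightarrow> int" and s
  have fam_value: "fam y s U C n = y (s, U, C, n)" if "U \<in> \<N>" "C \<in> rcosets U" for y s U C n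
    using that by (simp add: fam_def)
  have "compact_space X" unfolding X_def
  proof (rule iffD2[OF compact_space_product_topology], rule disjI2, rule ballI)
    fix i assume "i \<in> I"
    then show "compact_space (discrete_topology (D i))"
      by (auto simp: compact_space_discrete_topology D_def split: prod.splits)
  qed
  let ?red = "\<lambda>s U C n y. y (s, U, C, Suc n) mod int p ^ n = y (s, U, C, n)"
  let ?coh = "\<lambda>s U V C n y. y (s, V, C, n) = (\<Sum>D\<in>{D \<in> rcosets U. D \<subseteq> C}. y (s, U, D, n)) mod int p ^ n"
  \<comment> \<open>Coherence in n and in U. Each single instance involves finitely many coordinates
    and is thus a closed condition; a \<open>good\<close> point of X is a pair of elements of
    \<Lambda>.\<close>
  define good where "good y \<longleftrightarrow>
      (\<forall>s U C n. U \<in> \<N> \<and> C \<in> rcosets U \<longrightarrow> ?red s U C n y) \<and>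
      (\<forall>s U V C n. U \<in> \<N> \<and> V \<in> \<N> \<and> U \<subseteq> V \<and> C \<in> rcosets V \<longrightarrow> ?coh s U V C n y)"
    for y :: "bool \<times> 'a set \<times> 'a set \<times> nat \<Rightarrow> int"
  have fam_closed: "fam y s \<in> carrier \<Lambda>" if y: "y \<in> topspace X" and g: "good y" for y s
  proof (rule \<Lambda>I)
    fix U C assume U: "U \<in> \<N>" "C \<in> rcosets U"
    then have "y (s, U, C, n) \<in> {0..<int p ^ n}" for n
      using y by (auto simp: X_def PiE_iff I_def D_def)
    then show "fam y s U C \<in> carrier (Zp p)"
      using g U by (auto simp: Zp_carrier fam_value good_def)
  next
    fix U V C :: "'a set" and n :: nat assume U: "U \<in> \<N>" "V \<in> \<N>" "U \<subseteq> V" "C \<in> rcosets V"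
    then have "?coh s U V C n y" using g unfolding good_def by blast
    then show "fam y s V C n = (\<Sum>D\<in>{D \<in> rcosets U. D \<subseteq> C}. fam y s U D n) mod int p ^ n"
      using U by (simp add: fam_value)
  qed (auto simp: fam_def)
  let ?eq = "\<lambda>U x n y. a U (U #> x) n =
      (y (True, U, U #> (inv \<kappa> \<otimes> x), n) - y (True, U, U #> x, n) + int e * y (False, U, U #> x, n)) mod int p ^ n"
  define S where "S U n = {y \<in> topspace X. good y \<and> (\<forall>x. x \<in> carrier G \<longrightarrow> ?eq U x n y)}" for U n
  have S_closed: "closedin X (S U n)" if U: "U \<in> \<N>" for U n
    unfolding S_def good_def
  proof (intro closedin_Collect_conj' closedin_Collect_all' closedin_Collect_imp')
    fix s :: bool and U C :: "'a set" and n :: nat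
    show "closedin X {y \<in> topspace X. ?red s U C n y}"
      unfolding X_def by (rule closedin_finitely_determined[where F = "{(s, U, C, Suc n), (s, U, C, n)}"]) auto
  next
    fix s :: bool and U V C :: "'a set" and n :: nat assume UV: "U \<in> \<N> \<and> V \<in> \<N> \<and> U \<subseteq> V \<and> C \<in> rcosets V"
    let ?F = "insert (s, V, C, n) ((\<lambda>D. (s, U, D, n)) ` {D \<in> rcosets U. D \<subseteq> C})"
    have F: "finite ?F" using UV finite_rcosets[of U] by simp
    show "closedin X {y \<in> topspace X. ?coh s U V C n y}"
      unfolding X_def
    proof (rule closedin_finitely_determined[OF F])
      fix y y' :: "bool \<times> 'a set \<times> 'a set \<times> nat \<Rightarrow> int"
      assume yy: "\<And>i. i \<in> ?F \<Longrightarrow> y i = y' i" and "?coh s U V C n y"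
      moreover have "(\<Sum>D\<in>{D \<in> rcosets U. D \<subseteq> C}. y (s, U, D, n)) = (\<Sum>D\<in>{D \<in> rcosets U. D \<subseteq> C}. y' (s, U, D, n))"
        by (rule sum.cong[OF refl]) (use yy in blast)
      ultimately show "?coh s U V C n y'" by simp
    qed
  next
    fix x
    let ?F = "{(True, U, U #> (inv \<kappa> \<otimes> x), n), (True, U, U #> x, n), (False, U, U #> x, n)}"
    show "closedin X {y \<in> topspace X. ?eq U x n y}"
      unfolding X_def by (rule closedin_finitely_determined[where F = ?F]) auto
  qed
  have S_iff: "y \<in> S U n \<longleftrightarrow> (\<forall>C\<in>rcosets U. a U C n = ?w (fam y True) (fam y False) U C n)"
    if y: "y \<in> topspace X" "good y" and U: "U \<in> \<N>" for y U n
  proof -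
    have "?w (fam y True) (fam y False) U (U #> x) n =
      (y (True, U, U #> (inv \<kappa> \<otimes> x), n) - y (True, U, U #> x, n) + int e * y (False, U, U #> x, n)) mod int p ^ n"
      if x: "x \<in> carrier G" for x
      unfolding w[OF fam_closed[OF y] fam_closed[OF y] U x]
      using fam_value[OF U rcosets_I] x \<kappa> by simp
    then show ?thesis using y by (auto simp: S_def RCOSETS_def)
  qed
  \<comment> \<open>A solution at a finer level and a higher precision is also one at every coarser
    level. The sets \<open>S U n\<close> are therefore directed downwards, and the finite
    intersection property reduces to a single one being nonempty.\<close>
  have S_mono: "S U0 n0 \<subseteq> S U n" if "U0 \<in> \<N>" "U \<in> \<N>" "U0 \<subseteq> U" "n \<le> n0" for U0 U n n0
  proof
    fix y assume y0: "y \<in> S U0 n0"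
    then have y: "y \<in> topspace X" "good y" by (auto simp: S_def)
    show "y \<in> S U n"
      unfolding S_iff[OF y that(2)]
      using agree[OF w_closed[OF fam_closed[OF y] fam_closed[OF y]] that] y0 S_iff[OF y that(1)] by blast
  qed
  have S_ne: "S U n \<noteq> {}" if U: "U \<in> \<N>" for U n
  proof -
    obtain b c where bc: "b \<in> carrier \<Lambda>" "c \<in> carrier \<Lambda>" and eq: "\<And>x. x \<in> carrier G \<Longrightarrow>
      a U (U #> x) n = (b U (U #> (inv \<kappa> \<otimes> x)) n - b U (U #> x) n + int e * c U (U #> x) n) mod int p ^ n"
      using fin[OF U, of n] by blast
    define y where "y = (\<lambda>i\<in>I. case i of (s, U, C, n) \<Rightarrow> (if s then b else c) U C n)"
    have yv: "y (s, U, C, n) = (if s then b else c) U C n" if "U \<in> \<N>" "C \<in> rcosets U" for s U C n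
      using that by (simp add: y_def I_def)
    have sc: "(if s then b else c) \<in> carrier \<Lambda>" for s using bc by simp
    have "y \<in> topspace X"
      using \<Lambda>_value[OF sc] by (auto simp: X_def PiE_iff y_def I_def D_def Zp_carrier split: if_splits)
    moreover have "good y"
      unfolding good_def
    proof (intro conjI allI impI)
      fix s :: bool and U C :: "'a set" and n :: nat assume "U \<in> \<N> \<and> C \<in> rcosets U"
      then show "?red s U C n y" using \<Lambda>_value[OF sc, of U C s] by (simp add: yv Zp_carrier)
    next
      fix s :: bool and U V C :: "'a set" and n :: nat assume UV: "U \<in> \<N> \<and> V \<in> \<N> \<and> U \<subseteq> V \<and> C \<in> rcosets V"
      then have "(if s then b else c) V C n = (\<Sum>D\<in>{D \<in> rcosets U. D \<subseteq> C}. (if s then b else c) U D n) mod int p ^ n"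
        using \<Lambda>_coherent[OF sc] by blast
      also have "(\<Sum>D\<in>{D \<in> rcosets U. D \<subseteq> C}. (if s then b else c) U D n) = (\<Sum>D\<in>{D \<in> rcosets U. D \<subseteq> C}. y (s, U, D, n))"
        using UV by (intro sum.cong) (auto simp: yv)
      finally show "?coh s U V C n y" using UV by (simp add: yv)
    qed
    moreover have "?eq U x n y" if x: "x \<in> carrier G" for x
      using eq[OF x] U x \<kappa> rcosets_I by (simp add: yv)
    ultimately show ?thesis unfolding S_def by blast
  qed
  have "\<Inter>((\<lambda>(U, n). S U n) ` (\<N> \<times> UNIV)) \<noteq> {}"
  proof (rule iffD1[OF compact_space_fip \<open>compact_space X\<close>, rule_format], intro conjI ballI allI impI)
    fix Z assume "Z \<in> (\<lambda>(U, n). S U n) ` (\<N> \<times> UNIV)"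
    then show "closedin X Z" using S_closed by auto
  next
    fix F assume "finite F \<and> F \<subseteq> (\<lambda>(U, n). S U n) ` (\<N> \<times> UNIV)"
    then obtain Q where Q: "finite Q" "Q \<subseteq> \<N> \<times> (UNIV :: nat set)" "F = (\<lambda>(U, n). S U n) ` Q"
      using finite_subset_image by metis
    have "fst ` Q \<subseteq> \<N>" using Q(2) by auto
    then obtain U0 where U0: "U0 \<in> \<N>" "\<forall>V\<in>fst ` Q. U0 \<subseteq> V"
      using \<N>_Inter[OF finite_imageI[OF Q(1)], of fst] by blast
    obtain n0 where n0: "\<forall>n\<in>snd ` Q. n \<le> n0"
      using Q(1) finite_nat_set_iff_bounded_le[of "snd ` Q"] by auto
    have "S U0 n0 \<subseteq> \<Inter>F"
    proof
      fix y assume y: "y \<in> S U0 n0"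
      have "y \<in> S U n" if q: "(U, n) \<in> Q" for U n
      proof -
        have "U \<in> \<N>" "U0 \<subseteq> U" "n \<le> n0" using q Q(2) U0(2) n0 by force+
        then show ?thesis using S_mono[OF U0(1)] y by blast
      qed
      then show "y \<in> \<Inter>F" unfolding Q(3) by auto
    qed
    then show "\<Inter>F \<noteq> {}" using S_ne[OF U0(1)] by blast
  qed
  then obtain y where y: "\<And>U n. U \<in> \<N> \<Longrightarrow> y \<in> S U n" by force
  have yg: "y \<in> topspace X" "good y" using y[OF \<N>_carrier, of 0] by (auto simp: S_def)
  have bc: "fam y True \<in> carrier \<Lambda>" "fam y False \<in> carrier \<Lambda>" using fam_closed[OF yg] by auto
  have "a = ?w (fam y True) (fam y False)"
    by (rule \<Lambda>_eqI[OF a w_closed[OF bc]]) (use S_iff[OF yg] y in blast)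
  then show ?thesis using bc by blast
qed

end

section \<open>Ideals of the Iwasawa algebra\<close>

locale iwasawa_ring = iwasawa +
  assumes ring_\<Lambda>: "ring \<Lambda>"
begin

sublocale L: ring \<Lambda> by (rule ring_\<Lambda>)

definition om :: "'a \<Rightarrow> 'a completed" where "om g = \<delta> g \<ominus>\<^bsub>\<Lambda>\<^esub> \<one>\<^bsub>\<Lambda>\<^esub>"

lemma om_closed [simp]: "g \<in> carrier G \<Longrightarrow> om g \<in> carrier \<Lambda>"
  by (simp add: om_def)

lemma om_mult:
  "a \<in> carrier \<Lambda> \<Longrightarrow> U \<in> \<N> \<Longrightarrow> g \<in> carrier G \<Longrightarrow> x \<in> carrier G \<Longrightarrow>
    (om g \<otimes>\<^bsub>\<Lambda>\<^esub> a) U (U #> x) n = (a U (U #> (inv g \<otimes> x)) n - a U (U #> x) n) mod int p ^ n"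
  unfolding om_def by (rule \<delta>_minus_one_mult[OF ring_\<Lambda>])

lemma om_one: "om \<one> = \<zero>\<^bsub>\<Lambda>\<^esub>"
  unfolding om_def one_\<Lambda>[symmetric] by (simp add: L.r_right_minus_eq)

text \<open>The levels U \<supseteq> K see a only through G/K, and \<kappa> generates K modulo every
  open U. So \<open>div\<close> puts a into the kernel of the passage to G/K and modulo e, and this
  kernel is the right ideal generated by \<kappa> - 1 and e. Each finite level is solved with
  integers, the solutions are lifted to \<Lambda>, and \<open>solve_compact\<close> combines the
  levels. The case e = 0 describes (\<kappa> - 1)\<Lambda>.\<close>

lemma ideal_memI:
  assumes a: "a \<in> carrier \<Lambda>" and K: "K \<lhd> G" "\<kappa> \<in> K"
    and gen: "\<And>U k. U \<in> \<N> \<Longrightarrow> k \<in> K \<Longrightarrow> \<exists>i::nat. U #> k = U #> (\<kappa> [^] i)"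
    and div: "\<And>U C n. U \<in> \<N> \<Longrightarrow> K \<subseteq> U \<Longrightarrow> C \<in> rcosets U \<Longrightarrow> \<exists>z. a U C n = (int e * z) mod int p ^ n"
  shows "\<exists>b\<in>carrier \<Lambda>. \<exists>c\<in>carrier \<Lambda>. a = om \<kappa> \<otimes>\<^bsub>\<Lambda>\<^esub> b \<oplus>\<^bsub>\<Lambda>\<^esub> add_pow \<Lambda> e c"
  unfolding om_def
proof (rule solve_compact[OF ring_\<Lambda> a])
  have Ks: "subgroup K G" using K(1) normal_imp_subgroup by blast
  show \<kappa>: "\<kappa> \<in> carrier G" using subgroup.mem_carrier[OF Ks K(2)] .
  fix U n assume U: "U \<in> \<N>"
  have KU: "K <#> U \<in> \<N>" "K \<subseteq> K <#> U" using \<N>_set_mult[OF K(1) U] set_mult_subset(1)[OF Ks \<N>D(3)[OF U]] by auto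
  obtain b c where bc: "\<And>x. x \<in> carrier G \<Longrightarrow> a U (U #> x) n =
      (b (U #> (inv \<kappa> \<otimes> x)) - b (U #> x) + int e * c (U #> x)) mod int p ^ n"
    using solve_finite_level[OF a K U gen[OF U], of n "int e"] div[OF KU] by blast
  obtain b' where b': "b' \<in> carrier \<Lambda>" "\<And>D. D \<in> rcosets U \<Longrightarrow> b' U D n = b D mod int p ^ n"
    using lift_finite_level[OF U] by blast
  obtain c' where c': "c' \<in> carrier \<Lambda>" "\<And>D. D \<in> rcosets U \<Longrightarrow> c' U D n = c D mod int p ^ n"
    using lift_finite_level[OF U] by blast
  have "a U (U #> x) n = (b' U (U #> (inv \<kappa> \<otimes> x)) n - b' U (U #> x) n + int e * c' U (U #> x) n) mod int p ^ n"
    if x: "x \<in> carrier G" for x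
  proof -
    have v: "b' U (U #> x) n = b (U #> x) mod int p ^ n" "c' U (U #> x) n = c (U #> x) mod int p ^ n"
        "b' U (U #> (inv \<kappa> \<otimes> x)) n = b (U #> (inv \<kappa> \<otimes> x)) mod int p ^ n"
      using b'(2)[OF rcosets_I] c'(2)[OF rcosets_I] x \<kappa> by auto
    show ?thesis unfolding bc[OF x] v
      by (intro mod_add_cong mod_diff_cong mod_mult_cong refl) simp_all
  qed
  then show "\<exists>b\<in>carrier \<Lambda>. \<exists>c\<in>carrier \<Lambda>. \<forall>x\<in>carrier G.
      a U (U #> x) n = (b U (U #> (inv \<kappa> \<otimes> x)) n - b U (U #> x) n + int e * c U (U #> x) n) mod int p ^ n"
    using b'(1) c'(1) by blast
qed

lemma om_ideal_memI:
  assumes a: "a \<in> carrier \<Lambda>" and K: "K \<lhd> G" "\<kappa> \<in> K"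
    and gen: "\<And>U k. U \<in> \<N> \<Longrightarrow> k \<in> K \<Longrightarrow> \<exists>i::nat. U #> k = U #> (\<kappa> [^] i)"
    and z: "\<And>U C n. U \<in> \<N> \<Longrightarrow> K \<subseteq> U \<Longrightarrow> C \<in> rcosets U \<Longrightarrow> a U C n = 0"
  shows "\<exists>b\<in>carrier \<Lambda>. a = om \<kappa> \<otimes>\<^bsub>\<Lambda>\<^esub> b"
proof -
  have \<kappa>: "\<kappa> \<in> carrier G" using subgroup.mem_carrier[OF normal_imp_subgroup[OF K(1)] K(2)] .
  obtain b c where "b \<in> carrier \<Lambda>" "c \<in> carrier \<Lambda>" "a = om \<kappa> \<otimes>\<^bsub>\<Lambda>\<^esub> b \<oplus>\<^bsub>\<Lambda>\<^esub> add_pow \<Lambda> (0::nat) c"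
    using ideal_memI[OF a K gen, of 0] z by auto
  then show ?thesis using \<kappa> by (intro bexI[of _ b]) auto
qed

lemma om_p_ideal_memI:
  assumes a: "a \<in> carrier \<Lambda>" and K: "K \<lhd> G" "\<kappa> \<in> K"
    and gen: "\<And>U k. U \<in> \<N> \<Longrightarrow> k \<in> K \<Longrightarrow> \<exists>i::nat. U #> k = U #> (\<kappa> [^] i)"
    and z: "\<And>U C. U \<in> \<N> \<Longrightarrow> K \<subseteq> U \<Longrightarrow> C \<in> rcosets U \<Longrightarrow> a U C m = 0"
  shows "\<exists>b\<in>carrier \<Lambda>. \<exists>c\<in>carrier \<Lambda>. a = om \<kappa> \<otimes>\<^bsub>\<Lambda>\<^esub> b \<oplus>\<^bsub>\<Lambda>\<^esub> add_pow \<Lambda> (p ^ m) c"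
proof (rule ideal_memI[OF a K gen])
  fix U C n assume U: "U \<in> \<N>" "K \<subseteq> U" "C \<in> rcosets U"
  note v = \<Lambda>_value[OF a U(1,3)]
  show "\<exists>z. a U C n = (int (p ^ m) * z) mod int p ^ n"
  proof (cases "n \<le> m")
    case True
    then show ?thesis using Zp_mod_le[OF v True] z[OF U] by (intro exI[of _ 0]) simp
  next
    case False
    then have "int p ^ m dvd a U C n" using Zp_mod_le[OF v, of m n] z[OF U] by (simp add: mod_eq_0_iff_dvd)
    then obtain y where y: "a U C n = int p ^ m * y" by (rule dvdE)
    then show ?thesis using Zp_mod[OF v, of n] by (intro exI[of _ y]) simp
  qed
qed

lemma om_mult_vanish:
  assumes "b \<in> carrier \<Lambda>" "U \<in> \<N>" "g \<in> U" "C \<in> rcosets U"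
  shows "(om g \<otimes>\<^bsub>\<Lambda>\<^esub> b) U C n = 0"
proof -
  have Us: "subgroup U G" by (rule \<N>D(3)[OF assms(2)])
  have g: "g \<in> carrier G" using subgroup.mem_carrier[OF Us assms(3)] .
  obtain x where x: "x \<in> carrier G" "C = U #> x" using assms(4) by (rule rcosetsE)
  have "U #> (inv g \<otimes> x) = U #> x"
    using rcos_mult_eq_iff[OF assms(2) inv_closed[OF g] x(1)] subgroup.m_inv_closed[OF Us assms(3)] by simp
  then show ?thesis using om_mult[OF assms(1,2) g x(1)] x(2) by simp
qed

lemma mult_om_vanish:
  assumes "r \<in> carrier \<Lambda>" "U \<in> \<N>" "g \<in> U" "C \<in> rcosets U"
  shows "(r \<otimes>\<^bsub>\<Lambda>\<^esub> om g) U C n = 0"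
proof -
  have g: "g \<in> carrier G" using subgroup.mem_carrier[OF \<N>D(3)[OF assms(2)] assms(3)] .
  have z: "om g U D n = 0" if "D \<in> rcosets U" for D
    using om_mult_vanish[OF L.one_closed assms(2,3) that] g by simp
  obtain x where x: "x \<in> carrier G" "C = U #> x" using assms(4) by (rule rcosetsE)
  have "om g U (inv\<^bsub>G Mod U\<^esub> D \<otimes>\<^bsub>G Mod U\<^esub> (U #> x)) n = 0" if D: "D \<in> rcosets U" for D
  proof -
    obtain d where d: "d \<in> carrier G" "D = U #> d" using D by (rule rcosetsE)
    show ?thesis unfolding d(2) inv_mult_rcos[OF assms(2) d(1) x(1)] by (rule z) (use d x rcosets_I in simp)
  qed
  then show ?thesis using mult_\<Lambda>[OF assms(1) om_closed[OF g] assms(2) x(1)] x(2) by simp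
qed

text \<open>At every level containing K the element \<kappa> becomes 1, so r (\<kappa> - 1) vanishes
  there, and \<open>om_ideal_memI\<close> extracts the factor \<kappa> - 1 on the left.\<close>

lemma om_normal:
  assumes K: "K \<lhd> G" "\<kappa> \<in> K" and r: "r \<in> carrier \<Lambda>"
    and gen: "\<And>U k. U \<in> \<N> \<Longrightarrow> k \<in> K \<Longrightarrow> \<exists>i::nat. U #> k = U #> (\<kappa> [^] i)"
  shows "\<exists>r'\<in>carrier \<Lambda>. r \<otimes>\<^bsub>\<Lambda>\<^esub> om \<kappa> = om \<kappa> \<otimes>\<^bsub>\<Lambda>\<^esub> r'"
proof -
  have \<kappa>: "\<kappa> \<in> carrier G" using subgroup.mem_carrier[OF normal_imp_subgroup[OF K(1)] K(2)] .
  show ?thesis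
    by (rule om_ideal_memI[OF _ K gen]) (use mult_om_vanish[OF r] K(2) r \<kappa> in auto)
qed

text \<open>The direction from vanishing to divisibility is the ideal criterion for the trivial
  subgroup, where \<kappa> - 1 = 0.\<close>

lemma multiples_iff:
  assumes a: "a \<in> carrier \<Lambda>"
  shows "a \<in> multiples \<Lambda> (p ^ m) \<longleftrightarrow> (\<forall>U\<in>\<N>. \<forall>C\<in>rcosets U. a U C m = 0)"
proof
  assume "a \<in> multiples \<Lambda> (p ^ m)"
  then obtain b where "b \<in> carrier \<Lambda>" "a = add_pow \<Lambda> (p ^ m) b" by (auto simp: multiples_def)
  then show "\<forall>U\<in>\<N>. \<forall>C\<in>rcosets U. a U C m = 0" using add_pow_\<Lambda>[OF ring_\<Lambda>] by simp
next
  assume z: "\<forall>U\<in>\<N>. \<forall>C\<in>rcosets U. a U C m = 0"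
  have "\<exists>b\<in>carrier \<Lambda>. \<exists>c\<in>carrier \<Lambda>. a = om \<one> \<otimes>\<^bsub>\<Lambda>\<^esub> b \<oplus>\<^bsub>\<Lambda>\<^esub> add_pow \<Lambda> (p ^ m) c"
    by (rule om_p_ideal_memI[OF a, where K = "{\<one>}"])
       (use z in \<open>auto simp: normal_inv_iff triv_subgroup intro: exI[of _ "0::nat"]\<close>)
  then obtain b c where "b \<in> carrier \<Lambda>" "c \<in> carrier \<Lambda>" "a = add_pow \<Lambda> (p ^ m) c"
    by (auto simp: om_one)
  then show "a \<in> multiples \<Lambda> (p ^ m)" by (auto simp: multiples_def)
qed

lemma om_invariant:
  assumes a: "a \<in> carrier \<Lambda>" and g: "g \<in> carrier G" and U: "U \<in> \<N>" and x: "x \<in> carrier G"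
    and z: "(om g \<otimes>\<^bsub>\<Lambda>\<^esub> a) U (U #> x) m = 0"
  shows "a U (U #> (inv g \<otimes> x)) m = a U (U #> x) m"
proof -
  have "a U (U #> (inv g \<otimes> x)) m mod int p ^ m = a U (U #> x) m mod int p ^ m"
    using z om_mult[OF a U g x] by (simp add: mod_eq_dvd_iff mod_eq_0_iff_dvd)
  then show ?thesis using \<Lambda>_mod[OF a U rcosets_I] g x by simp
qed

text \<open>g - 1 is injective on \<Lambda>/p^m: if it kills a, then a modulo p^m is invariant under
  g, and \<open>invariant_imp_zero\<close> with L empty applies.\<close>

lemma om_cancel:
  assumes a: "a \<in> carrier \<Lambda>" and g: "g \<in> carrier G"
    and sep: "\<And>n::nat. n > 0 \<Longrightarrow> \<exists>V\<in>\<N>. g [^] n \<notin> V"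
    and tor: "\<And>V. V \<in> \<N> \<Longrightarrow> \<exists>j::nat. g [^] (p ^ j) \<in> V"
    and m: "om g \<otimes>\<^bsub>\<Lambda>\<^esub> a \<in> multiples \<Lambda> (p ^ m)"
  shows "a \<in> multiples \<Lambda> (p ^ m)"
proof -
  have z: "(om g \<otimes>\<^bsub>\<Lambda>\<^esub> a) U C m = 0" if "U \<in> \<N>" "C \<in> rcosets U" for U C
    using m multiples_iff[of "om g \<otimes>\<^bsub>\<Lambda>\<^esub> a" m] that a g by simp
  have "a U C m = 0" if U: "U \<in> \<N>" and C: "C \<in> rcosets U" for U C
  proof (rule invariant_imp_zero[OF a g _ _ tor U empty_subsetI C])
    show "\<exists>V\<in>\<N>. {} \<subseteq> V \<and> g [^] n \<notin> V" if "n > 0" for n :: nat using sep[OF that] by simp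
  qed (rule om_invariant[OF a g], auto intro: z rcosets_I)
  then show ?thesis using multiples_iff[OF a] by simp
qed

text \<open>The analogue on \<Lambda> modulo \<kappa> - 1 and p^m. This quotient is detected by the
  levels containing K, hence \<open>invariant_imp_zero\<close> is used with L = K, and
  \<open>om_p_ideal_memI\<close> turns vanishing at those levels back into membership in the
  ideal.\<close>

lemma om_cancel_mod:
  assumes a: "a \<in> carrier \<Lambda>" and g: "g \<in> carrier G" and K: "K \<lhd> G" "\<kappa> \<in> K"
    and gen: "\<And>U k. U \<in> \<N> \<Longrightarrow> k \<in> K \<Longrightarrow> \<exists>i::nat. U #> k = U #> (\<kappa> [^] i)"
    and sep: "\<And>n::nat. n > 0 \<Longrightarrow> \<exists>V\<in>\<N>. K \<subseteq> V \<and> g [^] n \<notin> V"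
    and tor: "\<And>V. V \<in> \<N> \<Longrightarrow> \<exists>j::nat. g [^] (p ^ j) \<in> V"
    and bc: "b \<in> carrier \<Lambda>" "c \<in> carrier \<Lambda>" "om g \<otimes>\<^bsub>\<Lambda>\<^esub> a = om \<kappa> \<otimes>\<^bsub>\<Lambda>\<^esub> b \<oplus>\<^bsub>\<Lambda>\<^esub> add_pow \<Lambda> (p ^ m) c"
  shows "\<exists>b\<in>carrier \<Lambda>. \<exists>c\<in>carrier \<Lambda>. a = om \<kappa> \<otimes>\<^bsub>\<Lambda>\<^esub> b \<oplus>\<^bsub>\<Lambda>\<^esub> add_pow \<Lambda> (p ^ m) c"
proof -
  have z: "(om g \<otimes>\<^bsub>\<Lambda>\<^esub> a) U C m = 0" if "U \<in> \<N>" "K \<subseteq> U" "C \<in> rcosets U" for U C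
    unfolding bc(3) add_\<Lambda>[OF that(1,3)] add_pow_\<Lambda>[OF ring_\<Lambda> bc(2) that(1,3)]
    using om_mult_vanish[OF bc(1) that(1) _ that(3)] that(2) K(2) by auto
  have "a U C m = 0" if U: "U \<in> \<N>" "K \<subseteq> U" "C \<in> rcosets U" for U C
    by (rule invariant_imp_zero[OF a g _ sep tor U]) (rule om_invariant[OF a g], auto intro: z rcosets_I)
  from om_p_ideal_memI[OF a K gen this] show ?thesis .
qed

end

section \<open>Iwasawa algebras of closed subgroups\<close>

text \<open>Each small set inside C lies in exactly one large set, and that one is inside C, so a
  sum over the small sets can be regrouped.\<close>

lemma sum_nested_sets:
  assumes "finite \<A>" "finite \<B>"
    and "\<And>A. A \<in> \<A> \<Longrightarrow> A \<subseteq> C \<Longrightarrow> \<exists>B\<in>\<B>. B \<subseteq> C \<and> A \<subseteq> B"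
    and "\<And>A B B'. A \<in> \<A> \<Longrightarrow> B \<in> \<B> \<Longrightarrow> B' \<in> \<B> \<Longrightarrow> A \<subseteq> B \<Longrightarrow> A \<subseteq> B' \<Longrightarrow> B = B'"
  shows "(\<Sum>B\<in>{B \<in> \<B>. B \<subseteq> C}. \<Sum>A\<in>{A \<in> \<A>. A \<subseteq> B}. f A) = (\<Sum>A\<in>{A \<in> \<A>. A \<subseteq> C}. f A)"
proof -
  have "{A \<in> \<A>. A \<subseteq> C} = (\<Union>B\<in>{B \<in> \<B>. B \<subseteq> C}. {A \<in> \<A>. A \<subseteq> B})"
    using assms(3) by fast
  also have "sum f \<dots> = (\<Sum>B\<in>{B \<in> \<B>. B \<subseteq> C}. \<Sum>A\<in>{A \<in> \<A>. A \<subseteq> B}. f A)"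
  proof (rule sum.UNION_disjoint)
    show "\<forall>i\<in>{B \<in> \<B>. B \<subseteq> C}. \<forall>j\<in>{B \<in> \<B>. B \<subseteq> C}. i \<noteq> j \<longrightarrow> {A \<in> \<A>. A \<subseteq> i} \<inter> {A \<in> \<A>. A \<subseteq> j} = {}"
    proof (intro ballI impI, rule ccontr)
      fix i j assume "i \<in> {B \<in> \<B>. B \<subseteq> C}" "j \<in> {B \<in> \<B>. B \<subseteq> C}" "i \<noteq> j"
        "{A \<in> \<A>. A \<subseteq> i} \<inter> {A \<in> \<A>. A \<subseteq> j} \<noteq> {}"
      then show False using assms(4)[of _ i j] by fastforce
    qed
  qed (use assms(1,2) in auto)
  finally show ?thesis by simp
qed

locale iwasawa_subgroup = iwasawa +
  fixes K assumes K: "subgroup K G" "closedin T K"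
begin

abbreviation GK where "GK \<equiv> G\<lparr>carrier := K\<rparr>"

lemma iwasawa_K: "iwasawa GK (subtopology T K) p"
  using closed_subgroup_compact_group[OF K] prime by (simp add: iwasawa_def iwasawa_axioms_def)

sublocale KI: iwasawa GK "subtopology T K" p
  by (rule iwasawa_K)

abbreviation emb where "emb \<equiv> Iwasawa_emb p G T K"

lemma Iwasawa_sub_eq: "Iwasawa_sub p G T K = KI.\<Lambda>"
  by (simp add: Iwasawa_sub_def)

lemma restrict_mem: "U \<in> \<N> \<Longrightarrow> U \<inter> K \<in> KI.\<N>"
  by (rule open_normal_restrict[OF K(1)])

lemma K_mem: "k \<in> K \<Longrightarrow> k \<in> carrier G"
  using subgroup.mem_carrier[OF K(1)] .

lemma rcosets_K: "rcosets\<^bsub>GK\<^esub> V = (\<lambda>k. V #> k) ` K"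
  by (auto simp: RCOSETS_def)

lemma sub_rcos_iff:
  assumes "U \<in> \<N>" "V \<in> \<N>" "U \<subseteq> V" "k \<in> K" "C \<in> rcosets V"
  shows "(U \<inter> K) #> k \<subseteq> C \<longleftrightarrow> k \<in> C"
proof -
  obtain x where x: "x \<in> carrier G" "C = V #> x" using assms(5) by (rule rcosetsE)
  show ?thesis unfolding x(2)
    by (rule rcos_subset_iff) (use assms K_mem x subgroups_Inter_pair[OF \<N>D(3) K(1)] \<N>D(3) in auto)
qed

lemma emb_value:
  assumes "x \<in> carrier KI.\<Lambda>" "U \<in> \<N>" "C \<in> rcosets U"
  shows "emb x U C n = (\<Sum>D\<in>{D \<in> rcosets\<^bsub>GK\<^esub> (U \<inter> K). D \<subseteq> C}. x (U \<inter> K) D n) mod int p ^ n"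
  using assms KI.finsum_Zp_coset_sum[OF restrict_mem[OF assms(2)], of "x (U \<inter> K)" C n]
    KI.\<Lambda>_value[OF assms(1) restrict_mem[OF assms(2)]]
  by (simp add: Iwasawa_emb_def push_cosets_def carrier_Mod KI.carrier_Mod)

text \<open>An embedded element is the pushforward of a measure along K \<rightarrow> G. For
  coherence between U and V the cosets of U \<inter> K inside C are grouped in two ways, by cosets
  of V \<inter> K and by cosets of U.\<close>

lemma emb_closed:
  assumes x: "x \<in> carrier KI.\<Lambda>"
  shows "emb x \<in> carrier \<Lambda>"
proof (rule \<Lambda>I)
  fix U V C n assume U: "U \<in> \<N>" and V: "V \<in> \<N>" and UV: "U \<subseteq> V" and C: "C \<in> rcosets V"
  have Us: "subgroup U G" and Vs: "subgroup V G" using U V \<N>D by blast+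
  let ?RU = "rcosets\<^bsub>GK\<^esub> (U \<inter> K)" and ?RV = "rcosets\<^bsub>GK\<^esub> (V \<inter> K)"
  have fU: "finite ?RU" and fV: "finite ?RV" using KI.finite_rcosets restrict_mem U V by blast+
  have UVK: "U \<inter> K \<subseteq> V \<inter> K" using UV by blast
  have "emb x V C n = (\<Sum>D\<in>{D \<in> ?RV. D \<subseteq> C}. (\<Sum>A\<in>{A \<in> ?RU. A \<subseteq> D}. x (U \<inter> K) A n) mod int p ^ n) mod int p ^ n"
    unfolding emb_value[OF x V C]
    by (intro arg_cong[where f = "\<lambda>z. z mod int p ^ n"] sum.cong refl
        KI.\<Lambda>_coherent[OF x restrict_mem[OF U] restrict_mem[OF V] UVK]) simp
  also have "\<dots> = (\<Sum>D\<in>{D \<in> ?RV. D \<subseteq> C}. \<Sum>A\<in>{A \<in> ?RU. A \<subseteq> D}. x (U \<inter> K) A n) mod int p ^ n"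
    by (rule mod_sum_eq)
  also have "(\<Sum>D\<in>{D \<in> ?RV. D \<subseteq> C}. \<Sum>A\<in>{A \<in> ?RU. A \<subseteq> D}. x (U \<inter> K) A n) =
      (\<Sum>A\<in>{A \<in> ?RU. A \<subseteq> C}. x (U \<inter> K) A n)"
  proof (rule sum_nested_sets[OF fU fV])
    fix A assume "A \<in> ?RU" "A \<subseteq> C"
    then obtain k where k: "k \<in> K" "A = (U \<inter> K) #> k" by (auto simp: rcosets_K)
    then have "k \<in> C" using sub_rcos_iff[OF U V UV k(1) C] \<open>A \<subseteq> C\<close> by simp
    then have "(V \<inter> K) #> k \<subseteq> C" using sub_rcos_iff[OF V V subset_refl k(1) C] by simp
    moreover have "A \<subseteq> (V \<inter> K) #> k" unfolding k(2) using UVK by (auto simp: r_coset_def)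
    ultimately show "\<exists>B\<in>?RV. B \<subseteq> C \<and> A \<subseteq> B" using k(1) unfolding rcosets_K by blast
  next
    fix A B B' assume A: "A \<in> ?RU" and B: "B \<in> ?RV" "B' \<in> ?RV" "A \<subseteq> B" "A \<subseteq> B'"
    then obtain k where k: "k \<in> K" "A = (U \<inter> K) #> k" by (auto simp: rcosets_K)
    have "k \<in> A" unfolding k(2) by (rule rcos_self[OF K_mem[OF k(1)] subgroups_Inter_pair[OF Us K(1)]])
    then show "B = B'" using KI.mem_rcos_iff[OF KI.\<N>D(3)[OF restrict_mem[OF V]], of k] B k(1) by auto
  qed
  also have "(\<Sum>A\<in>{A \<in> ?RU. A \<subseteq> C}. x (U \<inter> K) A n) =
      (\<Sum>D\<in>{D \<in> rcosets U. D \<subseteq> C}. \<Sum>A\<in>{A \<in> ?RU. A \<subseteq> D}. x (U \<inter> K) A n)"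
  proof (rule sum_nested_sets[OF fU finite_rcosets[OF U], symmetric])
    fix A assume "A \<in> ?RU" "A \<subseteq> C"
    then obtain k where k: "k \<in> K" "A = (U \<inter> K) #> k" by (auto simp: rcosets_K)
    then have "k \<in> C" using sub_rcos_iff[OF U V UV k(1) C] \<open>A \<subseteq> C\<close> by simp
    moreover obtain y where y: "y \<in> carrier G" "C = V #> y" using C by (rule rcosetsE)
    ultimately have "U #> k \<subseteq> C" using rcos_subset_iff[OF Us Vs UV K_mem[OF k(1)] y(1)] by simp
    moreover have "A \<subseteq> U #> k" unfolding k(2) by (auto simp: r_coset_def)
    ultimately show "\<exists>B\<in>rcosets U. B \<subseteq> C \<and> A \<subseteq> B" using rcosets_I[OF K_mem[OF k(1)]] by blast
  next
    fix A B B' assume A: "A \<in> ?RU" and B: "B \<in> rcosets U" "B' \<in> rcosets U" "A \<subseteq> B" "A \<subseteq> B'"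
    then obtain k where k: "k \<in> K" "A = (U \<inter> K) #> k" by (auto simp: rcosets_K)
    have "k \<in> A" unfolding k(2) by (rule rcos_self[OF K_mem[OF k(1)] subgroups_Inter_pair[OF Us K(1)]])
    then show "B = B'" using mem_rcos_iff[OF Us K_mem[OF k(1)]] B by auto
  qed
  also have "\<dots> mod int p ^ n = (\<Sum>D\<in>{D \<in> rcosets U. D \<subseteq> C}. (\<Sum>A\<in>{A \<in> ?RU. A \<subseteq> D}. x (U \<inter> K) A n) mod int p ^ n) mod int p ^ n"
    by (rule mod_sum_eq[symmetric])
  also have "\<dots> = (\<Sum>D\<in>{D \<in> rcosets U. D \<subseteq> C}. emb x U D n) mod int p ^ n"
    by (intro arg_cong[where f = "\<lambda>z. z mod int p ^ n"] sum.cong refl emb_value[OF x U, symmetric]) simp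
  finally show "emb x V C n = (\<Sum>D\<in>{D \<in> rcosets U. D \<subseteq> C}. emb x U D n) mod int p ^ n" .
next
  fix U C assume U: "U \<in> \<N>" "C \<in> rcosets U"
  have "finsum (Zp p) (x (U \<inter> K)) {D \<in> rcosets\<^bsub>GK\<^esub> (U \<inter> K). D \<subseteq> C} \<in> carrier (Zp p)"
    by (rule Zp_finsum_closed[OF p_pos]) (use KI.\<Lambda>_value[OF x restrict_mem[OF U(1)]] in simp)
  then show "emb x U C \<in> carrier (Zp p)"
    using U by (simp add: Iwasawa_emb_def push_cosets_def carrier_Mod KI.carrier_Mod)
qed (auto simp: Iwasawa_emb_def push_cosets_def carrier_Mod)

lemma emb_atom:
  assumes F: "finite F" "F \<subseteq> K"
  shows "emb (KI.atom F b) = atom F b"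
proof (rule \<Lambda>_eqI)
  have a: "KI.atom F b \<in> carrier KI.\<Lambda>" by (rule KI.atom_closed) (use F in auto)
  show "emb (KI.atom F b) \<in> carrier \<Lambda>" by (rule emb_closed[OF a])
  show "atom F b \<in> carrier \<Lambda>" by (rule atom_closed) (use F K_mem in auto)
  fix U C n assume U: "U \<in> \<N>" and C: "C \<in> rcosets U"
  let ?R = "{D \<in> rcosets\<^bsub>GK\<^esub> (U \<inter> K). D \<subseteq> C}"
  have fin: "finite ?R" using KI.finite_rcosets[OF restrict_mem[OF U]] by simp
  have "emb (KI.atom F b) U C n = (\<Sum>D\<in>?R. (\<Sum>g\<in>F. if g \<in> D then b g else 0) mod int p ^ n) mod int p ^ n"
    unfolding emb_value[OF a U C]
    by (intro arg_cong[where f = "\<lambda>z. z mod int p ^ n"] sum.cong refl KI.atom_value restrict_mem[OF U]) simp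
  also have "\<dots> = (\<Sum>D\<in>?R. \<Sum>g\<in>F. if g \<in> D then b g else 0) mod int p ^ n"
    by (rule mod_sum_eq)
  also have "(\<Sum>D\<in>?R. \<Sum>g\<in>F. if g \<in> D then b g else 0) = (\<Sum>g\<in>F. \<Sum>D\<in>?R. if g \<in> D then b g else 0)"
    by (rule sum.swap)
  also have "\<dots> = (\<Sum>g\<in>F. if g \<in> C then b g else 0)"
  proof (rule sum.cong[OF refl])
    fix g assume "g \<in> F"
    then have g: "g \<in> K" using F by blast
    have "(\<Sum>D\<in>?R. if g \<in> D then b g else 0) = (\<Sum>D\<in>?R. if D = (U \<inter> K) #> g then b g else 0)"
      using KI.mem_rcos_iff[OF KI.\<N>D(3)[OF restrict_mem[OF U]], of g] g by (intro sum.cong) auto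
    also have "\<dots> = (if (U \<inter> K) #> g \<in> ?R then b g else 0)"
      using fin by (rule sum.delta)
    also have "(U \<inter> K) #> g \<in> ?R \<longleftrightarrow> g \<in> C"
      using sub_rcos_iff[OF U U subset_refl g C] g by (auto simp: rcosets_K)
    finally show "(\<Sum>D\<in>?R. if g \<in> D then b g else 0) = (if g \<in> C then b g else 0)" .
  qed
  finally show "emb (KI.atom F b) U C n = atom F b U C n" using atom_value[OF U C] by simp
qed

text \<open>When U contains K, the only coset of U \<inter> K = K in K is K itself, and it lies in
  the coset U. Its mass \<open>x K K\<close> is the augmentation of x.\<close>

lemma emb_value_above:
  assumes x: "x \<in> carrier KI.\<Lambda>" and U: "U \<in> \<N>" "K \<subseteq> U" "C \<in> rcosets U"
  shows "emb x U C n = (if C = U then x K K n else 0)"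
proof -
  have UK: "U \<inter> K = K" using U(2) by blast
  have Us: "subgroup U G" by (rule \<N>D(3)[OF U(1)])
  have K_coset: "K #> k = K" if "k \<in> K" for k
    using coset_join2[OF K_mem[OF that] K(1) that] .
  have RK: "rcosets\<^bsub>GK\<^esub> K = {K}"
    using K_coset subgroup.one_closed[OF K(1)] unfolding rcosets_K by auto
  have one: "\<one> \<in> K" using subgroup.one_closed[OF K(1)] .
  have "K \<subseteq> C \<longleftrightarrow> C = U"
  proof
    assume "K \<subseteq> C"
    then have "\<one> \<in> C" using one by blast
    then show "C = U" using mem_rcos_iff[OF Us one_closed U(3)] coset_mult_one[OF subgroup.subset[OF Us]] by simp
  qed (use U in blast)
  then have R: "{D \<in> rcosets\<^bsub>GK\<^esub> (U \<inter> K). D \<subseteq> C} = (if C = U then {K} else {})"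
    unfolding UK RK by auto
  have "x K K n mod int p ^ n = x K K n"
    by (rule KI.\<Lambda>_mod[OF x]) (use restrict_mem[OF U(1)] UK RK in auto)
  then show ?thesis unfolding emb_value[OF x U(1,3)] R using UK by simp
qed

end

section \<open>Closed subgroups isomorphic to \<open>\<int>\<^sub>p\<close>\<close>

lemma Zp_nhd_zero:
  assumes "openin (Zp_top p) W" "(\<lambda>n. 0) \<in> W"
  shows "\<exists>j. \<forall>z\<in>carrier (Zp p). z j = 0 \<longrightarrow> z \<in> W"
proof -
  let ?D = "\<lambda>n. discrete_topology {0..<int p ^ n}"
  obtain W' where W': "openin (product_topology ?D UNIV) W'" "W = W' \<inter> carrier (Zp p)"
    using assms(1) by (auto simp: Zp_top_def openin_subtopology)
  have z: "(\<lambda>n. 0) \<in> W'" using W'(2) assms(2) by simp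
  obtain X where X: "finite {i \<in> UNIV. X i \<noteq> topspace (?D i)}" "(\<lambda>n. 0) \<in> Pi\<^sub>E UNIV X" "Pi\<^sub>E UNIV X \<subseteq> W'"
    using W'(1)[unfolded openin_product_topology_alt, rule_format, OF z] by (elim exE conjE)
  obtain j where j: "\<And>i. X i \<noteq> topspace (?D i) \<Longrightarrow> i \<le> j"
    using X(1) finite_nat_set_iff_bounded_le by auto
  have "z \<in> W" if zc: "z \<in> carrier (Zp p)" and zj: "z j = 0" for z
  proof -
    have "z i \<in> X i" for i
    proof (cases "X i = topspace (?D i)")
      case True
      then show ?thesis using zc by (simp add: Zp_carrier)
    next
      case False
      then have "z i = 0" using Zp_mod_le[OF zc j, of i] zj by simp
      then show ?thesis using X(2) by (simp add: PiE_iff)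
    qed
    then show ?thesis using X(3) W'(2) zc by (auto simp: PiE_iff)
  qed
  then show ?thesis by blast
qed

lemma Zp_divide:
  assumes "p > 0" "z \<in> carrier (Zp p)" "z m = 0"
  shows "\<exists>w\<in>carrier (Zp p). \<forall>n. z n = (int (p ^ m) * w n) mod int p ^ n"
proof
  \<comment> \<open>Division by p^m costs m digits of precision, so z is read m levels
    higher.\<close>
  let ?w = "\<lambda>n. z (n + m) div int p ^ m"
  have dvd: "int p ^ m dvd z (n + m)" for n
    using Zp_mod_le[OF assms(2), of m "n + m"] assms(3) by (simp add: mod_eq_0_iff_dvd)
  have bnd: "0 \<le> z n \<and> z n < int p ^ n \<and> z (Suc n) mod int p ^ n = z n" for n
    using assms(2) by (simp add: Zp_carrier)
  have pm: "int p ^ m > 0" using assms(1) by simp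
  show "?w \<in> carrier (Zp p)"
    unfolding Zp_carrier
  proof (intro allI conjI)
    fix n
    show "0 \<le> ?w n" using bnd[of "n + m"] pm by (simp add: pos_imp_zdiv_nonneg_iff)
    have "int p ^ m * ?w n < int p ^ m * int p ^ n"
      using bnd[of "n + m"] dvd[of n] by (simp add: power_add mult.commute)
    then show "?w n < int p ^ n" using pm by simp
    have "int p ^ m * (?w (Suc n) mod int p ^ n) = z (Suc n + m) mod (int p ^ m * int p ^ n)"
      using dvd[of "Suc n"] by (simp add: mult_mod_right)
    also have "\<dots> = z (n + m)" using bnd[of "n + m"] by (simp add: power_add mult.commute)
    also have "\<dots> = int p ^ m * ?w n" using dvd[of n] by simp
    finally show "?w (Suc n) mod int p ^ n = ?w n"
      using pm mult_left_cancel[of "int p ^ m"] by (metis less_irrefl)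
  qed
  show "\<forall>n. z n = (int (p ^ m) * ?w n) mod int p ^ n"
    using dvd Zp_mod_le[OF assms(2)] by simp
qed

locale zp_subgroup = iwasawa_subgroup +
  fixes f
  assumes f_iso: "f \<in> iso (G\<lparr>carrier := K\<rparr>) (add_monoid (Zp p))"
    and f_homeo: "homeomorphic_map (subtopology T K) (Zp_top p) f"
begin

lemma f_closed: "k \<in> K \<Longrightarrow> f k \<in> carrier (Zp p)"
  using f_iso by (auto simp: iso_def hom_def)

lemma f_mult: "k \<in> K \<Longrightarrow> l \<in> K \<Longrightarrow> f (k \<otimes> l) n = (f k n + f l n) mod int p ^ n"
  using f_iso by (auto simp: iso_def hom_def Zp_sel)

lemma f_bij: "bij_betw f K (carrier (Zp p))"
  using f_iso by (simp add: iso_def)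

lemma K_one: "\<one> \<in> K"
  using subgroup.one_closed[OF K(1)] .

lemma K_pow: "k \<in> K \<Longrightarrow> k [^] (n::nat) \<in> K"
  using subgroup_int_pow_closed[OF K(1), of k "int n"] by (simp add: int_pow_int)

lemma K_mult: "k \<in> K \<Longrightarrow> l \<in> K \<Longrightarrow> k \<otimes> l \<in> K"
  using subgroup.m_closed[OF K(1)] .

lemma K_inv: "k \<in> K \<Longrightarrow> inv k \<in> K"
  using subgroup.m_inv_closed[OF K(1)] .

lemma f_one: "f \<one> n = 0"
proof -
  have "(f \<one> n + f \<one> n) mod int p ^ n = f \<one> n" using f_mult[OF K_one K_one, of n] by simp
  then have "(f \<one> n + f \<one> n) mod int p ^ n = (f \<one> n + 0) mod int p ^ n"
    using Zp_mod[OF f_closed[OF K_one], of n] by simp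
  then have "f \<one> n mod int p ^ n = 0" by (simp add: mod_eq_dvd_iff mod_eq_0_iff_dvd)
  then show ?thesis using Zp_mod[OF f_closed[OF K_one]] by simp
qed

lemma f_pow: "k \<in> K \<Longrightarrow> f (k [^] (n::nat)) m = (int n * f k m) mod int p ^ m"
proof (induction n)
  case (Suc n)
  then show ?case using f_mult[OF K_pow[of k n], of k m]
    by (simp add: mod_add_left_eq mod_add_right_eq algebra_simps)
qed (simp add: f_one)

lemma f_inv: "k \<in> K \<Longrightarrow> f (inv k) n = (- f k n) mod int p ^ n"
proof -
  assume k: "k \<in> K"
  have "(f (inv k) n + f k n) mod int p ^ n = 0"
    using f_mult[OF K_inv[OF k] k, of n] K_mem[OF k] f_one by simp
  then have "f (inv k) n mod int p ^ n = (- f k n) mod int p ^ n"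
    by (simp add: mod_eq_dvd_iff mod_eq_0_iff_dvd)
  then show ?thesis using Zp_mod[OF f_closed[OF K_inv[OF k]]] by simp
qed

lemma K_comm:
  assumes "k \<in> K" "l \<in> K" shows "k \<otimes> l = l \<otimes> k"
proof -
  have "f (k \<otimes> l) = f (l \<otimes> k)" using f_mult assms by (auto simp: fun_eq_iff add.commute)
  then show ?thesis using f_bij K_mult assms by (auto simp: bij_betw_def inj_on_def)
qed

text \<open>The topological generator of K that corresponds to 1 in the p-adic integers.\<close>

definition gen where "gen = inv_into K f (\<lambda>n. 1 mod int p ^ n)"

lemma gen: "gen \<in> K" "f gen n = 1 mod int p ^ n"
proof -
  have "(\<lambda>n. 1 mod int p ^ n) \<in> f ` K"
    using f_bij Zp_of_int[OF p_pos, of 1] by (simp add: bij_betw_def)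
  from inv_into_into[OF this] f_inv_into_f[OF this]
  show "gen \<in> K" "f gen n = 1 mod int p ^ n" by (simp_all add: gen_def)
qed

lemma f_gen_pow: "f (gen [^] (n::nat)) m = int n mod int p ^ m"
  using f_pow[OF gen(1), of n m] gen(2) by (simp add: mod_mult_right_eq)

text \<open>Level n already detects n, since 0 < n < p^n. The explicit level is what
  \<open>separate_semidirect\<close> uses: the n-th power of the generator of \<Gamma> lies outside
  \<Gamma>^(p^n).\<close>

lemma gen_pow_neq: "n > 0 \<Longrightarrow> f (gen [^] (n::nat)) n \<noteq> 0"
proof -
  assume n: "n > 0"
  have "n < p ^ n" using power_gt_expt[of p n] prime_gt_1_nat[OF prime] by simp
  then have "int n < int p ^ n" by (metis of_nat_less_iff of_nat_power)
  then show ?thesis using f_gen_pow[of n n] n by simp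
qed

lemma gen_pow_neq_one: "n > 0 \<Longrightarrow> gen [^] (n::nat) \<noteq> \<one>"
  using gen_pow_neq f_one by metis

lemma small_in_open: "U \<in> \<N> \<Longrightarrow> \<exists>j. \<forall>k\<in>K. f k j = 0 \<longrightarrow> k \<in> U"
proof -
  assume U: "U \<in> \<N>"
  have "openin (subtopology T K) (U \<inter> K)" using \<N>D(2)[OF U] by (auto simp: openin_subtopology)
  then have o: "openin (Zp_top p) (f ` (U \<inter> K))"
    using f_homeo by (simp add: homeomorphic_map_openness_eq)
  have one: "\<one> \<in> U \<inter> K" using K_one subgroup.one_closed[OF \<N>D(3)[OF U]] by simp
  have "f \<one> = (\<lambda>n. 0)" using f_one by (simp add: fun_eq_iff)
  then have "(\<lambda>n. 0) \<in> f ` (U \<inter> K)" using one by (metis imageI)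
  from Zp_nhd_zero[OF o this] obtain j where j: "\<And>z. z \<in> carrier (Zp p) \<Longrightarrow> z j = 0 \<Longrightarrow> z \<in> f ` (U \<inter> K)" by blast
  have "k \<in> U" if k: "k \<in> K" "f k j = 0" for k
  proof -
    obtain u where u: "u \<in> U \<inter> K" "f k = f u" using j[OF f_closed[OF k(1)] k(2)] by auto
    then have "k = u" using f_bij k by (auto simp: bij_betw_def inj_on_def)
    then show ?thesis using u by simp
  qed
  then show ?thesis by blast
qed

lemma pow_in_open: "k \<in> K \<Longrightarrow> U \<in> \<N> \<Longrightarrow> \<exists>j::nat. k [^] (p ^ j) \<in> U"
proof -
  assume k: "k \<in> K" and U: "U \<in> \<N>"
  obtain j where "\<And>k. k \<in> K \<Longrightarrow> f k j = 0 \<Longrightarrow> k \<in> U" using small_in_open[OF U] by blast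
  then have "k [^] (p ^ j) \<in> U" using K_pow[OF k] f_pow[OF k, of "p ^ j" j] by simp
  then show ?thesis by blast
qed

section \<open>The subgroups K^(p^m) and their generators\<close>

abbreviation Kp where "Kp m \<equiv> power_subgroup G K (p ^ m)"

text \<open>A p-adic integer that is 0 modulo p^m is p^m times another one
  (\<open>Zp_divide\<close>), so it corresponds to a p^m-th power. The description by powers gives
  compactness and normality, the one by f the subgroup laws.\<close>

lemma Kp_eq: "Kp m = {k \<in> K. f k m = 0}"
proof
  show "Kp m \<subseteq> {k \<in> K. f k m = 0}"
    using K_pow f_pow by (auto simp: power_subgroup_def)
  show "{k \<in> K. f k m = 0} \<subseteq> Kp m"
  proof
    fix k assume k: "k \<in> {k \<in> K. f k m = 0}"
    obtain w where w: "w \<in> carrier (Zp p)" "\<And>n. f k n = (int (p ^ m) * w n) mod int p ^ n"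
      using Zp_divide[OF p_pos f_closed, of k m] k by auto
    obtain l where l: "l \<in> K" "w = f l" using w(1) f_bij by (auto simp: bij_betw_def)
    have "f k = f (l [^] (p ^ m))" using w(2) f_pow[OF l(1), of "p ^ m"] l(2) by (simp add: fun_eq_iff)
    then have "k = l [^] (p ^ m)" using f_bij k K_pow[OF l(1)] by (auto simp: bij_betw_def inj_on_def)
    then show "k \<in> Kp m" using l(1) by (auto simp: power_subgroup_def)
  qed
qed

lemma gen_pow_Kp: "gen [^] (p ^ m) \<in> Kp m"
  using gen(1) by (auto simp: power_subgroup_def)

lemma Kp_0: "Kp 0 = K"
proof -
  have "f k 0 = 0" if "k \<in> K" for k
    using f_closed[OF that, unfolded Zp_carrier, rule_format, of 0] by simp
  then show ?thesis unfolding Kp_eq by blast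
qed

lemma Kp_subset: "Kp m \<subseteq> K"
  by (auto simp: Kp_eq)

text \<open>The natural powers of gen^(p^m) are dense in K^(p^m). For some j all elements of K with
  f = 0 modulo p^j lie in U; taking j \<ge> m, the residue of f k modulo p^j is p^m times a natural
  number i, and then k and gen^(p^m i) have the same image modulo U.\<close>

lemma Kp_generated:
  assumes U: "U \<in> \<N>" and k: "k \<in> Kp m"
  shows "\<exists>i::nat. U #> k = U #> ((gen [^] (p ^ m)) [^] i)"
proof -
  obtain j0 where j0: "\<And>k. k \<in> K \<Longrightarrow> f k j0 = 0 \<Longrightarrow> k \<in> U" using small_in_open[OF U] by blast
  define j where "j = max j0 m"
  have kK: "k \<in> K" "f k m = 0" using k by (auto simp: Kp_eq)
  note kZ = f_closed[OF kK(1)]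
  have "int p ^ m dvd f k j"
    using Zp_mod_le[OF kZ, of m j] kK(2) by (simp add: j_def mod_eq_0_iff_dvd)
  then obtain q where q: "f k j = int p ^ m * q" by (rule dvdE)
  have "0 \<le> f k j" using kZ by (simp add: Zp_carrier)
  moreover have "int p ^ m > 0" using p_pos by simp
  ultimately have "q \<ge> 0" using q mult_pos_neg[of "int p ^ m" q] by linarith
  then obtain i where i: "q = int i" using nonneg_int_cases by blast
  define l where "l = gen [^] (p ^ m * i)"
  have l: "l \<in> K" unfolding l_def by (rule K_pow[OF gen(1)])
  have "f l j = f k j mod int p ^ j" using f_gen_pow[of "p ^ m * i" j] by (simp add: l_def q i)
  then have "f l j = f k j" using Zp_mod[OF kZ] by simp
  then have "f (k \<otimes> inv l) j = (f k j + (- f k j) mod int p ^ j) mod int p ^ j"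
    using f_mult[OF kK(1) K_inv[OF l]] f_inv[OF l] by simp
  then have z: "f (k \<otimes> inv l) j = 0" by (simp add: mod_add_right_eq)
  have c: "k \<otimes> inv l \<in> K" by (rule K_mult[OF kK(1) K_inv[OF l]])
  have "f (k \<otimes> inv l) j0 = 0" using Zp_mod_le[OF f_closed[OF c], of j0 j] z by (simp add: j_def)
  then have "k \<otimes> inv l \<in> U" using j0[OF c] by simp
  then have "U #> k = U #> l" using rcos_eq_iff[OF \<N>D(3)[OF U] K_mem[OF kK(1)] K_mem[OF l]] by simp
  then show ?thesis using K_mem[OF gen(1)] by (auto simp: l_def nat_pow_pow)
qed

lemma Kp_subgroup: "subgroup (Kp m) G"
proof (rule subgroupI)
  show "Kp m \<subseteq> carrier G" using Kp_subset K_mem by blast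
  show "Kp m \<noteq> {}" using gen_pow_Kp by blast
  show "inv k \<in> Kp m" if "k \<in> Kp m" for k using that f_inv K_inv by (auto simp: Kp_eq)
  show "k \<otimes> l \<in> Kp m" if "k \<in> Kp m" "l \<in> Kp m" for k l using that f_mult K_mult by (auto simp: Kp_eq)
qed

lemma continuous_pow: "continuous_map T T (\<lambda>x. x [^] (n::nat))"
proof (induction n)
  case 0
  show ?case by (simp add: topspace)
next
  case (Suc n)
  have "continuous_map T T (\<lambda>x. x [^] n \<otimes> x)"
    by (rule continuous_mult[OF Suc continuous_map_id[unfolded id_def]])
  then show ?case by simp
qed

lemma Kp_compact: "compactin T (Kp m)"
  unfolding power_subgroup_def
  by (rule image_compactin[OF closedin_compact_space[OF compact K(2)] continuous_pow])

lemma Kp_normal: "K \<lhd> G \<Longrightarrow> Kp m \<lhd> G"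
  unfolding normal_inv_iff
proof (intro conjI Kp_subgroup ballI)
  assume n: "subgroup K G \<and> (\<forall>x\<in>carrier G. \<forall>h\<in>K. x \<otimes> h \<otimes> inv x \<in> K)"
  fix x h assume x: "x \<in> carrier G" and "h \<in> Kp m"
  then obtain k where k: "k \<in> K" "h = k [^] (p ^ m)" by (auto simp: power_subgroup_def)
  have kc: "k \<in> carrier G" by (rule K_mem[OF k(1)])
  have "(x \<otimes> k \<otimes> inv x) [^] i = x \<otimes> k [^] i \<otimes> inv x" for i :: nat
  proof (induction i)
    case (Suc i)
    then show ?case using x kc by (simp add: m_assoc) (simp flip: m_assoc)
  qed (use x in simp)
  then have "x \<otimes> h \<otimes> inv x = (x \<otimes> k \<otimes> inv x) [^] (p ^ m)" using k by simp
  moreover have "x \<otimes> k \<otimes> inv x \<in> K" using n x k by blast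
  ultimately show "x \<otimes> h \<otimes> inv x \<in> Kp m" by (auto simp: power_subgroup_def)
qed

end

text \<open>V = H \<Gamma>^(p^n) works. It is normal because \<Gamma> is commutative and conjugating
  an element of \<Gamma> by H changes it only by an element of H. It is compact, hence closed, and
  has at most p^n cosets, hence open. As H \<inter> \<Gamma> is trivial, the n-th power of the
  generator could lie in V only by lying in \<Gamma>^(p^n), contrary to
  \<open>gen_pow_neq\<close>.\<close>

lemma (in compact_group) separate_semidirect:
  assumes haus: "Hausdorff_space T" and H: "H \<lhd> G" "closedin T H"
    and zp: "zp_subgroup G T p \<Gamma> f" and int: "H \<inter> \<Gamma> = {\<one>}" and prod: "H <#> \<Gamma> = carrier G" and n: "n > 0"
  shows "\<exists>V\<in>\<N>. H \<subseteq> V \<and> zp_subgroup.gen p \<Gamma> f [^] (n::nat) \<notin> V"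
proof -
  interpret Z: zp_subgroup G T p \<Gamma> f by (rule zp)
  have Hs: "subgroup H G" using H(1) normal_imp_subgroup by blast
  have Hc: "h \<in> carrier G" if "h \<in> H" for h using subgroup.mem_carrier[OF Hs that] .
  define V where "V = H <#> Z.Kp n"
  have Vs: "subgroup V G" unfolding V_def by (rule mult_norm_subgroup[OF H(1) Z.Kp_subgroup])
  have dec: "\<exists>h\<in>H. \<exists>c\<in>\<Gamma>. x = h \<otimes> c" if "x \<in> carrier G" for x
    using that prod[symmetric] by (auto simp: set_mult_mem)
  have V: "h \<otimes> c \<in> V" if "h \<in> H" "c \<in> Z.Kp n" for h c
    using that by (auto simp: V_def set_mult_mem)
  have Vn: "V \<lhd> G" unfolding normal_inv_iff
  proof (intro conjI Vs ballI)
    fix x y assume x: "x \<in> carrier G" and "y \<in> V"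
    then obtain h c where y: "h \<in> H" "c \<in> Z.Kp n" "y = h \<otimes> c" by (auto simp: V_def set_mult_mem)
    obtain h' c' where x': "h' \<in> H" "c' \<in> \<Gamma>" "x = h' \<otimes> c'" using dec[OF x] by blast
    have cG: "c \<in> \<Gamma>" using y(2) Z.Kp_subset by blast
    have cc: "c \<in> carrier G" "c' \<in> carrier G" "h \<in> carrier G" "h' \<in> carrier G"
      using Z.K_mem cG x' y Hc by auto
    have comm: "c' \<otimes> c \<otimes> inv c' = c"
      using Z.K_comm[OF x'(2) cG] cc by (simp add: m_assoc)
    have "x \<otimes> y \<otimes> inv x = h' \<otimes> (c' \<otimes> h \<otimes> inv c') \<otimes> (c' \<otimes> c \<otimes> inv c') \<otimes> inv h'"
      using cc by (simp add: x'(3) y(3) inv_mult_group m_assoc) (simp flip: m_assoc)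
    also have "\<dots> = h' \<otimes> (c' \<otimes> h \<otimes> inv c') \<otimes> (c \<otimes> inv h' \<otimes> inv c) \<otimes> c"
      unfolding comm using cc by (simp add: m_assoc)
    finally have e: "x \<otimes> y \<otimes> inv x = (h' \<otimes> (c' \<otimes> h \<otimes> inv c') \<otimes> (c \<otimes> inv h' \<otimes> inv c)) \<otimes> c" .
    have "h' \<otimes> (c' \<otimes> h \<otimes> inv c') \<otimes> (c \<otimes> inv h' \<otimes> inv c) \<in> H"
      using normal_conj[OF H(1) cc(2) y(1)] normal_conj[OF H(1) cc(1) subgroup.m_inv_closed[OF Hs x'(1)]]
        subgroup.m_closed[OF Hs] x'(1) by blast
    then show "x \<otimes> y \<otimes> inv x \<in> V" unfolding e using V y(2) by blast
  qed
  have "compactin (prod_topology T T) (H \<times> Z.Kp n)"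
    using closedin_compact_space[OF compact H(2)] Z.Kp_compact by (simp add: compactin_Times)
  from image_compactin[OF this cont_mult] have "compactin T ((\<lambda>(x, y). x \<otimes> y) ` (H \<times> Z.Kp n))" .
  moreover have "(\<lambda>(x, y). x \<otimes> y) ` (H \<times> Z.Kp n) = V" by (auto simp: V_def set_mult_def)
  ultimately have Vcl: "closedin T V" using compactin_imp_closedin[OF haus] by simp
  have "rcosets V \<subseteq> (\<lambda>i::nat. V #> (Z.gen [^] i)) ` {..<p ^ n}"
  proof
    fix C assume "C \<in> rcosets V"
    then obtain x where x: "x \<in> carrier G" "C = V #> x" by (auto simp: RCOSETS_def)
    obtain h c where hc: "h \<in> H" "c \<in> \<Gamma>" "x = h \<otimes> c" using dec[OF x(1)] by blast
    have fc: "0 \<le> f c n" "f c n < int p ^ n" using Z.f_closed[OF hc(2)] by (auto simp: Zp_carrier)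
    define i where "i = nat (f c n)"
    have i: "int i = f c n" "i < p ^ n"
      using fc by (simp_all add: i_def nat_less_iff)
    define l where "l = Z.gen [^] i"
    have l: "l \<in> \<Gamma>" unfolding l_def by (rule Z.K_pow[OF Z.gen(1)])
    have fl: "f l n = f c n" using Z.f_gen_pow[of i n] i Zp_mod[OF Z.f_closed[OF hc(2)]] by (simp add: l_def)
    have "f (c \<otimes> inv l) n = 0"
      using Z.f_mult[OF hc(2) Z.K_inv[OF l], of n] Z.f_inv[OF l, of n] fl by (simp add: mod_add_right_eq)
    then have cl: "c \<otimes> inv l \<in> Z.Kp n" using Z.K_mult[OF hc(2) Z.K_inv[OF l]] by (simp add: Z.Kp_eq)
    have "x \<otimes> inv l = h \<otimes> (c \<otimes> inv l)" using hc Hc Z.K_mem l by (simp add: m_assoc)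
    then have "x \<otimes> inv l \<in> V" using V[OF hc(1) cl] by simp
    then have "C = V #> l" using rcos_eq_iff[OF Vs x(1) Z.K_mem[OF l]] x(2) by simp
    then show "C \<in> (\<lambda>i::nat. V #> (Z.gen [^] i)) ` {..<p ^ n}" using i(2) by (auto simp: l_def)
  qed
  then have "finite (rcosets V)" using finite_subset by blast
  then have "openin T V" by (rule closedin_finite_index_imp_openin[OF Vs Vcl])
  then have "V \<in> \<N>" using Vn by (simp add: open_normal_def)
  moreover have "H \<subseteq> V" unfolding V_def by (rule set_mult_subset(1)[OF Hs Z.Kp_subgroup])
  moreover have "Z.gen [^] n \<notin> V"
  proof
    let ?g = "Z.gen [^] n"
    assume "?g \<in> V"
    then obtain h c where hc: "h \<in> H" "c \<in> Z.Kp n" "?g = h \<otimes> c" by (auto simp: V_def set_mult_mem)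
    have c: "c \<in> \<Gamma>" using hc(2) Z.Kp_subset by blast
    have gG: "?g \<in> \<Gamma>" by (rule Z.K_pow[OF Z.gen(1)])
    have "h = ?g \<otimes> inv c" using hc Hc Z.K_mem[OF c] by (simp add: m_assoc)
    then have "h \<in> H \<inter> \<Gamma>" using hc(1) Z.K_mult[OF gG Z.K_inv[OF c]] by simp
    then have "h = \<one>" using int by simp
    then have "?g = c" using hc(3) Z.K_mem[OF c] by simp
    then have "f ?g n = 0" using hc(2) by (simp add: Z.Kp_eq)
    then show False using Z.gen_pow_neq[OF n] by simp
  qed
  ultimately show ?thesis by blast
qed

section \<open>Modules that are finitely generated over the subalgebra\<close>

text \<open>Generators are adjoined one at a time. Since s^e = 1, inverses of powers of s are
  natural powers again, and adjoining s multiplies the number of cosets of D by at most e.\<close>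

lemma (in comm_group) finite_index_extension:
  assumes "subgroup D G" "finite S" "S \<subseteq> carrier G" "e > 0" "\<And>s. s \<in> S \<Longrightarrow> s [^] (e::nat) = \<one>"
  shows "\<exists>P. subgroup P G \<and> D \<subseteq> P \<and> S \<subseteq> P \<and> finite ((\<lambda>x. D #> x) ` P)"
  using assms(2,3,5)
proof (induction S rule: finite_induct)
  case empty
  have "(\<lambda>x. D #> x) ` D \<subseteq> {D}" using coset_join2[OF _ assms(1)] subgroup.mem_carrier[OF assms(1)] by auto
  then show ?case using assms(1) finite_subset by blast
next
  case (insert s S)
  obtain P where P: "subgroup P G" "D \<subseteq> P" "S \<subseteq> P" "finite ((\<lambda>x. D #> x) ` P)"
    using insert by auto
  have s: "s \<in> carrier G" "s [^] e = \<one>" using insert.prems by auto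
  have Pc: "y \<in> carrier G" if "y \<in> P" for y using subgroup.mem_carrier[OF P(1) that] .
  define P' where "P' = {y \<otimes> s [^] i | y (i::nat). y \<in> P}"
  have P'I: "y \<otimes> s [^] i \<in> P'" if "y \<in> P" for y and i :: nat using that by (auto simp: P'_def)
  have PP': "P \<subseteq> P'"
  proof
    fix y assume "y \<in> P"
    then show "y \<in> P'" using P'I[of y 0] Pc by simp
  qed
  have "subgroup P' G"
  proof (rule subgroupI)
    show "P' \<subseteq> carrier G" using Pc s by (auto simp: P'_def)
    show "P' \<noteq> {}" using PP' subgroup.one_closed[OF P(1)] by blast
    show "a \<otimes> b \<in> P'" if a: "a \<in> P'" and b: "b \<in> P'" for a b
    proof -
      obtain y i z j where ab: "a = y \<otimes> s [^] (i::nat)" "y \<in> P" "b = z \<otimes> s [^] (j::nat)" "z \<in> P"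
        using a b by (auto simp: P'_def)
      have "a \<otimes> b = (y \<otimes> z) \<otimes> (s [^] i \<otimes> s [^] j)" using ab Pc s by (simp add: m_ac)
      also have "s [^] i \<otimes> s [^] j = s [^] (i + j)" using s by (simp add: nat_pow_mult)
      finally show ?thesis using P'I subgroup.m_closed[OF P(1) ab(2,4)] by metis
    qed
    show "inv a \<in> P'" if aP: "a \<in> P'" for a
    proof -
      obtain y i where a: "a = y \<otimes> s [^] (i::nat)" "y \<in> P" using aP by (auto simp: P'_def)
      have "i * (e - 1) + i = e * i" using assms(4) by (cases e) auto
      then have "s [^] (i * (e - 1)) \<otimes> s [^] i = s [^] (e * i)" using s by (simp add: nat_pow_mult)
      also have "\<dots> = \<one>" using s nat_pow_pow[OF s(1), of e i] by simp
      finally have "inv (s [^] i) = s [^] (i * (e - 1))" using s by (intro inv_equality) auto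
      then have "inv a = inv y \<otimes> s [^] (i * (e - 1))" using a Pc s by (simp add: inv_mult)
      then show ?thesis using P'I subgroup.m_inv_closed[OF P(1) a(2)] by metis
    qed
  qed
  moreover have "finite ((\<lambda>x. D #> x) ` P')"
  proof -
    have "(\<lambda>x. D #> x) ` P' \<subseteq> (\<lambda>(C, i::nat). C #> s [^] i) ` (((\<lambda>x. D #> x) ` P) \<times> {..<e})"
    proof
      fix C assume "C \<in> (\<lambda>x. D #> x) ` P'"
      then obtain y i where y: "y \<in> P" "C = D #> (y \<otimes> s [^] (i::nat))" by (auto simp: P'_def)
      have "s [^] i = s [^] (i mod e + e * (i div e))" by simp
      also have "\<dots> = s [^] (i mod e) \<otimes> (s [^] e) [^] (i div e)"
        using s(1) by (simp add: nat_pow_mult nat_pow_pow del: mod_mult_div_eq div_mult_mod_eq mult_div_mod_eq mod_div_mult_eq)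
      also have "\<dots> = s [^] (i mod e)" using s by simp
      finally have "C = (D #> y) #> s [^] (i mod e)"
        using y Pc s subgroup.subset[OF assms(1)] by (simp add: coset_mult_assoc)
      then show "C \<in> (\<lambda>(C, i::nat). C #> s [^] i) ` (((\<lambda>x. D #> x) ` P) \<times> {..<e})"
        using y(1) assms(4) by (intro rev_image_eqI[of "(D #> y, i mod e)"]) auto
    qed
    then show ?thesis using P(4) by (meson finite_SigmaI finite_imageI finite_lessThan finite_subset)
  qed
  moreover have "insert s S \<subseteq> P'"
    using PP' P(3) P'I[OF subgroup.one_closed[OF P(1)], of 1] s by auto
  ultimately show ?case using PP' P(2) by blast
qed

locale normal_zp_subgroup = zp_subgroup + iwasawa_ring +
  assumes K_normal: "K \<lhd> G"
begin

abbreviation \<kappa> where "\<kappa> k \<equiv> gen [^] (p ^ k)"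

lemma gen_carrier [simp]: "gen \<in> carrier G"
  using K_mem gen(1) by blast

lemma om_smult:
  assumes "left_module \<Lambda> M" "g \<in> carrier G" "x \<in> carrier M"
  shows "om g \<odot>\<^bsub>M\<^esub> x = \<delta> g \<odot>\<^bsub>M\<^esub> x \<ominus>\<^bsub>M\<^esub> x"
  unfolding om_def by (rule left_module.smult_minus_one[OF assms(1) \<delta>_closed[OF assms(2)] assms(3)])

text \<open>T acts as h - 1, so 1 + T acts as h and \<omega>_k as h^(p^k) - 1. This links the count
  for abstract endomorphisms to elements of \<Lambda>.\<close>

lemma omega_poly_act:
  assumes M: "left_module \<Lambda> M" and x: "x \<in> carrier M"
  shows "poly_act (add_monoid M) (\<lambda>x. om gen \<odot>\<^bsub>M\<^esub> x) (omega_poly p k) x = om (\<kappa> k) \<odot>\<^bsub>M\<^esub> x"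
proof -
  interpret M: left_module \<Lambda> M by (rule M)
  let ?t = "\<lambda>x. om gen \<odot>\<^bsub>M\<^esub> x"
  interpret E: group_endo "add_monoid M" ?t
    using M.a_comm_group M.smult_hom[OF om_closed[OF gen_carrier]]
    by (simp add: group_endo_def group_endo_axioms_def)
  let ?s = "\<lambda>x. \<delta> gen \<odot>\<^bsub>M\<^esub> x"
  have s: "?s y = y \<oplus>\<^bsub>M\<^esub> ?t y" if y: "y \<in> carrier M" for y
  proof -
    have c: "?s y \<in> carrier M" using y by simp
    have "y \<oplus>\<^bsub>M\<^esub> (?s y \<ominus>\<^bsub>M\<^esub> y) = ?s y"
      using c y by (simp add: M.M.minus_eq M.M.a_lcomm[of y "?s y"] M.M.r_neg)
    then show ?thesis using om_smult[OF M gen_carrier y] by simp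
  qed
  have "E.act ([:1, 1:] ^ n) x = (?s ^^ n) x" for n
    by (rule E.act_one_plus_X_pow) (use s x in auto)
  moreover have "(?s ^^ n) x = \<delta> (gen [^] n) \<odot>\<^bsub>M\<^esub> x" for n
  proof (induction n)
    case 0
    show ?case using x one_\<Lambda> M.smult_one[OF x] by simp
  next
    case (Suc n)
    have "gen [^] Suc n = gen \<otimes> gen [^] n" by (rule nat_pow_Suc2[OF gen_carrier])
    then show ?case using Suc x by (simp add: \<delta>_mult_\<delta>[OF ring_\<Lambda>, symmetric] M.smult_assoc)
  qed
  ultimately have P: "E.act ([:1, 1:] ^ (p ^ k)) x = \<delta> (\<kappa> k) \<odot>\<^bsub>M\<^esub> x" by simp
  have xc: "x \<in> carrier (add_monoid M)" using x by simp
  have "[:1, 1:] ^ (p ^ k) = omega_poly p k + 1" by (simp add: omega_poly_def)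
  then have "E.act ([:1, 1:] ^ (p ^ k)) x = E.act (omega_poly p k) x \<oplus>\<^bsub>M\<^esub> x"
    using E.act_add[OF xc, of "omega_poly p k" 1] E.act_1[OF xc] by simp
  then have "\<delta> (\<kappa> k) \<odot>\<^bsub>M\<^esub> x \<ominus>\<^bsub>M\<^esub> x = E.act (omega_poly p k) x"
    using P E.act_closed[OF xc, of "omega_poly p k"] x by (simp add: M.M.minus_eq M.M.a_assoc M.M.r_neg)
  then show ?thesis using om_smult[OF M _ x, of "\<kappa> k"] by simp
qed

text \<open>Modulo the right ideal generated by h - 1 and p^N, an element of \<Lambda>(H) is equal
  to its augmentation. A subgroup P that contains tM and the generators is therefore stable under
  \<Lambda>(H), hence all of M; as M has exponent p^N, such a P exists in which tM has finite
  index.\<close>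

lemma finite_index_om:
  assumes M: "left_module \<Lambda> M" and exp: "\<And>x. x \<in> carrier M \<Longrightarrow> add_pow M (p ^ N) x = \<zero>\<^bsub>M\<^esub>"
    and fg: "fin_gen (Iwasawa_sub p G T K) (restrict_scalars emb M)"
  shows "index (add_monoid M) (carrier M) ((\<lambda>x. om gen \<odot>\<^bsub>M\<^esub> x) ` carrier M) > 0"
proof -
  interpret M: left_module \<Lambda> M by (rule M)
  let ?D = "(\<lambda>x. om gen \<odot>\<^bsub>M\<^esub> x) ` carrier M"
  have D: "subgroup ?D (add_monoid M)"
    using M.smult_image_subgroup[OF om_closed[OF gen_carrier] group.subgroup_self[OF M.a_group]] by simp
  obtain S where S: "finite S" "S \<subseteq> carrier M" "lspan KI.\<Lambda> (restrict_scalars emb M) S = carrier M"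
    using fg by (auto simp: fin_gen_def Iwasawa_sub_eq restrict_scalars_sel)
  have "\<exists>P. subgroup P (add_monoid M) \<and> ?D \<subseteq> P \<and> S \<subseteq> P \<and> finite ((\<lambda>x. ?D #>\<^bsub>add_monoid M\<^esub> x) ` P)"
    by (rule comm_group.finite_index_extension[OF M.a_comm_group D S(1), of "p ^ N"])
       (use S(2) exp p_pos in \<open>auto simp: add_pow_def\<close>)
  then obtain P where P: "subgroup P (add_monoid M)" "?D \<subseteq> P" "S \<subseteq> P" "finite ((\<lambda>x. ?D #>\<^bsub>add_monoid M\<^esub> x) ` P)"
    by blast
  have Pc: "P \<subseteq> carrier M" using M.add_subgroupD(1)[OF P(1)] .
  have "emb a \<odot>\<^bsub>M\<^esub> x \<in> P" if a: "a \<in> carrier KI.\<Lambda>" and x: "x \<in> P" for a x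
  proof -
    have xc: "x \<in> carrier M" using x Pc by blast
    have ea: "emb a \<in> carrier \<Lambda>" by (rule emb_closed[OF a])
    have KN: "K \<in> KI.\<N>" using KI.\<N>_carrier by simp
    have "K \<in> rcosets\<^bsub>GK\<^esub> K" using rcosets_K[of K] coset_join2[OF one_closed K(1) K_one] K_one by (metis imageI)
    then have nn: "0 \<le> a K K N" "a K K N < int p ^ N" using KI.\<Lambda>_value[OF a KN] by (auto simp: Zp_carrier)
    \<comment> \<open>n is the augmentation of a modulo p^N. Below, \<open>van\<close> verifies that
      a - n vanishes modulo p^N at every level containing K, as \<open>om_p_ideal_memI\<close>
      requires.\<close>
    define n where "n = nat (a K K N)"
    have n: "int n = a K K N" using nn by (simp add: n_def)
    let ?n = "add_pow \<Lambda> n \<one>\<^bsub>\<Lambda>\<^esub>"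
    have nc: "?n \<in> carrier \<Lambda>" by simp
    have van: "(emb a \<ominus>\<^bsub>\<Lambda>\<^esub> ?n) U C N = 0" if U: "U \<in> \<N>" "K \<subseteq> U" "C \<in> rcosets U" for U C
    proof -
      have "\<one> \<in> C \<longleftrightarrow> C = U"
        using mem_rcos_iff[OF \<N>D(3)[OF U(1)] one_closed U(3)] coset_mult_one[OF subgroup.subset[OF \<N>D(3)[OF U(1)]]] by simp
      then have "?n U C N = (if C = U then int n mod int p ^ N else 0)"
        using add_pow_\<Lambda>[OF ring_\<Lambda> L.one_closed U(1,3), of n N] one_\<Lambda> \<delta>_value[OF U(1,3), of \<one> N]
        by (simp add: mod_mult_right_eq)
      then show ?thesis
        using add_\<Lambda>[OF U(1,3), of "emb a" "\<ominus>\<^bsub>\<Lambda>\<^esub> ?n" N] minus_\<Lambda>[OF ring_\<Lambda> nc U(1,3), of N]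
          emb_value_above[OF a U, of N] n nn by (simp add: L.minus_eq mod_add_right_eq)
    qed
    have "\<exists>b\<in>carrier \<Lambda>. \<exists>c\<in>carrier \<Lambda>. emb a \<ominus>\<^bsub>\<Lambda>\<^esub> ?n = om gen \<otimes>\<^bsub>\<Lambda>\<^esub> b \<oplus>\<^bsub>\<Lambda>\<^esub> add_pow \<Lambda> (p ^ N) c"
    proof (rule om_p_ideal_memI[OF _ K_normal gen(1)])
      show "\<exists>i::nat. U #> k = U #> (gen [^] i)" if "U \<in> \<N>" "k \<in> K" for U k
        using Kp_generated[OF that(1), of k 0] that(2) Kp_0 K_mem[OF gen(1)] by simp
    qed (use van ea nc in auto)
    then obtain b c where bc: "b \<in> carrier \<Lambda>" "c \<in> carrier \<Lambda>"
      "emb a \<ominus>\<^bsub>\<Lambda>\<^esub> ?n = om gen \<otimes>\<^bsub>\<Lambda>\<^esub> b \<oplus>\<^bsub>\<Lambda>\<^esub> add_pow \<Lambda> (p ^ N) c" by blast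
    have gc: "om gen \<in> carrier \<Lambda>" by simp
    have pc: "add_pow \<Lambda> (p ^ N) c \<in> carrier \<Lambda>" using bc(2) by simp
    let ?w = "om gen \<otimes>\<^bsub>\<Lambda>\<^esub> b \<oplus>\<^bsub>\<Lambda>\<^esub> add_pow \<Lambda> (p ^ N) c"
    have w: "?w \<in> carrier \<Lambda>" using gc bc(1) pc by simp
    have "emb a = (emb a \<ominus>\<^bsub>\<Lambda>\<^esub> ?n) \<oplus>\<^bsub>\<Lambda>\<^esub> ?n"
      using ea nc by (simp add: L.minus_eq L.a_assoc L.l_neg)
    then have "emb a \<odot>\<^bsub>M\<^esub> x = ?w \<odot>\<^bsub>M\<^esub> x \<oplus>\<^bsub>M\<^esub> ?n \<odot>\<^bsub>M\<^esub> x"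
      unfolding bc(3) using M.smult_l_distr[OF w nc xc] by metis
    also have "(om gen \<otimes>\<^bsub>\<Lambda>\<^esub> b \<oplus>\<^bsub>\<Lambda>\<^esub> add_pow \<Lambda> (p ^ N) c) \<odot>\<^bsub>M\<^esub> x =
        om gen \<odot>\<^bsub>M\<^esub> (b \<odot>\<^bsub>M\<^esub> x) \<oplus>\<^bsub>M\<^esub> add_pow M (p ^ N) (c \<odot>\<^bsub>M\<^esub> x)"
      using M.smult_l_distr[OF _ pc xc, of "om gen \<otimes>\<^bsub>\<Lambda>\<^esub> b"] gc bc(1) M.smult_assoc[OF gc bc(1) xc]
        M.add_pow_smult[OF bc(2) xc, of "p ^ N"] by simp
    also have "add_pow M (p ^ N) (c \<odot>\<^bsub>M\<^esub> x) = \<zero>\<^bsub>M\<^esub>"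
      using exp bc(2) xc by simp
    also have "?n \<odot>\<^bsub>M\<^esub> x = add_pow M n x" using M.add_pow_smult[OF L.one_closed xc] xc by simp
    finally have e: "emb a \<odot>\<^bsub>M\<^esub> x = om gen \<odot>\<^bsub>M\<^esub> (b \<odot>\<^bsub>M\<^esub> x) \<oplus>\<^bsub>M\<^esub> add_pow M n x"
      using gc bc(1) xc by simp
    have "add_pow M n x \<in> P"
      using group.subgroup_int_pow_closed[OF M.a_group P(1) x, of "int n"] by (simp add: add_pow_def int_pow_int)
    moreover have "om gen \<odot>\<^bsub>M\<^esub> (b \<odot>\<^bsub>M\<^esub> x) \<in> P" using P(2) bc(1) xc by blast
    ultimately show ?thesis unfolding e using M.add_subgroupD(3)[OF P(1)] by blast
  qed
  then have "submodule P KI.\<Lambda> (restrict_scalars emb M)"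
    using P(1) by (simp add: submodule_restrict_scalars)
  then have "lspan KI.\<Lambda> (restrict_scalars emb M) S \<subseteq> P" using P(3) by (auto simp: lspan_def)
  then have "carrier M = P" using S(3) Pc by blast
  then have "finite ((\<lambda>x. ?D #>\<^bsub>add_monoid M\<^esub> x) ` carrier M)" using P(4) by simp
  then show ?thesis unfolding index_def card_gt_0_iff using M.M.zero_closed by blast
qed

section \<open>Separatedness of compact modules and the growth of their quotients\<close>

text \<open>Since \<open>\<kappa> k - 1\<close> tends to \<open>0\<close> in the Iwasawa algebra, it maps a compact module into any given
  neighbourhood of \<open>0\<close>.\<close>

lemma om_smult_tendsto_zero:
  assumes M: "continuous_module \<Lambda> (Iwasawa_top p G T) M" and x: "x \<in> carrier M" "x \<noteq> \<zero>\<^bsub>M\<^esub>"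
  shows "\<exists>k. \<forall>y\<in>carrier M. om (\<kappa> k) \<odot>\<^bsub>M\<^esub> y \<noteq> x"
proof -
  interpret M: left_module \<Lambda> M using M by (simp add: continuous_module_def)
  obtain TM where TM: "topspace TM = carrier M" "compact_space TM" "Hausdorff_space TM"
    "continuous_map (prod_topology (Iwasawa_top p G T) TM) TM (\<lambda>(r, x). r \<odot>\<^bsub>M\<^esub> x)"
    using M by (auto simp: continuous_module_def)
  have "closedin TM {x}" using TM x by (simp add: closedin_Hausdorff_singleton)
  then have O: "openin TM (topspace TM - {x})" by blast
  \<comment> \<open>The pairs (r, y) with r y \<noteq> x. This open set contains 0 paired with all
    of M, and the tube lemma makes the neighbourhood of 0 uniform in y.\<close>
  let ?W = "{z \<in> topspace (prod_topology (Iwasawa_top p G T) TM). (\<lambda>(r, y). r \<odot>\<^bsub>M\<^esub> y) z \<in> topspace TM - {x}}"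
  have W: "openin (prod_topology (Iwasawa_top p G T) TM) ?W"
    by (rule openin_continuous_map_preimage[OF TM(4) O])
  have tL: "topspace (Iwasawa_top p G T) = carrier \<Lambda>"
  proof
    show "carrier \<Lambda> \<subseteq> topspace (Iwasawa_top p G T)"
    proof
      fix a assume "a \<in> carrier \<Lambda>"
      then show "a \<in> topspace (Iwasawa_top p G T)"
        using \<Lambda>_ext[of a] \<Lambda>_ext'[of a] \<Lambda>_value[of a]
        by (simp add: Iwasawa_top_def PiE_iff topspace_Zp carrier_Mod)
    qed
  qed (auto simp: Iwasawa_top_def)
  have "\<exists>U V. openin (Iwasawa_top p G T) U \<and> openin TM V \<and> \<zero>\<^bsub>\<Lambda>\<^esub> \<in> U \<and> topspace TM \<subseteq> V \<and> U \<times> V \<subseteq> ?W"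
  proof (rule tube_lemma_right[OF W])
    show "compactin TM (topspace TM)" using TM(2) by (simp add: compact_space_def)
    show "{\<zero>\<^bsub>\<Lambda>\<^esub>} \<times> topspace TM \<subseteq> ?W" using TM(1) tL x by auto
  qed (use tL in simp)
  then obtain U V where U: "openin (Iwasawa_top p G T) U" "\<zero>\<^bsub>\<Lambda>\<^esub> \<in> U"
    and V: "topspace TM \<subseteq> V" "U \<times> V \<subseteq> ?W" by (elim exE conjE)
  obtain F where F: "finite F" "F \<subseteq> \<N>"
    "\<And>a. a \<in> carrier \<Lambda> \<Longrightarrow> (\<forall>U\<in>F. \<forall>C\<in>rcosets U. \<forall>n. a U C n = 0) \<Longrightarrow> a \<in> U"
    using \<Lambda>_nhd_zero[OF U] by (elim exE conjE) simp
  obtain U0 where U0: "U0 \<in> \<N>" "\<forall>V\<in>F. U0 \<subseteq> V" using \<N>_Inter[OF F(1,2)] by blast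
  obtain k where k: "\<kappa> k \<in> U0" using pow_in_open[OF gen(1) U0(1)] by blast
  have c: "om (\<kappa> k) \<in> carrier \<Lambda>" by simp
  have "om (\<kappa> k) \<in> U"
  proof (rule F(3)[OF c], intro ballI allI)
    fix V C n assume V: "V \<in> F" "C \<in> rcosets V"
    then have "V \<in> \<N>" "\<kappa> k \<in> V" using F(2) U0(2) k by auto
    then have "(om (\<kappa> k) \<otimes>\<^bsub>\<Lambda>\<^esub> \<one>\<^bsub>\<Lambda>\<^esub>) V C n = 0" by (intro om_mult_vanish[OF L.one_closed _ _ V(2)])
    then show "om (\<kappa> k) V C n = 0" using c by simp
  qed
  have "om (\<kappa> k) \<odot>\<^bsub>M\<^esub> y \<noteq> x" if y: "y \<in> carrier M" for y
  proof -
    have "y \<in> V" using V(1) TM(1) y by blast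
    then have "(om (\<kappa> k), y) \<in> ?W" using subsetD[OF V(2), of "(om (\<kappa> k), y)"] \<open>om (\<kappa> k) \<in> U\<close> by simp
    then show ?thesis by simp
  qed
  then show ?thesis by blast
qed

text \<open>For separatedness, an element of all t^n M lies in \<omega>_k M for every k, since
  t^(p^k N) factors through \<omega>_k, whereas \<open>om_smult_tendsto_zero\<close> keeps a nonzero
  element out of \<omega>_k M for some k.\<close>

lemma module_separated_endo:
  assumes M: "continuous_module \<Lambda> (Iwasawa_top p G T) M"
    and exp: "\<And>x. x \<in> carrier M \<Longrightarrow> add_pow M (p ^ N) x = \<zero>\<^bsub>M\<^esub>"
    and fg: "fin_gen (Iwasawa_sub p G T K) (restrict_scalars emb M)"
  shows "separated_endo (add_monoid M) (\<lambda>x. om gen \<odot>\<^bsub>M\<^esub> x) p N"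
proof -
  have lm: "left_module \<Lambda> M" using M by (simp add: continuous_module_def)
  interpret M: left_module \<Lambda> M by (rule lm)
  let ?t = "\<lambda>x. om gen \<odot>\<^bsub>M\<^esub> x"
  interpret E: group_endo "add_monoid M" ?t
    using M.a_comm_group M.smult_hom[OF om_closed[OF gen_carrier]]
    by (simp add: group_endo_def group_endo_axioms_def)
  have exp': "x [^]\<^bsub>add_monoid M\<^esub> (p ^ N) = \<one>\<^bsub>add_monoid M\<^esub>" if "x \<in> carrier (add_monoid M)" for x
    using exp that by (simp add: add_pow_def)
  show ?thesis
  proof
    show "prime p" by (rule prime)
    show "x [^]\<^bsub>add_monoid M\<^esub> (p ^ N) = \<one>\<^bsub>add_monoid M\<^esub>" if "x \<in> carrier (add_monoid M)" for x
      by (rule exp'[OF that])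
    show "0 < index (add_monoid M) (carrier (add_monoid M)) (?t ` carrier (add_monoid M))"
      using finite_index_om[OF lm exp fg] by simp
    fix x assume x: "x \<in> carrier (add_monoid M)"
      and im: "\<And>n. x \<in> ((\<lambda>x. om gen \<odot>\<^bsub>M\<^esub> x) ^^ n) ` carrier (add_monoid M)"
    show "x = \<one>\<^bsub>add_monoid M\<^esub>"
    proof (rule ccontr)
      assume "x \<noteq> \<one>\<^bsub>add_monoid M\<^esub>"
      then obtain k where k: "\<And>y. y \<in> carrier M \<Longrightarrow> om (\<kappa> k) \<odot>\<^bsub>M\<^esub> y \<noteq> x"
        using om_smult_tendsto_zero[OF M, of x] x by auto
      obtain y where y: "y \<in> carrier M" "x = (?t ^^ (p ^ k * N)) y" using im[of "p ^ k * N"] by auto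
      obtain v where v: "\<And>z. z \<in> carrier (add_monoid M) \<Longrightarrow> (?t ^^ (p ^ k * N)) z = E.act (omega_poly p k) (E.act v z)"
        using E.pow_factors_through_omega_poly[OF prime exp', of k] by blast
      have "x = om (\<kappa> k) \<odot>\<^bsub>M\<^esub> (E.act v y)"
        using v[of y] y omega_poly_act[OF lm, of "E.act v y" k] E.act_closed[of y v] by simp
      then show False using k[of "E.act v y"] E.act_closed[of y v] y by simp
    qed
  qed
qed

theorem module_growth:
  assumes M: "continuous_module \<Lambda> (Iwasawa_top p G T) M"
    and exp: "\<And>x. x \<in> carrier M \<Longrightarrow> add_pow M (p ^ N) x = \<zero>\<^bsub>M\<^esub>"
    and fg: "fin_gen (Iwasawa_sub p G T K) (restrict_scalars emb M)"
  shows "\<exists>(r::nat) \<nu>. \<forall>\<^sub>F k in sequentially.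
    card {x \<in> carrier M. om (\<kappa> k) \<odot>\<^bsub>M\<^esub> x = \<zero>\<^bsub>M\<^esub>} = p ^ \<nu> \<and>
    index (add_monoid M) (carrier M) ((\<lambda>x. om (\<kappa> k) \<odot>\<^bsub>M\<^esub> x) ` carrier M) = p ^ (r * p ^ k + \<nu>)"
proof -
  have lm: "left_module \<Lambda> M" using M by (simp add: continuous_module_def)
  interpret S: separated_endo "add_monoid M" "\<lambda>x. om gen \<odot>\<^bsub>M\<^esub> x" p N
    by (rule module_separated_endo[OF M exp fg])
  have 1: "S.ker k = {x \<in> carrier M. om (\<kappa> k) \<odot>\<^bsub>M\<^esub> x = \<zero>\<^bsub>M\<^esub>}" for k
    using omega_poly_act[OF lm, of _ k] by (auto simp: S.ker_def)
  have 2: "S.act (omega_poly p k) ` carrier (add_monoid M) = (\<lambda>x. om (\<kappa> k) \<odot>\<^bsub>M\<^esub> x) ` carrier M" for k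
    using omega_poly_act[OF lm, of _ k] by simp
  show ?thesis using S.index_omega_eventually unfolding 1 2 by simp
qed

end

section \<open>The elementary module\<close>

lemma fin_gen_p_torsion_exponent:
  assumes "left_module R M" "fin_gen R M" "p_torsion p M"
  shows "\<exists>N. \<forall>x\<in>carrier M. add_pow M (p ^ N) x = \<zero>\<^bsub>M\<^esub>"
proof -
  interpret left_module R M by (rule assms(1))
  obtain S where S: "finite S" "S \<subseteq> carrier M" "lspan R M S = carrier M"
    using assms(2) by (auto simp: fin_gen_def)
  have "\<forall>s\<in>S. \<exists>n::nat. add_pow M (p ^ n) s = \<zero>\<^bsub>M\<^esub>"
    using assms(3) S(2) by (auto simp: p_torsion_def)
  then obtain n where n: "\<And>s. s \<in> S \<Longrightarrow> add_pow M (p ^ n s :: nat) s = \<zero>\<^bsub>M\<^esub>" by metis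
  \<comment> \<open>The sum bounds every \<open>n s\<close> and makes sense for empty S as
    well.\<close>
  define N where "N = sum n S"
  let ?P = "{x \<in> carrier M. add_pow M (p ^ N) x = \<zero>\<^bsub>M\<^esub>}"
  have "S \<subseteq> ?P"
  proof
    fix s assume s: "s \<in> S"
    have "n s \<le> N" unfolding N_def by (intro member_le_sum s S(1)) auto
    then have "p ^ N = p ^ n s * p ^ (N - n s)" by (simp flip: power_add)
    moreover have "(s [^]\<^bsub>add_monoid M\<^esub> (p ^ n s)) [^]\<^bsub>add_monoid M\<^esub> (p ^ (N - n s)) =
        s [^]\<^bsub>add_monoid M\<^esub> (p ^ n s * p ^ (N - n s))"
      using monoid.nat_pow_pow[OF M.a_monoid, of s "p ^ n s" "p ^ (N - n s)"] s S(2) by auto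
    ultimately have "add_pow M (p ^ N) s = add_pow M (p ^ (N - n s)) (add_pow M (p ^ n s) s)"
      by (simp add: add_pow_def)
    then show "s \<in> ?P" using n[OF s] s S(2) by auto
  qed
  moreover have "submodule ?P R M"
  proof (rule submodule.intro)
    have "(\<lambda>x. x [^]\<^bsub>add_monoid M\<^esub> (p ^ N)) \<in> hom (add_monoid M) (add_monoid M)"
      using comm_monoid.nat_pow_distrib[OF comm_group.axioms(1)[OF M.a_comm_group]]
        monoid.nat_pow_closed[OF M.a_monoid] by (auto simp: hom_def)
    then have "group_hom (add_monoid M) (add_monoid M) (\<lambda>x. x [^]\<^bsub>add_monoid M\<^esub> (p ^ N))"
      by (simp add: group_hom_def group_hom_axioms_def M.a_group)
    from group_hom.subgroup_kernel[OF this]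
    show "subgroup ?P (add_monoid M)" by (simp add: kernel_def add_pow_def)
    show "submodule_axioms ?P R M"
      unfolding submodule_axioms_def by (auto simp flip: smult_add_pow)
  qed
  ultimately have "carrier M \<subseteq> ?P" using lspan_minimal S(3) by blast
  then show ?thesis by blast
qed

context iwasawa_ring
begin

abbreviation elementary :: "nat \<Rightarrow> (nat \<Rightarrow> nat) \<Rightarrow> ('a completed, nat \<Rightarrow> 'a completed set) module" where
  "elementary s m \<equiv> direct_sum {1..s} (\<lambda>i. mod_by (regular_module \<Lambda>) (p ^ m i))"

definition cls :: "nat \<Rightarrow> 'a completed \<Rightarrow> 'a completed set" where
  "cls n a = multiples \<Lambda> (p ^ n) +>\<^bsub>regular_module \<Lambda>\<^esub> a"

lemma elementary_left_module: "left_module \<Lambda> (elementary s m)"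
  by (intro direct_sum_left_module ring_\<Lambda>)
     (simp add: mod_by_regular_module left_submodule.quot_left_module[OF L.multiples_submodule])

lemma regular_minus: "x \<ominus>\<^bsub>regular_module R\<^esub> y = x \<ominus>\<^bsub>R\<^esub> y"
  by (simp add: a_minus_def a_inv_def m_inv_def regular_module_def)

lemma cls_eq_iff:
  assumes "x \<in> carrier \<Lambda>" "y \<in> carrier \<Lambda>"
  shows "cls n x = cls n y \<longleftrightarrow> x \<ominus>\<^bsub>\<Lambda>\<^esub> y \<in> multiples \<Lambda> (p ^ n)"
proof -
  interpret S: left_submodule "multiples \<Lambda> (p ^ n)" \<Lambda> "regular_module \<Lambda>" by (rule L.multiples_submodule)
  show ?thesis
    using S.a_rcos_eq_iff[OF S.N_subgroup, of x y] assms
    by (simp add: cls_def regular_minus) (simp add: regular_module_def)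
qed

lemma elementary_carrier:
  "e \<in> carrier (elementary s m) \<longleftrightarrow>
    (\<exists>a. (\<forall>i\<in>{1..s}. a i \<in> carrier \<Lambda>) \<and> e = (\<lambda>i\<in>{1..s}. cls (m i) (a i)))"
proof -
  have c: "carrier (mod_by (regular_module \<Lambda>) (p ^ n)) = cls n ` carrier \<Lambda>" for n
    using left_submodule.carrier_quot[OF L.multiples_submodule, of "p ^ n"]
    by (simp add: mod_by_regular_module cls_def) (simp add: regular_module_def)
  show ?thesis
  proof
    assume e: "e \<in> carrier (elementary s m)"
    then have "\<forall>i\<in>{1..s}. \<exists>a\<in>carrier \<Lambda>. e i = cls (m i) a" by (auto simp: direct_sum_def PiE_iff c)
    then obtain a where a: "\<forall>i\<in>{1..s}. a i \<in> carrier \<Lambda> \<and> e i = cls (m i) (a i)" by metis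
    have "e = (\<lambda>i\<in>{1..s}. e i)" using e by (simp add: direct_sum_def PiE_iff extensional_restrict)
    also have "\<dots> = (\<lambda>i\<in>{1..s}. cls (m i) (a i))" using a by (intro restrict_ext) simp
    finally show "\<exists>a. (\<forall>i\<in>{1..s}. a i \<in> carrier \<Lambda>) \<and> e = (\<lambda>i\<in>{1..s}. cls (m i) (a i))" using a by blast
  qed (auto simp: direct_sum_def PiE_iff c)
qed

lemma elementary_smult:
  assumes "r \<in> carrier \<Lambda>" "\<And>i. i \<in> {1..s} \<Longrightarrow> a i \<in> carrier \<Lambda>"
  shows "r \<odot>\<^bsub>elementary s m\<^esub> (\<lambda>i\<in>{1..s}. cls (m i) (a i)) = (\<lambda>i\<in>{1..s}. cls (m i) (r \<otimes>\<^bsub>\<Lambda>\<^esub> a i))"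
proof -
  have "r \<odot>\<^bsub>mod_by (regular_module \<Lambda>) (p ^ n)\<^esub> cls n x = cls n (r \<otimes>\<^bsub>\<Lambda>\<^esub> x)" if "x \<in> carrier \<Lambda>" for n x
    using left_submodule.smult_quot[OF L.multiples_submodule assms(1), of x "p ^ n"] that
    by (simp add: mod_by_regular_module cls_def) (simp add: regular_module_def)
  then show ?thesis using assms(2) by (auto simp: direct_sum_def intro!: restrict_ext)
qed

lemma elementary_zero: "\<zero>\<^bsub>elementary s m\<^esub> = (\<lambda>i\<in>{1..s}. cls (m i) \<zero>\<^bsub>\<Lambda>\<^esub>)"
proof -
  have "\<zero>\<^bsub>mod_by (regular_module \<Lambda>) (p ^ n)\<^esub> = cls n \<zero>\<^bsub>\<Lambda>\<^esub>" for n
    using left_submodule.zero_quot[OF L.multiples_submodule, of "p ^ n"]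
    by (simp add: mod_by_regular_module cls_def) (simp add: regular_module_def)
  then show ?thesis by (simp add: direct_sum_def)
qed

lemma minus_zero: "x \<in> carrier \<Lambda> \<Longrightarrow> x \<ominus>\<^bsub>\<Lambda>\<^esub> \<zero>\<^bsub>\<Lambda>\<^esub> = x"
  by (simp add: L.minus_eq)

text \<open>B is a quotient of E and gets its exponent from here, whereas A embeds in X and gets it
  from \<open>fin_gen_p_torsion_exponent\<close>.\<close>

lemma elementary_exponent: "\<exists>M. \<forall>e\<in>carrier (elementary s m). add_pow (elementary s m) (p ^ M) e = \<zero>\<^bsub>elementary s m\<^esub>"
proof (intro exI ballI)
  define M where "M = sum m {1..s}"
  fix e assume e: "e \<in> carrier (elementary s m)"
  interpret E: left_module \<Lambda> "elementary s m" by (rule elementary_left_module)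
  obtain a where a: "\<And>i. i \<in> {1..s} \<Longrightarrow> a i \<in> carrier \<Lambda>" "e = (\<lambda>i\<in>{1..s}. cls (m i) (a i))"
    using e unfolding elementary_carrier by blast
  let ?q = "add_pow \<Lambda> (p ^ M) \<one>\<^bsub>\<Lambda>\<^esub>"
  have q: "?q \<in> carrier \<Lambda>" by simp
  have "add_pow (elementary s m) (p ^ M) e = ?q \<odot>\<^bsub>elementary s m\<^esub> e"
    using E.add_pow_smult[OF L.one_closed e, of "p ^ M"] E.smult_one[OF e] by simp
  also have "\<dots> = (\<lambda>i\<in>{1..s}. cls (m i) (?q \<otimes>\<^bsub>\<Lambda>\<^esub> a i))"
    unfolding a(2) by (rule elementary_smult[OF q a(1)])
  also have "\<dots> = (\<lambda>i\<in>{1..s}. cls (m i) \<zero>\<^bsub>\<Lambda>\<^esub>)"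
  proof (rule restrict_ext)
    fix i assume i: "i \<in> {1..s}"
    have c: "?q \<otimes>\<^bsub>\<Lambda>\<^esub> a i = add_pow \<Lambda> (p ^ M) (a i)"
      using L.add_pow_ldistr[OF L.one_closed a(1)[OF i], of "p ^ M"] a(1)[OF i] by simp
    have "m i \<le> M" unfolding M_def using i by (intro member_le_sum) auto
    then have "int p ^ m i dvd int (p ^ M)" by (simp add: le_imp_power_dvd)
    then have "add_pow \<Lambda> (p ^ M) (a i) \<in> multiples \<Lambda> (p ^ m i)"
      using multiples_iff[of "add_pow \<Lambda> (p ^ M) (a i)" "m i"] add_pow_\<Lambda>[OF ring_\<Lambda> a(1)[OF i]] a(1)[OF i]
      by (simp add: mod_eq_0_iff_dvd)
    then show "cls (m i) (?q \<otimes>\<^bsub>\<Lambda>\<^esub> a i) = cls (m i) \<zero>\<^bsub>\<Lambda>\<^esub>"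
      using cls_eq_iff[of "?q \<otimes>\<^bsub>\<Lambda>\<^esub> a i" "\<zero>\<^bsub>\<Lambda>\<^esub>"] a(1)[OF i] by (simp add: c minus_zero)
  qed
  finally show "add_pow (elementary s m) (p ^ sum m {1..s}) e = \<zero>\<^bsub>elementary s m\<^esub>"
    by (simp only: elementary_zero M_def)
qed

lemma elementary_om_inj:
  assumes g: "g \<in> carrier G"
    and sep: "\<And>n::nat. n > 0 \<Longrightarrow> \<exists>V\<in>\<N>. g [^] n \<notin> V"
    and tor: "\<And>V. V \<in> \<N> \<Longrightarrow> \<exists>j::nat. g [^] (p ^ j) \<in> V"
    and e: "e \<in> carrier (elementary s m)" "om g \<odot>\<^bsub>elementary s m\<^esub> e = \<zero>\<^bsub>elementary s m\<^esub>"
  shows "e = \<zero>\<^bsub>elementary s m\<^esub>"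
proof -
  obtain a where a: "\<And>i. i \<in> {1..s} \<Longrightarrow> a i \<in> carrier \<Lambda>" "e = (\<lambda>i\<in>{1..s}. cls (m i) (a i))"
    using e(1) unfolding elementary_carrier by blast
  have gc: "om g \<in> carrier \<Lambda>" using g by simp
  have eq: "(\<lambda>i\<in>{1..s}. cls (m i) (om g \<otimes>\<^bsub>\<Lambda>\<^esub> a i)) = (\<lambda>i\<in>{1..s}. cls (m i) \<zero>\<^bsub>\<Lambda>\<^esub>)"
    using e(2) elementary_smult[OF gc a(1), where m = m] unfolding a(2) elementary_zero by simp
  have "cls (m i) (a i) = cls (m i) \<zero>\<^bsub>\<Lambda>\<^esub>" if i: "i \<in> {1..s}" for i
  proof -
    have "cls (m i) (om g \<otimes>\<^bsub>\<Lambda>\<^esub> a i) = cls (m i) \<zero>\<^bsub>\<Lambda>\<^esub>" using fun_cong[OF eq, of i] i by simp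
    then have mm: "om g \<otimes>\<^bsub>\<Lambda>\<^esub> a i \<in> multiples \<Lambda> (p ^ m i)"
      using cls_eq_iff[of "om g \<otimes>\<^bsub>\<Lambda>\<^esub> a i" "\<zero>\<^bsub>\<Lambda>\<^esub>"] a(1)[OF i] gc by (simp add: minus_zero)
    have "a i \<in> multiples \<Lambda> (p ^ m i)" by (rule om_cancel[OF a(1)[OF i] g sep tor mm])
    then show ?thesis using cls_eq_iff[of "a i" "\<zero>\<^bsub>\<Lambda>\<^esub>"] a(1)[OF i] by (simp add: minus_zero)
  qed
  then show ?thesis unfolding a(2) elementary_zero by (intro restrict_ext)
qed

text \<open>In the application \<kappa> = h^(p^k), K = H^(p^k), and g is a positive power of the
  generator of \<Gamma>; the statement then supplies the hypothesis \<open>fixed\<close> of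
  \<open>max_finite_submodule_F\<close>. Each component is an instance of
  \<open>om_cancel_mod\<close>.\<close>

lemma elementary_om_mod:
  assumes g: "g \<in> carrier G" and K: "K \<lhd> G" "\<kappa> \<in> K"
    and gen: "\<And>U k. U \<in> \<N> \<Longrightarrow> k \<in> K \<Longrightarrow> \<exists>i::nat. U #> k = U #> (\<kappa> [^] i)"
    and sep: "\<And>n::nat. n > 0 \<Longrightarrow> \<exists>V\<in>\<N>. K \<subseteq> V \<and> g [^] n \<notin> V"
    and tor: "\<And>V. V \<in> \<N> \<Longrightarrow> \<exists>j::nat. g [^] (p ^ j) \<in> V"
    and e: "e \<in> carrier (elementary s m)"
      "om g \<odot>\<^bsub>elementary s m\<^esub> e \<in> (\<lambda>e. om \<kappa> \<odot>\<^bsub>elementary s m\<^esub> e) ` carrier (elementary s m)"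
  shows "e \<in> (\<lambda>e. om \<kappa> \<odot>\<^bsub>elementary s m\<^esub> e) ` carrier (elementary s m)"
proof -
  have \<kappa>: "\<kappa> \<in> carrier G" using subgroup.mem_carrier[OF normal_imp_subgroup[OF K(1)] K(2)] .
  have gc: "om g \<in> carrier \<Lambda>" and kc: "om \<kappa> \<in> carrier \<Lambda>" using g \<kappa> by simp_all
  obtain a where a: "\<And>i. i \<in> {1..s} \<Longrightarrow> a i \<in> carrier \<Lambda>" "e = (\<lambda>i\<in>{1..s}. cls (m i) (a i))"
    using e(1) unfolding elementary_carrier by blast
  obtain e' where e': "e' \<in> carrier (elementary s m)" "om g \<odot>\<^bsub>elementary s m\<^esub> e = om \<kappa> \<odot>\<^bsub>elementary s m\<^esub> e'"
    using e(2) by blast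
  obtain a' where a': "\<And>i. i \<in> {1..s} \<Longrightarrow> a' i \<in> carrier \<Lambda>" "e' = (\<lambda>i\<in>{1..s}. cls (m i) (a' i))"
    using e'(1) unfolding elementary_carrier by blast
  have eq: "(\<lambda>i\<in>{1..s}. cls (m i) (om g \<otimes>\<^bsub>\<Lambda>\<^esub> a i)) = (\<lambda>i\<in>{1..s}. cls (m i) (om \<kappa> \<otimes>\<^bsub>\<Lambda>\<^esub> a' i))"
    using e'(2) elementary_smult[OF gc a(1), where m = m] elementary_smult[OF kc a'(1), where m = m] unfolding a(2) a'(2) by simp
  have "\<exists>b\<in>carrier \<Lambda>. cls (m i) (a i) = cls (m i) (om \<kappa> \<otimes>\<^bsub>\<Lambda>\<^esub> b)" if i: "i \<in> {1..s}" for i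
  proof -
    note ai = a(1)[OF i] and ai' = a'(1)[OF i]
    have c: "om g \<otimes>\<^bsub>\<Lambda>\<^esub> a i \<in> carrier \<Lambda>" "om \<kappa> \<otimes>\<^bsub>\<Lambda>\<^esub> a' i \<in> carrier \<Lambda>" using ai ai' gc kc by simp_all
    have "cls (m i) (om g \<otimes>\<^bsub>\<Lambda>\<^esub> a i) = cls (m i) (om \<kappa> \<otimes>\<^bsub>\<Lambda>\<^esub> a' i)" using fun_cong[OF eq, of i] i by simp
    then obtain q where q: "q \<in> carrier \<Lambda>"
      "om g \<otimes>\<^bsub>\<Lambda>\<^esub> a i \<ominus>\<^bsub>\<Lambda>\<^esub> om \<kappa> \<otimes>\<^bsub>\<Lambda>\<^esub> a' i = add_pow \<Lambda> (p ^ m i) q"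
      using cls_eq_iff[OF c] by (auto simp: multiples_def)
    have "om g \<otimes>\<^bsub>\<Lambda>\<^esub> a i = om \<kappa> \<otimes>\<^bsub>\<Lambda>\<^esub> a' i \<oplus>\<^bsub>\<Lambda>\<^esub> (om g \<otimes>\<^bsub>\<Lambda>\<^esub> a i \<ominus>\<^bsub>\<Lambda>\<^esub> om \<kappa> \<otimes>\<^bsub>\<Lambda>\<^esub> a' i)"
      using c by (simp add: L.minus_eq L.a_lcomm[of "om \<kappa> \<otimes>\<^bsub>\<Lambda>\<^esub> a' i"] L.r_neg)
    then have eqn: "om g \<otimes>\<^bsub>\<Lambda>\<^esub> a i = om \<kappa> \<otimes>\<^bsub>\<Lambda>\<^esub> a' i \<oplus>\<^bsub>\<Lambda>\<^esub> add_pow \<Lambda> (p ^ m i) q"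
      unfolding q(2) .
    have "\<exists>b\<in>carrier \<Lambda>. \<exists>c\<in>carrier \<Lambda>. a i = om \<kappa> \<otimes>\<^bsub>\<Lambda>\<^esub> b \<oplus>\<^bsub>\<Lambda>\<^esub> add_pow \<Lambda> (p ^ m i) c"
      by (rule om_cancel_mod[OF ai g K gen sep tor ai' q(1) eqn])
    then obtain b c where bc: "b \<in> carrier \<Lambda>" "c \<in> carrier \<Lambda>" "a i = om \<kappa> \<otimes>\<^bsub>\<Lambda>\<^esub> b \<oplus>\<^bsub>\<Lambda>\<^esub> add_pow \<Lambda> (p ^ m i) c"
      by blast
    have kb: "om \<kappa> \<otimes>\<^bsub>\<Lambda>\<^esub> b \<in> carrier \<Lambda>" using kc bc(1) by simp
    have pc: "add_pow \<Lambda> (p ^ m i) c \<in> carrier \<Lambda>" using bc(2) by simp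
    have "a i \<ominus>\<^bsub>\<Lambda>\<^esub> om \<kappa> \<otimes>\<^bsub>\<Lambda>\<^esub> b = add_pow \<Lambda> (p ^ m i) c"
      unfolding bc(3) using kb pc by (simp add: L.minus_eq L.a_comm[of "om \<kappa> \<otimes>\<^bsub>\<Lambda>\<^esub> b"] L.a_assoc L.r_neg)
    then have "cls (m i) (a i) = cls (m i) (om \<kappa> \<otimes>\<^bsub>\<Lambda>\<^esub> b)"
      using cls_eq_iff[OF ai kb] bc(2) by (auto simp: multiples_def)
    then show ?thesis using bc(1) by blast
  qed
  then obtain b where b: "\<And>i. i \<in> {1..s} \<Longrightarrow> b i \<in> carrier \<Lambda>"
    "\<And>i. i \<in> {1..s} \<Longrightarrow> cls (m i) (a i) = cls (m i) (om \<kappa> \<otimes>\<^bsub>\<Lambda>\<^esub> b i)" by metis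
  have "e = om \<kappa> \<odot>\<^bsub>elementary s m\<^esub> (\<lambda>i\<in>{1..s}. cls (m i) (b i))"
    using elementary_smult[OF kc b(1), where m = m] b(2) unfolding a(2) by (simp cong: restrict_cong)
  moreover have "(\<lambda>i\<in>{1..s}. cls (m i) (b i)) \<in> carrier (elementary s m)"
    unfolding elementary_carrier using b(1) by blast
  ultimately show ?thesis by blast
qed

end

section \<open>Coinvariants\<close>

context normal_zp_subgroup
begin

text \<open>An element of the augmentation ideal of K^(p^k) becomes a measure on G that vanishes at
  all levels containing K^(p^k), so \<open>om_ideal_memI\<close> extracts the factor \<kappa> - 1,
  where \<kappa> is gen^(p^k). Conversely \<kappa> - 1 is itself the image of an element of that
  ideal. By \<open>om_normal\<close> the image of \<kappa> - 1 on X is already a submodule.\<close>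

lemma coinvariants_eq:
  assumes haus: "Hausdorff_space T" and X: "left_module \<Lambda> X"
  shows "coinvariants p G T (Kp k) X = quot_module X ((\<lambda>x. om (\<kappa> k) \<odot>\<^bsub>X\<^esub> x) ` carrier X)"
proof -
  interpret X: left_module \<Lambda> X by (rule X)
  have n: "Kp k \<lhd> G" by (rule Kp_normal[OF K_normal])
  interpret P: iwasawa_subgroup G T p "Kp k"
    using Kp_subgroup compactin_imp_closedin[OF haus Kp_compact]
    by (intro iwasawa_subgroup.intro iwasawa_subgroup_axioms.intro iwasawa_axioms)
  have gk: "\<And>U l. U \<in> \<N> \<Longrightarrow> l \<in> Kp k \<Longrightarrow> \<exists>i::nat. U #> l = U #> ((\<kappa> k) [^] i)"
    by (rule Kp_generated)
  have kc: "\<kappa> k \<in> carrier G" by simp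
  have oc: "om (\<kappa> k) \<in> carrier \<Lambda>" by simp
  let ?W = "(\<lambda>x. om (\<kappa> k) \<odot>\<^bsub>X\<^esub> x) ` carrier X"
  let ?S = "{Iwasawa_emb p G T (Kp k) a \<odot>\<^bsub>X\<^esub> x |a x. a \<in> aug_ideal p G T (Kp k) \<and> x \<in> carrier X}"
  have KN: "Kp k \<in> P.KI.\<N>" using P.KI.\<N>_carrier by simp
  have one: "\<one> \<in> Kp k" using subgroup.one_closed[OF Kp_subgroup] .
  have KR: "Kp k \<in> rcosets\<^bsub>P.GK\<^esub> (Kp k)"
    using P.rcosets_K[of "Kp k"] coset_join2[OF one_closed Kp_subgroup one] one by (metis imageI)
  have aug: "a \<in> aug_ideal p G T (Kp k) \<longleftrightarrow> a \<in> carrier P.KI.\<Lambda> \<and> (\<forall>n. a (Kp k) (Kp k) n = 0)" for a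
    by (simp add: aug_ideal_def P.Iwasawa_sub_eq a_kernel_def kernel_def Zp_sel fun_eq_iff)
  have "lspan \<Lambda> X ?S = ?W"
  proof (rule X.lspan_subset_eqI)
    show "submodule ?W \<Lambda> X"
    proof (rule submodule.intro)
      show "subgroup ?W (add_monoid X)"
        using X.smult_image_subgroup[OF oc group.subgroup_self[OF X.M.a_group]] by simp
      show "submodule_axioms ?W \<Lambda> X"
        unfolding submodule_axioms_def
      proof (intro allI impI)
        fix r y assume r: "r \<in> carrier \<Lambda>" and "y \<in> ?W"
        then obtain x where x: "x \<in> carrier X" "y = om (\<kappa> k) \<odot>\<^bsub>X\<^esub> x" by auto
        obtain r' where r': "r' \<in> carrier \<Lambda>" "r \<otimes>\<^bsub>\<Lambda>\<^esub> om (\<kappa> k) = om (\<kappa> k) \<otimes>\<^bsub>\<Lambda>\<^esub> r'"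
          using om_normal[OF n gen_pow_Kp r gk] by blast
        have "r \<odot>\<^bsub>X\<^esub> y = om (\<kappa> k) \<odot>\<^bsub>X\<^esub> (r' \<odot>\<^bsub>X\<^esub> x)"
          unfolding x(2) using X.smult_assoc[OF r oc x(1)] X.smult_assoc[OF oc r'(1) x(1)] r'(2) by simp
        then show "r \<odot>\<^bsub>X\<^esub> y \<in> ?W" using X.smult_closed[OF r'(1) x(1)] by blast
      qed
    qed
    show "?S \<subseteq> ?W"
    proof
      fix y assume "y \<in> ?S"
      then obtain a x where ax: "a \<in> aug_ideal p G T (Kp k)" "x \<in> carrier X" "y = P.emb a \<odot>\<^bsub>X\<^esub> x" by blast
      have a: "a \<in> carrier P.KI.\<Lambda>" "\<And>n. a (Kp k) (Kp k) n = 0" using ax(1) aug by auto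
      have "\<exists>b\<in>carrier \<Lambda>. P.emb a = om (\<kappa> k) \<otimes>\<^bsub>\<Lambda>\<^esub> b"
        by (rule om_ideal_memI[OF P.emb_closed[OF a(1)] n gen_pow_Kp gk])
           (use P.emb_value_above[OF a(1)] a(2) in auto)
      then obtain b where b: "b \<in> carrier \<Lambda>" "P.emb a = om (\<kappa> k) \<otimes>\<^bsub>\<Lambda>\<^esub> b" by blast
      have "y = om (\<kappa> k) \<odot>\<^bsub>X\<^esub> (b \<odot>\<^bsub>X\<^esub> x)"
        unfolding ax(3) b(2) by (rule X.smult_assoc[OF oc b(1) ax(2)])
      then show "y \<in> ?W" using X.smult_closed[OF b(1) ax(2)] by blast
    qed
    fix y N' assume y: "y \<in> ?W" and N': "submodule N' \<Lambda> X" "?S \<subseteq> N'"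
    then obtain x where x: "x \<in> carrier X" "y = om (\<kappa> k) \<odot>\<^bsub>X\<^esub> x" by auto
    \<comment> \<open>The two points of the support must differ for the coefficients 1 and -1 to be
      placed separately.\<close>
    have ne: "\<kappa> k \<noteq> \<one>" using gen_pow_neq_one[of "p ^ k"] p_pos by simp
    let ?F = "{\<kappa> k, \<one>}" and ?b = "\<lambda>g. if g = \<one> then - 1 else 1 :: int"
    have F: "finite ?F" "?F \<subseteq> Kp k" using gen_pow_Kp one by auto
    have "om (\<kappa> k) = atom ?F ?b"
    proof (rule \<Lambda>_eqI[OF oc])
      show "atom ?F ?b \<in> carrier \<Lambda>" by (rule atom_closed) auto
      fix U C n assume U: "U \<in> \<N>" "C \<in> rcosets U"
      have "om (\<kappa> k) U C n = (\<delta> (\<kappa> k) U C n + (- \<one>\<^bsub>\<Lambda>\<^esub> U C n) mod int p ^ n) mod int p ^ n"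
        unfolding om_def L.minus_eq add_\<Lambda>[OF U] minus_\<Lambda>[OF ring_\<Lambda> L.one_closed U] ..
      also have "\<dots> = atom ?F ?b U C n"
        unfolding one_\<Lambda> using ne by (auto simp: \<delta>_value[OF U] atom_value[OF U] mod_simps)
      finally show "om (\<kappa> k) U C n = atom ?F ?b U C n" .
    qed
    then have e: "om (\<kappa> k) = P.emb (P.KI.atom ?F ?b)" using P.emb_atom[OF F] by simp
    have "P.KI.atom ?F ?b \<in> carrier P.KI.\<Lambda>" by (rule P.KI.atom_closed) (use F in auto)
    moreover have "P.KI.atom ?F ?b (Kp k) (Kp k) n = 0" for n
      unfolding P.KI.atom_value[OF KN KR] using ne gen_pow_Kp one by simp
    ultimately have "P.KI.atom ?F ?b \<in> aug_ideal p G T (Kp k)" unfolding aug by blast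
    then have "y \<in> ?S" unfolding x(2) e using x(1) by blast
    then show "y \<in> N'" using N'(2) by blast
  qed
  then show ?thesis by (simp add: coinvariants_def)
qed

theorem max_finite_submodule_coinvariants:
  fixes A :: "('a completed, 'y) module" and X :: "('a completed, 'x) module" and B :: "('a completed, 'z) module"
  assumes prof: "profinite_group G T"
    and \<Gamma>: "zp_subgroup G T p \<Gamma> f'" and int: "K \<inter> \<Gamma> = {\<one>}" and prod: "K <#> \<Gamma> = carrier G"
    and lm: "left_module \<Lambda> A" "left_module \<Lambda> X" "left_module \<Lambda> B"
    and maps: "\<alpha> \<in> lin_maps \<Lambda> A X" "\<phi> \<in> lin_maps \<Lambda> X (elementary s m)" "\<beta> \<in> lin_maps \<Lambda> (elementary s m) B"
    and exact: "inj_on \<alpha> (carrier A)" "a_kernel X (elementary s m) \<phi> = \<alpha> ` carrier A"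
      "a_kernel (elementary s m) B \<beta> = \<phi> ` carrier X" "\<beta> ` carrier (elementary s m) = carrier B"
    and pos: "index (add_monoid A) (carrier A) ((\<lambda>x. om (\<kappa> k) \<odot>\<^bsub>A\<^esub> x) ` carrier A) > 0"
      "card {b \<in> carrier B. om (\<kappa> k) \<odot>\<^bsub>B\<^esub> b = \<zero>\<^bsub>B\<^esub>} > 0"
  shows "\<exists>X'. max_finite_submodule (Iwasawa_sub p G T \<Gamma>)
      (restrict_scalars (Iwasawa_emb p G T \<Gamma>) (coinvariants p G T (Kp k) X)) X' \<and>
    card X' = index (add_monoid A) (carrier A) ((\<lambda>x. om (\<kappa> k) \<odot>\<^bsub>A\<^esub> x) ` carrier A) *
      card {b \<in> carrier B. om (\<kappa> k) \<odot>\<^bsub>B\<^esub> b = \<zero>\<^bsub>B\<^esub>}"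
proof -
  let ?E = "elementary s m"
  interpret \<Gamma>: zp_subgroup G T p \<Gamma> f' by (rule \<Gamma>)
  have haus: "Hausdorff_space T" using prof by (simp add: profinite_group_def)
  have n: "Kp k \<lhd> G" by (rule Kp_normal[OF K_normal])
  have gk: "\<And>U l. U \<in> \<N> \<Longrightarrow> l \<in> Kp k \<Longrightarrow> \<exists>i::nat. U #> l = U #> ((\<kappa> k) [^] i)"
    by (rule Kp_generated)
  have kc: "\<kappa> k \<in> carrier G" by simp
  interpret S: exact_seq \<Lambda> A X ?E B \<alpha> \<phi> \<beta> "om (\<kappa> k)"
  proof (intro exact_seq.intro exact_seq_axioms.intro lm elementary_left_module maps exact)
    show "om (\<kappa> k) \<in> carrier \<Lambda>" by simp
    show "\<exists>r'\<in>carrier \<Lambda>. r \<otimes>\<^bsub>\<Lambda>\<^esub> om (\<kappa> k) = om (\<kappa> k) \<otimes>\<^bsub>\<Lambda>\<^esub> r'" if "r \<in> carrier \<Lambda>" for r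
      by (rule om_normal[OF n gen_pow_Kp that gk])
    show "e = \<zero>\<^bsub>?E\<^esub>" if e: "e \<in> carrier ?E" "om (\<kappa> k) \<odot>\<^bsub>?E\<^esub> e = \<zero>\<^bsub>?E\<^esub>" for e
    proof (rule elementary_om_inj[OF kc _ _ e])
      \<comment> \<open>The generator of K has infinite order, and open normal subgroups separate
        its nontrivial powers from 1.\<close>
      fix i :: nat assume "i > 0"
      then have "gen [^] (p ^ k * i) \<noteq> \<one>" using gen_pow_neq_one[of "p ^ k * i"] p_pos by simp
      then show "\<exists>V\<in>\<N>. (\<kappa> k) [^] i \<notin> V"
        using profinite_separated[OF prof, of "(\<kappa> k) [^] i"] by (simp add: nat_pow_pow)
    next
      fix V assume "V \<in> \<N>"
      then show "\<exists>j::nat. (\<kappa> k) [^] (p ^ j) \<in> V" by (rule pow_in_open[OF K_pow[OF gen(1)]])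
    qed
  qed
  let ?X' = "(\<lambda>x. S.W +>\<^bsub>X\<^esub> x) ` S.F"
  have co: "coinvariants p G T (Kp k) X = quot_module X S.W"
    unfolding S.W_def by (rule coinvariants_eq[OF haus lm(2)])
  have idx: "index (add_monoid X) S.F S.W > 0" unfolding S.card_F_mod_W using pos by simp
  \<comment> \<open>The unit g of \<open>max_finite_submodule_F\<close> is the topological generator
    of \<Gamma>, which comes from \<Lambda>(\<Gamma>) and is invertible in \<Lambda>.\<close>
  let ?g = "\<Gamma>.gen"
  have gc: "?g \<in> carrier G" using \<Gamma>.K_mem[OF \<Gamma>.gen(1)] .
  have "max_finite_submodule \<Gamma>.KI.\<Lambda> (restrict_scalars \<Gamma>.emb (quot_module X S.W)) ?X'"
  proof (rule S.max_finite_submodule_F[OF idx \<Gamma>.emb_closed])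
    have "\<Gamma>.emb (\<Gamma>.KI.\<delta> ?g) = \<delta> ?g"
      unfolding \<Gamma>.KI.\<delta>_def \<delta>_def by (rule \<Gamma>.emb_atom) (use \<Gamma>.gen(1) in auto)
    moreover have "\<Gamma>.KI.\<delta> ?g \<in> carrier \<Gamma>.KI.\<Lambda>" using \<Gamma>.KI.\<delta>_closed[of ?g] \<Gamma>.gen(1) by simp
    ultimately show "\<delta> ?g \<in> \<Gamma>.emb ` carrier \<Gamma>.KI.\<Lambda>" by (metis imageI)
    show "\<delta> (inv ?g) \<in> carrier \<Lambda>" using gc by simp
    show "\<delta> (inv ?g) \<otimes>\<^bsub>\<Lambda>\<^esub> \<delta> ?g = \<one>\<^bsub>\<Lambda>\<^esub>"
      using \<delta>_mult_\<delta>[OF ring_\<Lambda> inv_closed[OF gc] gc] gc by (simp add: one_\<Lambda>)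
    fix i e assume i: "(i::nat) > 0" and e: "e \<in> carrier ?E"
      "(\<delta> ?g [^]\<^bsub>\<Lambda>\<^esub> i \<ominus>\<^bsub>\<Lambda>\<^esub> \<one>\<^bsub>\<Lambda>\<^esub>) \<odot>\<^bsub>?E\<^esub> e \<in> (\<lambda>e. om (\<kappa> k) \<odot>\<^bsub>?E\<^esub> e) ` carrier ?E"
    have "\<delta> ?g [^]\<^bsub>\<Lambda>\<^esub> i \<ominus>\<^bsub>\<Lambda>\<^esub> \<one>\<^bsub>\<Lambda>\<^esub> = om (?g [^] i)"
      unfolding om_def \<delta>_pow[OF ring_\<Lambda> gc] ..
    then have e2: "om (?g [^] i) \<odot>\<^bsub>?E\<^esub> e \<in> (\<lambda>e. om (\<kappa> k) \<odot>\<^bsub>?E\<^esub> e) ` carrier ?E" using e(2) by simp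
    show "e \<in> (\<lambda>e. om (\<kappa> k) \<odot>\<^bsub>?E\<^esub> e) ` carrier ?E"
    proof (rule elementary_om_mod[OF nat_pow_closed[OF gc] n gen_pow_Kp gk _ _ e(1) e2])
      fix j :: nat assume "j > 0"
      then have "i * j > 0" using i by simp
      from separate_semidirect[OF haus K_normal K(2) \<Gamma> int prod this]
      obtain V where "V \<in> \<N>" "K \<subseteq> V" "?g [^] (i * j) \<notin> V" by blast
      then show "\<exists>V\<in>\<N>. Kp k \<subseteq> V \<and> (?g [^] i) [^] j \<notin> V"
        using Kp_subset[of k] gc by (auto simp: nat_pow_pow)
    next
      fix V assume "V \<in> \<N>"
      then show "\<exists>j::nat. (?g [^] i) [^] (p ^ j) \<in> V" by (rule \<Gamma>.pow_in_open[OF \<Gamma>.K_pow[OF \<Gamma>.gen(1)]])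
    qed
  qed
  then have "max_finite_submodule (Iwasawa_sub p G T \<Gamma>)
      (restrict_scalars (Iwasawa_emb p G T \<Gamma>) (coinvariants p G T (Kp k) X)) ?X'"
    unfolding co \<Gamma>.Iwasawa_sub_eq .
  moreover have "card ?X' = index (add_monoid A) (carrier A) ((\<lambda>x. om (\<kappa> k) \<odot>\<^bsub>A\<^esub> x) ` carrier A) *
      card {b \<in> carrier B. om (\<kappa> k) \<odot>\<^bsub>B\<^esub> b = \<zero>\<^bsub>B\<^esub>}"
    unfolding S.card_image_F S.card_F_mod_W ..
  ultimately show ?thesis by blast
qed

end

section \<open>Transport of exponents along linear maps and assembly of the theorem\<close>

lemma lin_maps_add_pow:
  assumes "h \<in> lin_maps R M N" "left_module R M" "left_module R N" "x \<in> carrier M"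
  shows "h (add_pow M (q::nat) x) = add_pow N q (h x)"
proof -
  have "Group.group (add_monoid M)" "Group.group (add_monoid N)"
    using assms(2,3) by (auto simp: left_module_def intro: abelian_group.a_group)
  then show ?thesis
    using hom_nat_pow[OF lin_maps_hom[OF assms(1)], of x q] assms(4) by (simp add: add_pow_def)
qed

lemma lin_maps_zero:
  assumes "h \<in> lin_maps R M N" "left_module R M" "left_module R N"
  shows "h \<zero>\<^bsub>M\<^esub> = \<zero>\<^bsub>N\<^esub>"
proof -
  have "group_hom (add_monoid M) (add_monoid N) h"
    using assms lin_maps_hom[OF assms(1)]
    by (auto simp: group_hom_def group_hom_axioms_def left_module_def intro: abelian_group.a_group)
  from group_hom.hom_one[OF this] show ?thesis by simp
qed

theorem theorem3p1:
  fixes p :: nat and G :: "'g monoid" and T :: "'g topology" and H \<Gamma> :: "'g set"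
  defines "\<Lambda> \<equiv> Iwasawa p G T" and "T\<Lambda> \<equiv> Iwasawa_top p G T"
    and "\<Lambda>H \<equiv> Iwasawa_sub p G T H" and "\<Lambda>\<Gamma> \<equiv> Iwasawa_sub p G T \<Gamma>"
  assumes "prime p"
    and "profinite_group G T"
    and "H \<lhd> G" "closedin T H"
    and "subgroup \<Gamma> G" "closedin T \<Gamma>"
    and "H \<inter> \<Gamma> = {\<one>\<^bsub>G\<^esub>}" "H <#>\<^bsub>G\<^esub> \<Gamma> = carrier G"
    and "top_group_isomorphic (G\<lparr>carrier := H\<rparr>) (subtopology T H) (add_monoid (Zp p)) (Zp_top p)"
    and "top_group_isomorphic (G\<lparr>carrier := \<Gamma>\<rparr>) (subtopology T \<Gamma>) (add_monoid (Zp p)) (Zp_top p)"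
  shows "\<exists>(\<mu>A :: ('g completed, 'a) module \<Rightarrow> int) (\<nu>A :: ('g completed, 'a) module \<Rightarrow> int)
          (\<nu>B :: ('g completed, 'b) module \<Rightarrow> int).
    \<forall>(X :: ('g completed, 'x) module) A B (s :: nat) (m :: nat \<Rightarrow> nat) \<alpha> \<phi> \<beta>.
      let E = direct_sum {1..s} (\<lambda>i. mod_by (regular_module \<Lambda>) (p ^ m i)) in
        continuous_module \<Lambda> T\<Lambda> X \<and> fin_gen \<Lambda> X \<and> p_torsion p X \<and>
        continuous_module \<Lambda> T\<Lambda> A \<and> fin_gen \<Lambda> A \<and> pseudo_null \<Lambda> A \<and>
        fin_gen \<Lambda>H (restrict_scalars (Iwasawa_emb p G T H) A) \<and>
        continuous_module \<Lambda> T\<Lambda> B \<and> fin_gen \<Lambda> B \<and> pseudo_null \<Lambda> B \<and>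
        fin_gen \<Lambda>H (restrict_scalars (Iwasawa_emb p G T H) B) \<and>
        \<alpha> \<in> lin_maps \<Lambda> A X \<and> \<phi> \<in> lin_maps \<Lambda> X E \<and> \<beta> \<in> lin_maps \<Lambda> E B \<and>
        inj_on \<alpha> (carrier A) \<and> a_kernel X E \<phi> = \<alpha> ` carrier A \<and>
        a_kernel E B \<beta> = \<phi> ` carrier X \<and> \<beta> ` carrier E = carrier B
      \<longrightarrow> (\<forall>\<^sub>F k in sequentially. \<exists>X'.
             max_finite_submodule \<Lambda>\<Gamma>
               (restrict_scalars (Iwasawa_emb p G T \<Gamma>)
                 (coinvariants p G T (power_subgroup G H (p ^ k)) X)) X' \<and>
             real (card X') = real p powi (\<mu>A A * int p ^ k + \<nu>A A + \<nu>B B))"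
proof (cases "ring (Iwasawa p G T)")
  \<comment> \<open>The ring axioms for \<Lambda> are part of \<open>left_module\<close>. Where they
    fail, no X satisfies the hypotheses and the claim is vacuous; in the other case they are
    available as an assumption.\<close>
  case False
  then show ?thesis by (simp add: \<Lambda>_def continuous_module_def left_module_def Let_def)
next
  case True
  obtain f where f: "f \<in> iso (G\<lparr>carrier := H\<rparr>) (add_monoid (Zp p))"
    "homeomorphic_map (subtopology T H) (Zp_top p) f"
    using assms(13) by (auto simp: top_group_isomorphic_def)
  obtain f' where f': "f' \<in> iso (G\<lparr>carrier := \<Gamma>\<rparr>) (add_monoid (Zp p))"
    "homeomorphic_map (subtopology T \<Gamma>) (Zp_top p) f'"
    using assms(14) by (auto simp: top_group_isomorphic_def)
  have iw: "iwasawa G T p"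
    using profinite_compact_group[OF assms(6)] assms(5) by (simp add: iwasawa_def iwasawa_axioms_def)
  have zpH: "zp_subgroup G T p H f"
    using iw assms(7,8) f normal_imp_subgroup[OF assms(7)]
    by (simp add: zp_subgroup_def zp_subgroup_axioms_def iwasawa_subgroup_def iwasawa_subgroup_axioms_def)
  have zp\<Gamma>: "zp_subgroup G T p \<Gamma> f'"
    using iw assms(9,10) f'
    by (simp add: zp_subgroup_def zp_subgroup_axioms_def iwasawa_subgroup_def iwasawa_subgroup_axioms_def)
  interpret N: normal_zp_subgroup G T p H f
    using zpH iw True assms(7)
    by (simp add: normal_zp_subgroup_def normal_zp_subgroup_axioms_def iwasawa_ring_def iwasawa_ring_axioms_def)
  define growth where "growth M r \<nu> \<longleftrightarrow> (\<forall>\<^sub>F k in sequentially.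
    index (add_monoid M) (carrier M) ((\<lambda>x. N.om (N.\<kappa> k) \<odot>\<^bsub>M\<^esub> x) ` carrier M) = p ^ (r * p ^ k + \<nu>))"
    for M :: "('g completed, 'a) module" and r \<nu> :: nat
  define kernel_card where "kernel_card M \<nu> \<longleftrightarrow> (\<forall>\<^sub>F k in sequentially.
    card {x \<in> carrier M. N.om (N.\<kappa> k) \<odot>\<^bsub>M\<^esub> x = \<zero>\<^bsub>M\<^esub>} = p ^ \<nu>)"
    for M :: "('g completed, 'b) module" and \<nu> :: nat
  \<comment> \<open>The exponents are chosen from the module alone, before X, E and the maps are
    fixed, so they depend only on A or only on B. \<open>nA\<close> is chosen relative to
    \<open>rA\<close>.\<close>
  define rA where "rA M = (SOME r. \<exists>\<nu>. growth M r \<nu>)" for M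
  define nA where "nA M = (SOME \<nu>. growth M (rA M) \<nu>)" for M
  define nB where "nB M = (SOME \<nu>. kernel_card M \<nu>)" for M
  have main: "\<forall>\<^sub>F k in sequentially. \<exists>X'.
      max_finite_submodule \<Lambda>\<Gamma> (restrict_scalars (Iwasawa_emb p G T \<Gamma>)
        (coinvariants p G T (power_subgroup G H (p ^ k)) X)) X' \<and>
      real (card X') = real p powi (int (rA A) * int p ^ k + int (nA A) + int (nB B))"
    if X: "continuous_module \<Lambda> T\<Lambda> X" "fin_gen \<Lambda> X" "p_torsion p X"
      and A: "continuous_module \<Lambda> T\<Lambda> A" "fin_gen \<Lambda>H (restrict_scalars (Iwasawa_emb p G T H) A)"
      and B: "continuous_module \<Lambda> T\<Lambda> B" "fin_gen \<Lambda>H (restrict_scalars (Iwasawa_emb p G T H) B)"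
      and maps: "\<alpha> \<in> lin_maps \<Lambda> A X" "\<phi> \<in> lin_maps \<Lambda> X (N.elementary s m)" "\<beta> \<in> lin_maps \<Lambda> (N.elementary s m) B"
      and exact: "inj_on \<alpha> (carrier A)" "a_kernel X (N.elementary s m) \<phi> = \<alpha> ` carrier A"
        "a_kernel (N.elementary s m) B \<beta> = \<phi> ` carrier X" "\<beta> ` carrier (N.elementary s m) = carrier B"
    for X :: "('g completed, 'x) module" and A :: "('g completed, 'a) module"
      and B :: "('g completed, 'b) module" and s m \<alpha> \<phi> \<beta>
  proof -
    have lm: "left_module (Iwasawa p G T) A" "left_module (Iwasawa p G T) X" "left_module (Iwasawa p G T) B"
      using X(1) A(1) B(1) by (simp_all add: continuous_module_def \<Lambda>_def)
    interpret A: left_module "Iwasawa p G T" A by (rule lm(1))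
    obtain N where N: "\<And>x. x \<in> carrier X \<Longrightarrow> add_pow X (p ^ N) x = \<zero>\<^bsub>X\<^esub>"
      using fin_gen_p_torsion_exponent[OF lm(2) X(2)[unfolded \<Lambda>_def] X(3)] by blast
    have NA: "add_pow A (p ^ N) a = \<zero>\<^bsub>A\<^esub>" if a: "a \<in> carrier A" for a
    proof -
      have ac: "add_pow A (p ^ N) a \<in> carrier A" using a by simp
      have z: "\<alpha> \<zero>\<^bsub>A\<^esub> = \<zero>\<^bsub>X\<^esub>" by (rule lin_maps_zero[OF maps(1)[unfolded \<Lambda>_def] lm(1,2)])
      have "\<alpha> (add_pow A (p ^ N) a) = \<alpha> \<zero>\<^bsub>A\<^esub>"
        unfolding lin_maps_add_pow[OF maps(1)[unfolded \<Lambda>_def] lm(1,2) a] z using N lin_mapsD(1)[OF maps(1) a] by simp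
      then show ?thesis using inj_onD[OF exact(1)] ac by simp
    qed
    obtain M where M: "\<And>e. e \<in> carrier (N.elementary s m) \<Longrightarrow>
        add_pow (N.elementary s m) (p ^ M) e = \<zero>\<^bsub>N.elementary s m\<^esub>"
      using N.elementary_exponent[of s m] by blast
    \<comment> \<open>Surjectivity of \<beta> passes the exponent of E on to B, as injectivity of
      \<alpha> passed that of X on to A.\<close>
    have MB: "add_pow B (p ^ M) b = \<zero>\<^bsub>B\<^esub>" if b: "b \<in> carrier B" for b
    proof -
      obtain e where e: "e \<in> carrier (N.elementary s m)" "b = \<beta> e" using b exact(4) by blast
      have z: "\<beta> \<zero>\<^bsub>N.elementary s m\<^esub> = \<zero>\<^bsub>B\<^esub>"
        by (rule lin_maps_zero[OF maps(3)[unfolded \<Lambda>_def] N.elementary_left_module lm(3)])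
      show ?thesis
        unfolding e(2) lin_maps_add_pow[OF maps(3)[unfolded \<Lambda>_def] N.elementary_left_module lm(3) e(1), symmetric] M[OF e(1)] by (rule z)
    qed
    obtain r \<nu> where "\<forall>\<^sub>F k in sequentially. card {x \<in> carrier A. N.om (N.\<kappa> k) \<odot>\<^bsub>A\<^esub> x = \<zero>\<^bsub>A\<^esub>} = p ^ \<nu> \<and>
        index (add_monoid A) (carrier A) ((\<lambda>x. N.om (N.\<kappa> k) \<odot>\<^bsub>A\<^esub> x) ` carrier A) = p ^ (r * p ^ k + \<nu>)"
      using N.module_growth[OF A(1)[unfolded \<Lambda>_def T\<Lambda>_def] NA A(2)[unfolded \<Lambda>H_def]] by blast
    then have r\<nu>: "growth A r \<nu>" unfolding growth_def by (rule eventually_mono) (rule conjunct2)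
    have "\<exists>\<nu>. growth A (rA A) \<nu>"
      unfolding rA_def by (rule someI_ex) (use r\<nu> in blast)
    then have gA: "growth A (rA A) (nA A)" unfolding nA_def by (rule someI_ex)
    obtain r' \<nu>' where "\<forall>\<^sub>F k in sequentially. card {x \<in> carrier B. N.om (N.\<kappa> k) \<odot>\<^bsub>B\<^esub> x = \<zero>\<^bsub>B\<^esub>} = p ^ \<nu>' \<and>
        index (add_monoid B) (carrier B) ((\<lambda>x. N.om (N.\<kappa> k) \<odot>\<^bsub>B\<^esub> x) ` carrier B) = p ^ (r' * p ^ k + \<nu>')"
      using N.module_growth[OF B(1)[unfolded \<Lambda>_def T\<Lambda>_def] MB B(2)[unfolded \<Lambda>H_def]] by blast
    then have "kernel_card B \<nu>'" unfolding kernel_card_def by (rule eventually_mono) (rule conjunct1)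
    then have gB: "kernel_card B (nB B)" unfolding nB_def by (rule someI)
    from eventually_conj[OF gA[unfolded growth_def] gB[unfolded kernel_card_def]]
    show ?thesis
    proof (rule eventually_mono)
      fix k
      assume k: "index (add_monoid A) (carrier A) ((\<lambda>x. N.om (N.\<kappa> k) \<odot>\<^bsub>A\<^esub> x) ` carrier A) = p ^ (rA A * p ^ k + nA A) \<and>
        card {x \<in> carrier B. N.om (N.\<kappa> k) \<odot>\<^bsub>B\<^esub> x = \<zero>\<^bsub>B\<^esub>} = p ^ nB B"
      have pos: "index (add_monoid A) (carrier A) ((\<lambda>x. N.om (N.\<kappa> k) \<odot>\<^bsub>A\<^esub> x) ` carrier A) > 0"
        "card {x \<in> carrier B. N.om (N.\<kappa> k) \<odot>\<^bsub>B\<^esub> x = \<zero>\<^bsub>B\<^esub>} > 0"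
        using k N.p_pos by simp_all
      obtain X' where X': "max_finite_submodule \<Lambda>\<Gamma> (restrict_scalars (Iwasawa_emb p G T \<Gamma>)
          (coinvariants p G T (power_subgroup G H (p ^ k)) X)) X'"
        "card X' = p ^ (rA A * p ^ k + nA A) * p ^ nB B"
        using N.max_finite_submodule_coinvariants[OF assms(6) zp\<Gamma> assms(11,12) lm maps[unfolded \<Lambda>_def] exact pos]
        unfolding \<Lambda>\<Gamma>_def conjunct1[OF k] conjunct2[OF k] by blast
      have "real (card X') = real p ^ (rA A * p ^ k + nA A + nB B)"
        unfolding X'(2) by (simp add: power_add)
      also have "\<dots> = real p powi (int (rA A * p ^ k + nA A + nB B))"
        by (simp only: power_int_of_nat)
      also have "int (rA A * p ^ k + nA A + nB B) = int (rA A) * int p ^ k + int (nA A) + int (nB B)"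
        by simp
      finally show "\<exists>X'. max_finite_submodule \<Lambda>\<Gamma> (restrict_scalars (Iwasawa_emb p G T \<Gamma>)
          (coinvariants p G T (power_subgroup G H (p ^ k)) X)) X' \<and>
        real (card X') = real p powi (int (rA A) * int p ^ k + int (nA A) + int (nB B))"
        using X'(1) by blast
    qed
  qed
  show ?thesis
    unfolding Let_def
    by (rule exI[of _ "\<lambda>A. int (rA A)"], rule exI[of _ "\<lambda>A. int (nA A)"], rule exI[of _ "\<lambda>B. int (nB B)"],
        intro allI impI, elim conjE, rule main) (simp_all only: \<Lambda>_def)
qed

end
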